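(* Let $n\ge2$, let $B$ be the unit ball of $\mathbb{R}^n$ and let $\alpha>0$. Let $G$ and $H$ be N-functions with $g=G'$, $h=H'$, such that for some constants $p^\pm,q^\pm\in(1,n)$ $$p^- G(t)\le t g(t)\le p^+ G(t),\qquad q^- H(t)\le t h(t)\le q^+H(t)\qquad\text{for all } t\ge 0,$$ and $p^+<q^-$. Let $R$ be an N-function satisfying $$\int_0^1 r^{\alpha+n-1}R\left(\|s^{1-n}\|_{L^{\widetilde G}((r,1),s^{n-1}ds)}\right)dr<\infty$$ and suppose that $q^+<r^-:=\inf_{t>0}\frac{tR'(t)}{R(t)}$. Then for any weak solution $u\in X_{rad}(B)$ of $$-\operatorname{div}\left(\frac{g(|\nabla u|)}{|\nabla u|}\nabla u\right)=|x|^\alpha h(u)\ \text{ in } B,\qquad u>0\ \text{ in } B,\qquad u=0\ \text{ on }\partial B,$$ there is a constant $C>0$ such that $\|u\|_{L^\infty(B)}\le C$.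
   Context: An N-function is a function $G:[0,\infty)\to\mathbb{R}$ of the form $G(t)=\int_0^t g(\tau)\,d\tau$, where $g$ is right-continuous on $[0,\infty)$, positive for $t>0$, non-decreasing, $g(0)=0$ and $\lim_{t\to\infty}g(t)=\infty$. One writes $g=G'$, $h=H'$, and $R'$ for the derivatives of $G$, $H$, $R$. The complementary function is $\widetilde G(t)=\sup\{tw-G(w):w>0\}$. For a measure $\mu$ the Luxemburg norm is $\|f\|_{L^G(\Omega;d\mu)}=\inf\{\lambda>0:\int_\Omega G(|f|/\lambda)\,d\mu\le 1\}$; thus $\|s^{1-n}\|_{L^{\widetilde G}((r,1),s^{n-1}ds)}=\inf\{\lambda>0:\int_r^1\widetilde G(s^{1-n}/\lambda)s^{n-1}ds\le1\}$. $L^G(B)=\{u:\int_B G(|u|)dx<\infty\}$, $W^{1,G}(B)=\{u\in L^G(B):\int_B G(|\nabla u|)dx<\infty\}$ with norm $\|u\|_{L^G(B)}+\|\nabla u\|_{L^G(B)}$, and $W^{1,G}_0(B)$ is the closure of $C_0^\infty(B)$ in $W^{1,G}(B)$. $X_{rad}(B)=\{u\in W_0^{1,G}(B): u \text{ is radial}\}$. A weak solution of the problem is a function $u\in W_0^{1,G}(B)$ with $u>0$ a.e. in $B$ and $$\int_B \frac{g(|\nabla u|)}{|\nabla u|}\nabla u\cdot\nabla v\,dx=\int_B|x|^\alpha h(u_+)v\,dx\quad\text{for every } v\in W_0^{1,G}(B),$$ where $u_+=\max\{u,0\}$ and $\frac{g(|\nabla u|)}{|\nabla u|}\nabla u$ is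 read as $0$ where $\nabla u=0$. *)

theory Defs
  imports "HOL-Analysis.Analysis" "HOL-Probability.Essential_Supremum"
begin

section \<open>N-functions\<close>

text \<open>
  Functions on \<open>[0,\<infinity>)\<close> are represented by functions on all reals, of which only the values at
  nonnegative arguments are ever used. The density \<open>g\<close> is a parameter because one writes
  \<open>g = G'\<close>: it is the right derivative of \<open>G\<close> on \<open>[0,\<infinity>)\<close> and thus determined by \<open>G\<close>.
\<close>

definition N_function :: "(real \<Rightarrow> real) \<Rightarrow> (real \<Rightarrow> real) \<Rightarrow> bool" where
  "N_function g G \<longleftrightarrow>
     (\<forall>t\<ge>0. continuous (at_right t) g) \<and>
     (\<forall>t>0. g t > 0) \<and>
     mono_on {0..} g \<and>
     g 0 = 0 \<and>
     filterlim g at_top at_top \<and>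
     (\<forall>t\<ge>0. G t = integral {0..t} g)"

text \<open>
  For an N-function \<open>G\<close> the supremum is over a nonempty set that is bounded above,
  since \<open>G\<close> grows superlinearly.
\<close>

definition complementary :: "(real \<Rightarrow> real) \<Rightarrow> real \<Rightarrow> real" where
  "complementary G t = (SUP w\<in>{0<..}. t * w - G w)"

text \<open>The norm takes values in \<open>[0,\<infinity>]\<close>; it is \<open>\<infinity>\<close> if no admissible \<open>l\<close> exists.\<close>

definition luxemburg_norm :: "'a measure \<Rightarrow> (real \<Rightarrow> real) \<Rightarrow> ('a \<Rightarrow> real) \<Rightarrow> ennreal" where
  "luxemburg_norm M G f =
     (INF l\<in>{l::real. l > 0 \<and> (\<integral>\<^sup>+x. ennreal (G (\<bar>f x\<bar> / l)) \<partial>M) \<le> 1}. ennreal l)"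

section \<open>Test functions and weak gradients\<close>

text \<open>\<open>C_k k\<close>: all partial derivatives up to order \<open>k\<close> exist and are continuous.\<close>

fun C_k :: "nat \<Rightarrow> ('a::euclidean_space \<Rightarrow> real) \<Rightarrow> bool" where
  "C_k 0 f \<longleftrightarrow> continuous_on UNIV f"
| "C_k (Suc k) f \<longleftrightarrow>
     (\<forall>x. f differentiable (at x)) \<and>
     (\<forall>b\<in>Basis. C_k k (\<lambda>x. frechet_derivative f (at x) b))"

definition test_functions :: "'a::euclidean_space set \<Rightarrow> ('a \<Rightarrow> real) set" where
  "test_functions \<Omega> =
     {\<phi>. (\<forall>k. C_k k \<phi>) \<and> compact (closure {x. \<phi> x \<noteq> 0}) \<and> closure {x. \<phi> x \<noteq> 0} \<subseteq> \<Omega>}"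

definition locally_integrable ::
  "'a::euclidean_space set \<Rightarrow> ('a \<Rightarrow> 'b::{banach, second_countable_topology}) \<Rightarrow> bool" where
  "locally_integrable \<Omega> f \<longleftrightarrow>
     (\<forall>K. compact K \<and> K \<subseteq> \<Omega> \<longrightarrow> integrable (lebesgue_on K) f)"

definition has_weak_gradient ::
  "'a::euclidean_space set \<Rightarrow> ('a \<Rightarrow> real) \<Rightarrow> ('a \<Rightarrow> 'a) \<Rightarrow> bool" where
  "has_weak_gradient \<Omega> u U \<longleftrightarrow>
     u \<in> borel_measurable (lebesgue_on \<Omega>) \<and> U \<in> borel_measurable (lebesgue_on \<Omega>) \<and>
     locally_integrable \<Omega> u \<and> locally_integrable \<Omega> U \<and>
     (\<forall>\<phi>\<in>test_functions \<Omega>. \<forall>b\<in>Basis.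
        (LINT x|lebesgue_on \<Omega>. u x * frechet_derivative \<phi> (at x) b) =
        - (LINT x|lebesgue_on \<Omega>. (U x \<bullet> b) * \<phi> x))"

text \<open>
  Weak gradients are unique up to null sets, and the notions below do not depend on the choice
  of a representative.
\<close>

definition weak_gradient ::
  "'a::euclidean_space set \<Rightarrow> ('a \<Rightarrow> real) \<Rightarrow> 'a \<Rightarrow> 'a" where
  "weak_gradient \<Omega> u = (SOME U. has_weak_gradient \<Omega> u U)"

section \<open>Orlicz--Sobolev spaces\<close>

text \<open>
  Elements are functions rather than equivalence classes; two functions that agree almost
  everywhere on \<open>\<Omega>\<close> represent the same element.
\<close>

definition orlicz_space ::
  "'a::euclidean_space set \<Rightarrow> (real \<Rightarrow> real) \<Rightarrow> ('a \<Rightarrow> real) set" where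
  "orlicz_space \<Omega> G =
     {u \<in> borel_measurable (lebesgue_on \<Omega>).
        (\<integral>\<^sup>+x. ennreal (G \<bar>u x\<bar>) \<partial>lebesgue_on \<Omega>) < \<infinity>}"

definition orlicz_sobolev ::
  "'a::euclidean_space set \<Rightarrow> (real \<Rightarrow> real) \<Rightarrow> ('a \<Rightarrow> real) set" where
  "orlicz_sobolev \<Omega> G =
     {u \<in> orlicz_space \<Omega> G.
        (\<exists>U. has_weak_gradient \<Omega> u U) \<and>
        (\<integral>\<^sup>+x. ennreal (G (norm (weak_gradient \<Omega> u x))) \<partial>lebesgue_on \<Omega>) < \<infinity>}"

definition orlicz_sobolev_norm ::
  "'a::euclidean_space set \<Rightarrow> (real \<Rightarrow> real) \<Rightarrow> ('a \<Rightarrow> real) \<Rightarrow> ennreal" where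
  "orlicz_sobolev_norm \<Omega> G u =
     luxemburg_norm (lebesgue_on \<Omega>) G u +
     luxemburg_norm (lebesgue_on \<Omega>) G (\<lambda>x. norm (weak_gradient \<Omega> u x))"

definition orlicz_sobolev_0 ::
  "'a::euclidean_space set \<Rightarrow> (real \<Rightarrow> real) \<Rightarrow> ('a \<Rightarrow> real) set" where
  "orlicz_sobolev_0 \<Omega> G =
     {u \<in> orlicz_sobolev \<Omega> G.
        \<forall>\<epsilon>>0. \<exists>\<phi>\<in>test_functions \<Omega>.
          orlicz_sobolev_norm \<Omega> G (\<lambda>x. u x - \<phi> x) < ennreal \<epsilon>}"

definition X_rad :: "'a::euclidean_space set \<Rightarrow> (real \<Rightarrow> real) \<Rightarrow> ('a \<Rightarrow> real) set" where
  "X_rad \<Omega> G =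
     {u \<in> orlicz_sobolev_0 \<Omega> G.
        \<exists>\<rho>::real \<Rightarrow> real. AE x in lebesgue_on \<Omega>. u x = \<rho> (norm x)}"

section \<open>The boundary value problem\<close>

text \<open>
  The factor \<open>g (norm U) / norm U\<close> applied to \<open>U\<close> vanishes where \<open>U = 0\<close> because
  \<open>c *\<^sub>R 0 = 0\<close>. Integrability is stated explicitly because the Bochner integral of a
  non-integrable function is \<open>0\<close> by convention.
\<close>

definition weak_solution ::
  "'a::euclidean_space set \<Rightarrow> real \<Rightarrow> (real \<Rightarrow> real) \<Rightarrow> (real \<Rightarrow> real) \<Rightarrow> (real \<Rightarrow> real) \<Rightarrow>
   ('a \<Rightarrow> real) \<Rightarrow> bool" where
  "weak_solution \<Omega> \<alpha> g G h u \<longleftrightarrow>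
     u \<in> orlicz_sobolev_0 \<Omega> G \<and>
     (AE x in lebesgue_on \<Omega>. u x > 0) \<and>
     (\<forall>v\<in>orlicz_sobolev_0 \<Omega> G.
        let flux = (\<lambda>x. (g (norm (weak_gradient \<Omega> u x)) / norm (weak_gradient \<Omega> u x)) *\<^sub>R
                        weak_gradient \<Omega> u x)
        in integrable (lebesgue_on \<Omega>) (\<lambda>x. flux x \<bullet> weak_gradient \<Omega> v x) \<and>
           integrable (lebesgue_on \<Omega>) (\<lambda>x. norm x powr \<alpha> * h (max (u x) 0) * v x) \<and>
           (LINT x|lebesgue_on \<Omega>. flux x \<bullet> weak_gradient \<Omega> v x) =
           (LINT x|lebesgue_on \<Omega>. norm x powr \<alpha> * h (max (u x) 0) * v x))"

section \<open>The growth condition\<close>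

text \<open>The norm of \<open>s\<^bsup>1-n\<^esup>\<close> on \<open>(r,1)\<close> with respect to the measure \<open>s\<^bsup>n-1\<^esup> ds\<close>.\<close>

definition radial_weight_norm :: "nat \<Rightarrow> (real \<Rightarrow> real) \<Rightarrow> real \<Rightarrow> ennreal" where
  "radial_weight_norm n G r =
     luxemburg_norm (density (restrict_space lborel {r<..<1}) (\<lambda>s. ennreal (s powr (real n - 1))))
       (complementary G) (\<lambda>s. s powr (1 - real n))"

text \<open>
  For an N-function \<open>G\<close> and \<open>0 < r < 1\<close> this norm is finite (\<open>s\<^bsup>1-n\<^esup>\<close> is bounded on \<open>(r,1)\<close>
  and the complementary function is continuous and vanishes at \<open>0\<close>), so that \<open>enn2real\<close>
  does not lose information.
\<close>

definition growth_condition ::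
  "nat \<Rightarrow> real \<Rightarrow> (real \<Rightarrow> real) \<Rightarrow> (real \<Rightarrow> real) \<Rightarrow> bool" where
  "growth_condition n \<alpha> G R \<longleftrightarrow>
     (\<integral>\<^sup>+r\<in>{0<..<1}. ennreal (r powr (\<alpha> + real n - 1) *
        R (enn2real (radial_weight_norm n G r))) \<partial>lborel) < \<infinity>"

end

theory Submission
  imports Defs "HOL-Real_Asymp.Real_Asymp"
begin

text \<open>
  A radial solution has an absolutely continuous profile \<open>w\<close> on \<open>(0,1)\<close>, and testing the equation with
  radial functions gives \<open>r\<^sup>n\<^sup>-\<^sup>1 g(\<gamma>(r)) = \<integral>\<^sub>0\<^sup>r s\<^sup>\<alpha>\<^sup>+\<^sup>n\<^sup>-\<^sup>1 h(w(s)) ds\<close> for \<open>\<gamma> = -w'\<close>; in particular \<open>w\<close>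
  decreases. Let \<open>m(s) = G\<^sup>-\<^sup>1(s\<^sup>-\<^sup>n)\<close>. Finiteness of \<open>\<integral> s\<^sup>n\<^sup>-\<^sup>1 G(\<gamma>) ds\<close> gives \<open>w(r) \<le> M(r) := K r m(r)\<close>. The norm
  in the growth condition is at least a multiple of \<open>r m(r)\<close>, so that \<open>q\<^sup>+ < r\<^sup>-\<close> yields
  \<open>H(M(r)) \<le> C r\<^sup>\<delta>\<^sup>-\<^sup>(\<^sup>\<alpha>\<^sup>+\<^sup>n\<^sup>)\<close> with some \<open>\<delta> > 0\<close>. With \<open>\<Theta>(r) = sup\<^sub>s\<^sub>\<le>\<^sub>r w(s)/M(s) \<le> 1\<close> the equation and
  \<open>p\<^sup>+ \<le> q\<^sup>-\<close> give \<open>\<gamma> \<le> C r\<^sup>\<epsilon> \<Theta> m\<close>. As \<open>M\<close> decays like a negative power of \<open>r\<close>, this forces \<open>w \<ge> \<Theta> M / 4\<close>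
  near \<open>0\<close>, hence \<open>-w' \<le> C r\<^sup>\<epsilon>\<^sup>-\<^sup>1 w\<close>, which is integrable, and \<open>w\<close> is bounded.
\<close>

section \<open>N-functions and the growth condition\<close>

text \<open>The flux at radius r depends on w on all of (0,r), so the equation gives no local
  inequality between -w' and w. The running supremum \<Theta> carries this nonlocal information.
  Since \<Theta> \<le> 1, its power with exponent (qm - 1)/(pp - 1) \<ge> 1 may be replaced by
  \<Theta> itself, which makes the slope bound linear; the lower bound of w by \<Theta> M then makes
  it local again. The strict inequality between the indices of H and R is the source of the small
  power of r, without which the factor 1/r in the last step would not be integrable at 0. The
  condition p+ < n makes r m(r) blow up at least like a power, so that integrals of m over (r,1/2)
  are controlled by their left end.

  The other obstacle is the passage to one dimension. The solution is radial only almost everywhere,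
  with a profile not assumed measurable, and its weak gradient is an arbitrary representative.
  Spherical means are therefore replaced by densities of image measures under the norm, and no
  integration over spheres occurs.\<close>

lemma N_function_mono: "N_function g G \<Longrightarrow> 0 \<le> a \<Longrightarrow> a \<le> b \<Longrightarrow> g a \<le> g b"
  by (auto simp: N_function_def mono_on_def)

lemma N_function_pos: "N_function g G \<Longrightarrow> 0 < t \<Longrightarrow> 0 < g t"
  by (auto simp: N_function_def)

lemma N_function_nonneg: "N_function g G \<Longrightarrow> 0 \<le> t \<Longrightarrow> 0 \<le> g t"
  by (cases "t = 0") (auto simp: N_function_def intro: less_imp_le)

lemma N_function_integrable:
  assumes "N_function g G" "0 \<le> a"
  shows "g integrable_on {a..b}"
proof -
  have "mono_on {a..b} g"
    using assms by (auto simp: N_function_def mono_on_def)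
  then show ?thesis by (rule integrable_on_mono_on)
qed

lemma N_function_zero: "N_function g G \<Longrightarrow> G 0 = 0"
  by (auto simp: N_function_def)

lemma N_function_diff:
  assumes "N_function g G" "0 \<le> a" "a \<le> b"
  shows "G b - G a = integral {a..b} g"
proof -
  have "integral {0..a} g + integral {a..b} g = integral {0..b} g"
    using assms N_function_integrable[OF assms(1), of 0 b]
    by (intro Henstock_Kurzweil_Integration.integral_combine) auto
  then show ?thesis using assms by (auto simp: N_function_def)
qed

text \<open>Together with the matching upper estimate this is convexity of G in terms of the slopes
  at the two ends. All growth estimates use only these two bounds, because g may jump and G need not
  be differentiable.\<close>

lemma N_function_diff_ge:
  assumes "N_function g G" "0 \<le> a" "a \<le> b"
  shows "(b - a) * g a \<le> G b - G a"
proof -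
  have "integral {a..b} (\<lambda>x. g a) \<le> integral {a..b} g"
    using assms N_function_integrable[OF assms(1,2), of b] N_function_mono[OF assms(1)]
    by (intro integral_le) auto
  then show ?thesis using assms N_function_diff[OF assms] by simp
qed

lemma N_function_diff_le:
  assumes "N_function g G" "0 \<le> a" "a \<le> b"
  shows "G b - G a \<le> (b - a) * g b"
proof -
  have "integral {a..b} g \<le> integral {a..b} (\<lambda>x. g b)"
    using assms N_function_integrable[OF assms(1,2), of b] N_function_mono[OF assms(1)]
    by (intro integral_le) auto
  then show ?thesis using assms N_function_diff[OF assms] by simp
qed

lemma N_function_le: "N_function g G \<Longrightarrow> 0 \<le> a \<Longrightarrow> a \<le> b \<Longrightarrow> G a \<le> G b"
  using N_function_diff_ge[of g G a b] N_function_nonneg[of g G a]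
  by (smt (verit) mult_nonneg_nonneg)

lemma N_function_value_pos:
  assumes G: "N_function g G" and t: "0 < t"
  shows "0 < G t"
proof -
  have "0 < (t - t / 2) * g (t / 2)" using t N_function_pos[OF G, of "t/2"] by simp
  also have "\<dots> \<le> G t - G (t / 2)" using N_function_diff_ge[OF G, of "t/2" t] t by simp
  also have "\<dots> \<le> G t" using N_function_le[OF G, of 0 "t/2"] N_function_zero[OF G] t by simp
  finally show ?thesis .
qed

lemma N_function_value_nonneg: "N_function g G \<Longrightarrow> 0 \<le> t \<Longrightarrow> 0 \<le> G t"
  using N_function_le[of g G 0 t] N_function_zero[of g G] by simp

lemma N_function_less: "N_function g G \<Longrightarrow> 0 \<le> a \<Longrightarrow> a < b \<Longrightarrow> G a < G b"
proof -
  assume *: "N_function g G" "0 \<le> a" "a < b"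
  have "0 < (b - (a+b)/2) * g ((a+b)/2)"
    using * N_function_pos[OF *(1), of "(a+b)/2"] by (intro mult_pos_pos) auto
  then show ?thesis
    using * N_function_diff_ge[OF *(1), of "(a+b)/2" b] N_function_le[OF *(1), of a "(a+b)/2"]
    by auto
qed

lemma N_function_le_iff:
  "N_function g G \<Longrightarrow> 0 \<le> a \<Longrightarrow> 0 \<le> b \<Longrightarrow> G a \<le> G b \<longleftrightarrow> a \<le> b"
  using N_function_less[of g G b a] N_function_le[of g G a b] by linarith

lemma N_function_le_mult: "N_function g G \<Longrightarrow> 0 \<le> t \<Longrightarrow> G t \<le> t * g t"
  using N_function_diff_le[of g G 0 t] N_function_zero[of g G] by simp

lemma N_function_continuous:
  assumes "N_function g G"
  shows "continuous_on {0..b} G"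
proof -
  have "continuous_on {0..b} (\<lambda>x. integral {0..x} g)"
    by (rule indefinite_integral_continuous_1[OF N_function_integrable[OF assms]]) simp
  then show ?thesis
    by (rule continuous_on_eq) (use assms in \<open>auto simp: N_function_def\<close>)
qed

section \<open>Power bounds from the growth indices\<close>

text \<open>With x = c^(1/k), a chain of k steps that each multiply by 1 + p (x - 1) accumulates
  this power; in the limit nothing is lost. The discretisation stands in for integrating g / G,
  which would need a derivative of G.\<close>

lemma root_power_tendsto:
  fixes c p :: real
  assumes "c > 0"
  shows "(\<lambda>k. (1 + p * (c powr (1 / real k) - 1)) powr real k) \<longlonglongrightarrow> c powr p"
  using assms by real_asymp (simp add: powr_def)

text \<open>\<open>G t / t powr p\<close> is non-decreasing. The supporting line at t, of slope g t,
  gives the one-step factor 1 + p (x - 1); split c into k equal factors x, iterate, and let k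
  grow.\<close>

lemma N_function_powr_lower:
  assumes G: "N_function g G" and p: "p \<ge> 0" "\<And>t. t > 0 \<Longrightarrow> p * G t \<le> t * g t"
    and ab: "0 < a" "1 \<le> c"
  shows "c powr p * G a \<le> G (c * a)"
proof -
  have step: "(1 + p * (x - 1)) * G t \<le> G (x * t)" if "t > 0" "x \<ge> 1" for x t
  proof -
    have "(x - 1) * (p * G t) \<le> (x - 1) * (t * g t)"
      using that p(2)[of t] by (intro mult_left_mono) auto
    also have "\<dots> \<le> G (x * t) - G t"
      using N_function_diff_ge[OF G, of t "x*t"] that by (simp add: algebra_simps)
    finally show ?thesis by (simp add: algebra_simps)
  qed
  have pow: "(1 + p * (x - 1)) ^ k * G a \<le> G (x ^ k * a)" if "x \<ge> 1" for x k
  proof (induction k)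
    case (Suc k)
    have "(1 + p * (x - 1)) ^ Suc k * G a \<le> (1 + p * (x - 1)) * G (x ^ k * a)"
      using Suc that p by (simp add: mult.assoc mult_left_mono)
    also have "\<dots> \<le> G (x * (x ^ k * a))"
      using step[of "x ^ k * a" x] that ab by auto
    finally show ?case by (simp add: mult.assoc)
  qed simp
  have ev: "\<forall>\<^sub>F k in sequentially. (1 + p * (c powr (1 / real k) - 1)) powr real k * G a \<le> G (c * a)"
    using eventually_gt_at_top[of 0]
  proof eventually_elim
    case (elim k)
    have x: "c powr (1 / real k) \<ge> 1" using ab by (simp add: ge_one_powr_ge_zero)
    have "(1 + p * (c powr (1 / real k) - 1)) powr real k = (1 + p * (c powr (1 / real k) - 1)) ^ k"
      using x p by (intro powr_realpow) (smt (verit) mult_nonneg_nonneg)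
    moreover have "(c powr (1 / real k)) ^ k = c"
      using elim ab by (simp add: powr_realpow[symmetric] powr_powr)
    ultimately show ?case using pow[OF x, of k] by simp
  qed
  have "(\<lambda>k. (1 + p * (c powr (1 / real k) - 1)) powr real k * G a) \<longlonglongrightarrow> c powr p * G a"
    using ab by (intro tendsto_mult root_power_tendsto tendsto_const) auto
  then show ?thesis
    by (rule tendsto_upperbound[OF _ ev]) simp
qed

text \<open>The same discretisation towards 0: for x \<le> 1 the slope g t at the right end bounds
  the loss G t - G (x t) from above.\<close>

lemma N_function_powr_upper:
  assumes G: "N_function g G" and p: "p \<ge> 0" "\<And>t. t > 0 \<Longrightarrow> t * g t \<le> p * G t"
    and ab: "0 < a" "0 < c" "c \<le> 1"
  shows "c powr p * G a \<le> G (c * a)"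
proof -
  have step: "(1 + p * (x - 1)) * G t \<le> G (x * t)" if "t > 0" "x \<le> 1" "x > 0" for x t
  proof -
    have "G t - G (x * t) \<le> (1 - x) * (t * g t)"
      using N_function_diff_le[OF G, of "x*t" t] that
      by (simp add: algebra_simps mult_left_le_one_le)
    also have "\<dots> \<le> (1 - x) * (p * G t)"
      using that p(2)[of t] by (intro mult_left_mono) auto
    finally show ?thesis by (simp add: algebra_simps)
  qed
  have pow: "(1 + p * (x - 1)) ^ k * G a \<le> G (x ^ k * a)" if "x \<le> 1" "x > 0" "1 + p * (x - 1) \<ge> 0" for x k
  proof (induction k)
    case (Suc k)
    have "(1 + p * (x - 1)) ^ Suc k * G a \<le> (1 + p * (x - 1)) * G (x ^ k * a)"
      using Suc that p by (simp add: mult.assoc mult_left_mono)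
    also have "\<dots> \<le> G (x * (x ^ k * a))"
      using step[of "x ^ k * a" x] that ab by auto
    finally show ?case by (simp add: mult.assoc)
  qed simp
  \<comment> \<open>The one-step factor may be negative while \<open>c powr (1 / real k)\<close> is
    far from 1, and the iteration multiplies an inequality by it. It is positive for large
    k.\<close>
  have "(\<lambda>k. 1 + p * (c powr (1 / real k) - 1)) \<longlonglongrightarrow> 1"
    using ab by real_asymp
  then have "\<forall>\<^sub>F k in sequentially. 0 < 1 + p * (c powr (1 / real k) - 1)"
    by (rule order_tendstoD) simp
  then have ev: "\<forall>\<^sub>F k in sequentially. (1 + p * (c powr (1 / real k) - 1)) powr real k * G a \<le> G (c * a)"
    using eventually_gt_at_top[of 0]
  proof eventually_elim
    case (elim k)
    have x: "c powr (1 / real k) \<le> 1" "c powr (1 / real k) > 0"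
      using ab by (auto simp add: powr_le1)
    have "(1 + p * (c powr (1 / real k) - 1)) powr real k = (1 + p * (c powr (1 / real k) - 1)) ^ k"
      using elim by (intro powr_realpow) auto
    moreover have "(c powr (1 / real k)) ^ k = c"
      using elim ab by (simp add: powr_realpow[symmetric] powr_powr)
    ultimately show ?case using pow[OF x, of k] elim by simp
  qed
  have "(\<lambda>k. (1 + p * (c powr (1 / real k) - 1)) powr real k * G a) \<longlonglongrightarrow> c powr p * G a"
    using ab by (intro tendsto_mult root_power_tendsto tendsto_const) auto
  then show ?thesis
    by (rule tendsto_upperbound[OF _ ev]) simp
qed

lemma N_function_powr_lower':
  assumes "N_function g G" "p \<ge> 0" "\<And>t. t > 0 \<Longrightarrow> p * G t \<le> t * g t" "0 < a" "0 < c" "c \<le> 1"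
  shows "G (c * a) \<le> c powr p * G a"
  using N_function_powr_lower[OF assms(1-3), of "c * a" "1 / c"] assms(4-)
  by (simp add: powr_divide field_simps)

lemma N_function_powr_upper':
  assumes "N_function g G" "p \<ge> 0" "\<And>t. t > 0 \<Longrightarrow> t * g t \<le> p * G t" "0 < a" "1 \<le> c"
  shows "G (c * a) \<le> c powr p * G a"
  using N_function_powr_upper[OF assms(1-3), of "c * a" "1 / c"] assms(4-)
  by (simp add: powr_divide field_simps)

text \<open>The exponent 1 is available for every N-function, since G t \<le> t g t by convexity and
  G 0 = 0.\<close>

lemma N_function_superlinear:
  "N_function g G \<Longrightarrow> 0 < a \<Longrightarrow> 1 \<le> c \<Longrightarrow> c * G a \<le> G (c * a)"
  using N_function_powr_lower[of g G 1 a c] N_function_le_mult[of g G] by simp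

lemma N_function_surj:
  assumes G: "N_function g G" and y: "0 < y"
  shows "\<exists>t>0. G t = y"
proof -
  define T where "T = max 1 (y / G 1)"
  have T: "y \<le> G T"
  proof -
    have "T * G 1 \<le> G T" using N_function_superlinear[OF G, of 1 T] by (simp add: T_def)
    moreover have "y \<le> T * G 1"
      using N_function_value_pos[OF G, of 1] by (simp add: T_def max_def field_simps)
    ultimately show ?thesis by simp
  qed
  have "\<exists>t\<ge>0. t \<le> T \<and> G t = y"
    using y T N_function_zero[OF G] N_function_continuous[OF G, of T]
    by (intro IVT') (auto simp: T_def)
  then obtain t where "t \<ge> 0" "G t = y" by auto
  moreover have "t \<noteq> 0" using \<open>G t = y\<close> N_function_zero[OF G] y by auto
  ultimately show ?thesis by (intro exI[of _ t]) auto
qed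

section \<open>The complementary function and the radial weight norm\<close>

text \<open>Beyond a point T with g T \<ge> t the function G grows at least as fast as t w, so
  larger w do not increase the supremum. Boundedness has to be known before the real-valued supremum
  in \<open>complementary\<close> can be compared with its members.\<close>

lemma complementary_bdd:
  assumes G: "N_function g G"
  shows "bdd_above ((\<lambda>w. t * w - G w) ` {0<..})"
proof -
  have "filterlim g at_top at_top" using G by (simp add: N_function_def)
  then have "\<forall>\<^sub>F x in at_top. t \<le> g x" by (simp add: filterlim_at_top)
  then obtain T0 where T0: "\<And>x. x \<ge> T0 \<Longrightarrow> t \<le> g x" by (auto simp: eventually_at_top_linorder)
  define T where "T = max T0 1"
  have T: "T > 0" "t \<le> g T" using T0[of T] by (auto simp: T_def)
  have "t * w - G w \<le> \<bar>t\<bar> * T" if "w > 0" for w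
  proof (cases "w \<le> T")
    case True
    have "t * w \<le> \<bar>t\<bar> * T" using True that by (intro mult_mono) auto
    then show ?thesis using N_function_value_nonneg[OF G, of w] that by simp
  next
    case False
    have "(w - T) * t \<le> (w - T) * g T" using T False by (intro mult_left_mono) auto
    also have "\<dots> \<le> G w - G T" using N_function_diff_ge[OF G, of T w] T False by simp
    finally have "t * w - G w \<le> t * T" using N_function_value_nonneg[OF G, of T] T
      by (simp add: algebra_simps)
    also have "\<dots> \<le> \<bar>t\<bar> * T" using T by (intro mult_right_mono) auto
    finally show ?thesis .
  qed
  then show ?thesis by (auto intro!: bdd_aboveI2)
qed

lemma complementary_ge:
  assumes "N_function g G" "w > 0"
  shows "t * w - G w \<le> complementary G t"
  unfolding complementary_def using assms complementary_bdd[OF assms(1), of t]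
  by (intro cSUP_upper) auto

text \<open>If t \<le> G 1, then w > 1 contributes nothing positive, since G w \<ge> w G 1 \<ge> t
  w. This smallness produces admissible scalings in the Luxemburg norm.\<close>

lemma complementary_le:
  assumes G: "N_function g G" and t: "0 \<le> t" "t \<le> G 1"
  shows "complementary G t \<le> t"
  unfolding complementary_def
proof (rule cSUP_least)
  fix w :: real assume "w \<in> {0<..}"
  then have w: "w > 0" by simp
  show "t * w - G w \<le> t"
  proof (cases "w \<le> 1")
    case True
    then have "t * w \<le> t" using t w by (simp add: mult_left_le)
    then show ?thesis using N_function_value_nonneg[OF G, of w] w by simp
  next
    case False
    have "w * t \<le> w * G 1" using t w by (intro mult_left_mono) auto
    also have "\<dots> \<le> G w" using N_function_superlinear[OF G, of 1 w] False by simp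
    finally show ?thesis using t by (simp add: mult.commute)
  qed
qed auto

text \<open>The scaling l brings the weight below min 1 (G 1), where the complementary function is
  at most its argument, hence at most 1; the measure of (r,1) is at most 1 as well. Finiteness
  matters because \<open>enn2real\<close> sends \<infinity> to 0, which would destroy the lower
  bound on the norm.\<close>

lemma radial_weight_norm_finite:
  assumes G: "N_function g G" and r: "0 < r" "r < 1" and n: "n \<ge> 1"
  shows "radial_weight_norm n G r < \<infinity>"
proof -
  let ?M = "density (restrict_space lborel {r<..<1}) (\<lambda>s. ennreal (s powr (real n - 1)))"
  define l where "l = r powr (1 - real n) / min 1 (G 1)"
  have G1: "G 1 > 0" using N_function_value_pos[OF G] by simp
  have l: "l > 0" using r G1 by (simp add: l_def)
  have "(\<integral>\<^sup>+s. ennreal (complementary G (\<bar>s powr (1 - real n)\<bar> / l)) \<partial>?M) \<le> (\<integral>\<^sup>+s. 1 \<partial>?M)"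
  proof (rule nn_integral_mono, rule ennreal_le_1[THEN iffD2])
    fix s assume "s \<in> space ?M"
    then have s: "r < s" "s < 1" by (auto simp: space_restrict_space)
    have "s powr (1 - real n) \<le> r powr (1 - real n)"
      using s r n by (intro powr_mono2') auto
    then have "\<bar>s powr (1 - real n)\<bar> / l \<le> r powr (1 - real n) / l"
      using l by (intro divide_right_mono) auto
    also have "\<dots> = min 1 (G 1)" using r G1 by (simp add: l_def)
    finally have le: "\<bar>s powr (1 - real n)\<bar> / l \<le> min 1 (G 1)" .
    then have "complementary G (\<bar>s powr (1 - real n)\<bar> / l) \<le> \<bar>s powr (1 - real n)\<bar> / l"
      using l by (intro complementary_le[OF G]) auto
    then show "complementary G (\<bar>s powr (1 - real n)\<bar> / l) \<le> 1" using le by simp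
  qed
  also have "\<dots> = (\<integral>\<^sup>+s. ennreal (s powr (real n - 1)) * indicator {r<..<1} s \<partial>lborel)"
    by (subst nn_integral_density) (auto simp: nn_integral_restrict_space intro!: measurable_restrict_space1)
  also have "\<dots> \<le> (\<integral>\<^sup>+s. indicator {r<..<1} s \<partial>lborel)"
    using r n by (intro nn_integral_mono) (auto simp: indicator_def powr_le1)
  also have "\<dots> \<le> 1" using r by (simp add: ennreal_le_1)
  finally have "radial_weight_norm n G r \<le> ennreal l"
    unfolding radial_weight_norm_def luxemburg_norm_def using l by (intro INF_lower) auto
  then show ?thesis by (simp add: le_less_trans)
qed

text \<open>Young's inequality with the fixed value w = m bounds the complementary function from
  below by an affine function. Integrating over the shell (r,2r), contained in (r,1) up to its end
  because r \<le> 1/2, is enough: since G m = r^(-n), the subtracted term costs only a dimensional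
  constant, and every admissible l satisfies r m / l \<le> 1 + 2^n.\<close>

lemma radial_weight_norm_ge:
  assumes G: "N_function g G" and r: "0 < r" "r \<le> 1/2" and n: "n \<ge> 1"
    and m: "0 < m" "G m = r powr - real n"
  shows "r * m \<le> (1 + 2 ^ n) * enn2real (radial_weight_norm n G r)"
proof -
  let ?M = "density (restrict_space lborel {r<..<1}) (\<lambda>s. ennreal (s powr (real n - 1)))"
  have bound: "r * m / (1 + 2 ^ n) \<le> l"
    if l: "l > 0" and le: "(\<integral>\<^sup>+s. ennreal (complementary G (\<bar>s powr (1 - real n)\<bar> / l)) \<partial>?M) \<le> 1" for l
  proof -
    define c where "c = (\<lambda>s. s powr (1 - real n) / l * m - G m)"
    \<comment> \<open>A lower bound for the weighted integrand on the shell. It may be negative;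
      \<open>ennreal\<close> then truncates it to 0, which is harmless because only r d \<le> 1 is
      extracted.\<close>
    define d where "d = m / l - 2 ^ n / r"
    have [measurable]: "c \<in> borel_measurable borel" unfolding c_def by measurable
    have c: "d \<le> s powr (real n - 1) * c s" if s: "r < s" "s < 2 * r" for s
    proof -
      have "s powr (real n - 1) * c s = m / l - r powr - real n * s powr (real n - 1)"
        using s r by (simp add: c_def m algebra_simps flip: powr_add)
      moreover have "r powr - real n * s powr (real n - 1) \<le> r powr - real n * (2 * r) powr (real n - 1)"
        using s r n by (intro mult_left_mono powr_mono2) auto
      moreover have "r powr - real n * (2 * r) powr (real n - 1) = 2 powr (real n - 1) / r"
        using r by (simp add: powr_mult powr_diff powr_minus field_simps)
      moreover have "2 powr (real n - 1) / r \<le> 2 ^ n / r"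
        using r by (intro divide_right_mono) (auto simp: powr_diff powr_realpow)
      ultimately show ?thesis unfolding d_def by linarith
    qed
    have "ennreal (r * d) \<le> (\<integral>\<^sup>+s. ennreal d * indicator {r<..<2 * r} s \<partial>lborel)"
      using r by (subst nn_integral_cmult_indicator)
        (auto simp: ennreal_mult''[symmetric] mult.commute)
    also have "\<dots> \<le> (\<integral>\<^sup>+s. ennreal (s powr (real n - 1)) * ennreal (c s) * indicator {r<..<1} s \<partial>lborel)"
      using r c by (intro nn_integral_mono) (auto simp: indicator_def ennreal_mult'[symmetric] intro!: ennreal_leI)
    also have "\<dots> = (\<integral>\<^sup>+s. ennreal (c s) \<partial>?M)"
      by (subst nn_integral_density) (auto simp: nn_integral_restrict_space intro!: measurable_restrict_space1)
    also have "\<dots> \<le> (\<integral>\<^sup>+s. ennreal (complementary G (\<bar>s powr (1 - real n)\<bar> / l)) \<partial>?M)"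
      unfolding c_def
      by (intro nn_integral_mono ennreal_leI order_trans[OF complementary_ge[OF G m(1)]]) simp
    also note le
    finally have "r * d \<le> 1" by simp
    then have "r * m / l \<le> 1 + 2 ^ n" using r by (simp add: d_def algebra_simps)
    then show ?thesis using l by (simp add: field_simps add_pos_pos)
  qed
  have "ennreal (r * m / (1 + 2 ^ n)) \<le> radial_weight_norm n G r"
    unfolding radial_weight_norm_def luxemburg_norm_def using bound
    by (intro INF_greatest ennreal_leI) auto
  moreover have "radial_weight_norm n G r < \<infinity>"
    using r by (intro radial_weight_norm_finite[OF G _ _ n]) auto
  ultimately have "r * m / (1 + 2 ^ n) \<le> enn2real (radial_weight_norm n G r)"
    using r m by (subst (asm) ennreal_enn2real[symmetric]) (auto simp: top.not_eq_extremum)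
  then show ?thesis by (simp add: field_simps add_pos_pos)
qed

text \<open>The function \<open>m\<close> is \<open>s \<mapsto> G\<^sup>-\<^sup>1(s\<^sup>-\<^sup>n)\<close>.\<close>

lemma profile_decay:
  assumes G: "N_function g G" and p: "0 < p" "\<And>t. t > 0 \<Longrightarrow> t * g t \<le> p * G t"
    and m: "\<And>s. s > 0 \<Longrightarrow> m s > 0 \<and> G (m s) = s powr - real n"
    and rs: "0 < r" "r \<le> s"
  shows "m s \<le> (r / s) powr (real n / p) * m r"
proof -
  \<comment> \<open>The exponent is chosen so that
    \<open>c powr p * s powr - n = r powr - n\<close>, that is, c^p G (m s) = G (m r).\<close>
  define c where "c = (s / r) powr (real n / p)"
  have c: "c \<ge> 1" using rs p by (simp add: c_def ge_one_powr_ge_zero)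
  have "G (c * m s) \<le> c powr p * G (m s)"
    using p m[of s] rs c by (intro N_function_powr_upper'[OF G]) auto
  also have "\<dots> = G (m r)"
    using p rs m[of s] m[of r] by (simp add: c_def powr_powr powr_divide powr_minus_divide)
  finally have "c * m s \<le> m r"
    using N_function_le_iff[OF G, of "c * m s" "m r"] c m[of s] m[of r] rs by simp
  then have "m s \<le> 1 / c * m r" using c by (simp add: pos_le_divide_eq mult.commute)
  moreover have "(r / s) powr (real n / p) = 1 / c"
    using rs by (simp add: c_def powr_divide)
  ultimately show ?thesis by simp
qed

text \<open>Since n / p \<ge> 1, the decay of m is at least as fast as that of 1/s.\<close>

lemma profile_antimono:
  assumes G: "N_function g G" and p: "0 < p" "p \<le> real n" "\<And>t. t > 0 \<Longrightarrow> t * g t \<le> p * G t"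
    and m: "\<And>s. s > 0 \<Longrightarrow> m s > 0 \<and> G (m s) = s powr - real n"
    and rs: "0 < r" "r \<le> s"
  shows "s * m s \<le> r * m r"
proof -
  have "m s \<le> (r / s) powr (real n / p) * m r" by (rule profile_decay[OF G p(1,3) m rs])
  also have "\<dots> \<le> (r / s) powr 1 * m r"
    using rs p m[of r] by (intro mult_right_mono powr_mono') auto
  finally show ?thesis using rs by (simp add: field_simps)
qed

section \<open>From the growth condition to a bound on H along the profile\<close>

text \<open>An integral bound becomes a pointwise one because the integrand on the shell (r/2,r) can
  be bounded below by data at r: the norm at s is at least s m(s) / (1 + 2^n), this dominates the
  same expression at r, and R is monotone.\<close>

lemma growth_condition_pointwise:
  assumes G: "N_function g G" and p: "0 < p" "p \<le> real n" "\<And>t. t > 0 \<Longrightarrow> t * g t \<le> p * G t"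
    and m: "\<And>s. s > 0 \<Longrightarrow> m s > 0 \<and> G (m s) = s powr - real n"
    and R: "N_function R' R" and gc: "growth_condition n \<alpha> G R" and n: "n \<ge> 1" and \<alpha>: "\<alpha> > 0"
  shows "\<exists>C>0. \<forall>r. 0 < r \<longrightarrow> r \<le> 1/2 \<longrightarrow> R (r * m r / (1 + 2 ^ n)) \<le> C * r powr - (\<alpha> + real n)"
proof -
  define a where "a = \<alpha> + real n"
  define I where "I = (\<integral>\<^sup>+r\<in>{0<..<1}. ennreal (r powr (\<alpha> + real n - 1) *
        R (enn2real (radial_weight_norm n G r))) \<partial>lborel)"
  have I: "I < \<infinity>" using gc by (simp add: growth_condition_def I_def)
  have "R (r * m r / (1 + 2 ^ n)) \<le> (2 powr a * (1 + enn2real I)) * r powr - a" if r: "0 < r" "r \<le> 1/2" for r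
  proof -
    let ?K = "R (r * m r / (1 + 2 ^ n))"
    have K: "?K \<ge> 0" using r m[of r] by (intro N_function_value_nonneg[OF R]) auto
    have "ennreal ((r / 2) powr a * ?K) = (\<integral>\<^sup>+s. ennreal ((r / 2) powr (a - 1) * ?K) * indicator {r/2<..<r} s \<partial>lborel)"
      using r K by (subst nn_integral_cmult_indicator)
        (auto simp: ennreal_mult[symmetric] powr_diff)
    also have "\<dots> \<le> I"
      unfolding I_def
    proof (intro nn_integral_mono)
      fix s :: real
      show "ennreal ((r / 2) powr (a - 1) * ?K) * indicator {r/2<..<r} s
        \<le> ennreal (s powr (\<alpha> + real n - 1) * R (enn2real (radial_weight_norm n G s))) * indicator {0<..<1} s"
      proof (cases "s \<in> {r/2<..<r}")
        case True
        then have s: "0 < s" "s < r" "r / 2 < s" "s \<le> 1/2" using r by auto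
        have "r * m r \<le> s * m s" using s by (intro profile_antimono[OF G p m]) auto
        also have "\<dots> \<le> (1 + 2 ^ n) * enn2real (radial_weight_norm n G s)"
          using s m[of s] by (intro radial_weight_norm_ge[OF G _ _ n]) auto
        finally have "r * m r / (1 + 2 ^ n) \<le> enn2real (radial_weight_norm n G s)"
          by (simp add: field_simps add_pos_pos)
        then have "?K \<le> R (enn2real (radial_weight_norm n G s))"
          using r m[of r] by (intro N_function_le[OF R]) auto
        moreover have "(r / 2) powr (a - 1) \<le> s powr (\<alpha> + real n - 1)"
          using s r n \<alpha> by (simp add: a_def powr_mono2)
        ultimately show ?thesis using s r K by (auto simp: indicator_def intro!: ennreal_leI mult_mono)
      qed auto
    qed
    finally have "(r / 2) powr a * ?K \<le> enn2real I"
      using I K by (subst (asm) ennreal_enn2real[symmetric]) (auto simp: top.not_eq_extremum)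
    then have "(r / 2) powr a * ?K \<le> 1 + enn2real I" by simp
    then show ?thesis using r by (simp add: powr_divide powr_minus field_simps)
  qed
  then show ?thesis
    by (intro exI[of _ "2 powr a * (1 + enn2real I)"]) (auto simp: a_def intro!: mult_pos_pos add_pos_nonneg)
qed

text \<open>Put t = c M r. For t \<ge> 1 the lower power bound of R turns the bound on R t into
  t^\<rho> \<le> const r^(-a), while H grows at most like t^q; together they give r^(-a q / \<rho>).
  The strict inequality q < \<rho> leaves the gain a (1 - q / \<rho>) over the exponent -a.\<close>

lemma H_profile_bound:
  assumes H: "N_function h H" and q: "0 < q" "\<And>t. t > 0 \<Longrightarrow> t * h t \<le> q * H t"
    and R: "N_function R' R" and \<rho>: "q < \<rho>" "\<And>t. t > 0 \<Longrightarrow> \<rho> * R t \<le> t * R' t"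
    and c: "0 < c" and a: "0 < a"
    and C: "C > 0" "\<And>r. 0 < r \<Longrightarrow> r \<le> 1/2 \<Longrightarrow> R (c * M r) \<le> C * r powr - a"
    and M: "\<And>r. 0 < r \<Longrightarrow> M r > 0" and K: "0 < K"
  shows "\<exists>C1>0. \<forall>r. 0 < r \<longrightarrow> r \<le> 1/2 \<longrightarrow> H (K * M r) \<le> C1 * r powr (a * (1 - q / \<rho>) - a)"
proof -
  \<comment> \<open>The summand 1 serves the case t < 1, where H is bounded and the power of r is at
    least 1; the power of C / R 1 serves t \<ge> 1.\<close>
  define B where "B = H (K / c) * (1 + (C / R 1) powr (q / \<rho>))"
  have R1: "R 1 > 0" using N_function_value_pos[OF R] by simp
  have HK: "H (K / c) > 0" using N_function_value_pos[OF H] K c by simp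
  have "H (K * M r) \<le> B * r powr (a * (1 - q / \<rho>) - a)" if r: "0 < r" "r \<le> 1/2" for r
  proof -
    define t where "t = c * M r"
    have t: "t > 0" using M r c by (simp add: t_def)
    have KM: "K * M r = t * (K / c)" using c by (simp add: t_def)
    have e: "r powr (a * (1 - q / \<rho>) - a) = (r powr - a) powr (q / \<rho>)"
      using r by (simp add: powr_powr algebra_simps)
    have e1: "(r powr - a) powr (q / \<rho>) \<ge> 1"
      using r a q \<rho> by (simp add: powr_powr powr_minus ge_one_powr_ge_zero one_le_inverse powr_le1)
    show ?thesis
    proof (cases "t \<ge> 1")
      case True
      have "t powr \<rho> * R 1 \<le> R t"
        using N_function_powr_lower[OF R, of \<rho> 1 t] \<rho> q True by simp
      also have "\<dots> \<le> C * r powr - a" using C r by (simp add: t_def)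
      finally have "t powr \<rho> \<le> C / R 1 * r powr - a" using R1 by (simp add: field_simps)
      then have "(t powr \<rho>) powr (q / \<rho>) \<le> (C / R 1 * r powr - a) powr (q / \<rho>)"
        using q \<rho> by (intro powr_mono2) auto
      then have tq: "t powr q \<le> (C / R 1) powr (q / \<rho>) * (r powr - a) powr (q / \<rho>)"
        using q \<rho> C R1 unfolding powr_mult powr_powr by simp
      have "H (K * M r) \<le> t powr q * H (K / c)"
        unfolding KM using q K c True by (intro N_function_powr_upper'[OF H]) auto
      also have "\<dots> \<le> ((C / R 1) powr (q / \<rho>) * (r powr - a) powr (q / \<rho>)) * H (K / c)"
        using tq HK by (intro mult_right_mono) auto
      also have "\<dots> \<le> B * (r powr - a) powr (q / \<rho>)"
        using HK by (simp add: B_def algebra_simps)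
      finally show ?thesis by (simp only: e)
    next
      case False
      have "H (K * M r) \<le> H (K / c)"
        unfolding KM using False t K c mult_right_mono[of t 1 "K / c"]
        by (intro N_function_le[OF H]) auto
      also have "\<dots> \<le> B * 1" using HK by (simp add: B_def algebra_simps)
      also have "\<dots> \<le> B * (r powr - a) powr (q / \<rho>)"
        using e1 HK by (intro mult_left_mono) (auto simp: B_def)
      finally show ?thesis by (simp only: e)
    qed
  qed
  moreover have "B > 0" using HK by (auto simp: B_def intro!: mult_pos_pos add_pos_nonneg)
  ultimately show ?thesis by blast
qed

section \<open>Power integrals on intervals\<close>

lemma lint_powr_0:
  fixes d r :: real
  assumes "d > 0" "r > 0"
  shows "set_integrable lborel {0<..<r} (\<lambda>s. s powr (d - 1))"
    "(LINT s:{0<..<r}|lborel. s powr (d - 1)) = r powr d / d"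
proof -
  have hi: "((\<lambda>s. s powr (d - 1)) has_integral (r powr d / d)) {0..r}"
    using has_integral_powr_from_0[of "d - 1" r] assms by simp
  have abs: "(\<lambda>s. s powr (d - 1)) absolutely_integrable_on {0..r}"
    using hi by (intro nonnegative_absolutely_integrable_1) (auto simp: integrable_on_def)
  then have si: "set_integrable lborel {0..r} (\<lambda>s. s powr (d - 1))"
    unfolding set_integrable_def
    by (subst integrable_completion[symmetric]) auto
  then show "set_integrable lborel {0<..<r} (\<lambda>s. s powr (d - 1))"
    by (rule set_integrable_subset) auto
  have "(LINT s:{0<..<r}|lborel. s powr (d - 1)) = (LINT s:{0..r}|lborel. s powr (d - 1))"
    by (intro set_integral_cong_set AE_I'[of "{0,r}"])
      (auto simp: set_borel_measurable_def intro!: countable_imp_null_set_lborel)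
  also have "\<dots> = r powr d / d"
    using set_borel_integral_eq_integral(2)[OF si] hi by (simp add: integral_unique)
  finally show "(LINT s:{0<..<r}|lborel. s powr (d - 1)) = r powr d / d" .
qed

text \<open>For a decay exponent above 1 the integral is controlled by the left end alone, uniformly
  in r. This is how a positive \<kappa> is exploited.\<close>

lemma lint_powr_decay:
  fixes a t r :: real
  assumes "a > 1" "0 < t" "t \<le> r"
  shows "set_integrable lborel {t..r} (\<lambda>s. (t / s) powr a)"
    "(LINT s:{t..r}|lborel. (t / s) powr a) \<le> t / (a - 1)"
proof -
  show si: "set_integrable lborel {t..r} (\<lambda>s. (t / s) powr a)"
    using assms by (intro borel_integrable_atLeastAtMost' continuous_intros) auto
  have "(LINT s:{t..r}|lborel. (t / s) powr a) = integral {t..r} (\<lambda>s. (t / s) powr a)"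
    using set_borel_integral_eq_integral(2)[OF si] .
  moreover have "((\<lambda>s. (t / s) powr a) has_integral (- (t / (a - 1)) * (t / r) powr (a - 1) - (- (t / (a - 1)) * (t / t) powr (a - 1)))) {t..r}"
  proof (rule fundamental_theorem_of_calculus)
    fix s assume s: "s \<in> {t..r}"
    have "((\<lambda>s. t / s) has_real_derivative - t / (s * s)) (at s)"
      using assms s by (auto intro!: derivative_eq_intros)
    from DERIV_cmult[OF DERIV_chain2[OF has_real_derivative_powr[where r="a - 1"] this], of "- (t / (a - 1))"]
    have "((\<lambda>s. - (t / (a - 1)) * (t / s) powr (a - 1)) has_real_derivative
        - (t / (a - 1)) * ((a - 1) * (t / s) powr (a - 1 - 1) * (- t / (s * s)))) (at s)"
      using assms s by simp
    also have "- (t / (a - 1)) * ((a - 1) * (t / s) powr (a - 1 - 1) * (- t / (s * s))) = (t / s) powr a"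
      using assms s by (simp add: powr_diff field_simps power2_eq_square)
    finally show "((\<lambda>s. - (t / (a - 1)) * (t / s) powr (a - 1)) has_vector_derivative (t / s) powr a) (at s within {t..r})"
      by (simp add: has_real_derivative_iff_has_vector_derivative has_vector_derivative_at_within)
  qed (use assms in auto)
  then have "integral {t..r} (\<lambda>s. (t / s) powr a) = t / (a - 1) - (t / (a - 1)) * (t / r) powr (a - 1)"
    using assms by (simp add: integral_unique)
  moreover have "(t / (a - 1)) * (t / r) powr (a - 1) \<ge> 0" using assms by auto
  ultimately show "(LINT s:{t..r}|lborel. (t / s) powr a) \<le> t / (a - 1)" by linarith
qed

section \<open>The radial equation\<close>

text \<open>The one-dimensional problem, detached from the space dimension and from weak
  formulations; \<gamma> stands for -w'. The flux identity holds only almost everywhere because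
  \<gamma> is an arbitrary representative. \<open>HM\<close> is required for every K since the K to
  which it is applied depends on the solution through \<open>w_le_profile\<close>.\<close>

locale radial_ode =
  fixes n :: nat and \<alpha> pm pp qm qp \<delta> :: real
    and g G h H m \<gamma> w :: "real \<Rightarrow> real"
  assumes n: "n \<ge> 1"
    and G: "N_function g G" and H: "N_function h H"
    and exps: "1 < pm" "1 < pp" "pp < real n" "0 < qp" "pp \<le> qm"
    and Gl: "\<And>t. t > 0 \<Longrightarrow> pm * G t \<le> t * g t"
    and Gu: "\<And>t. t > 0 \<Longrightarrow> t * g t \<le> pp * G t"
    and Hl: "\<And>t. t > 0 \<Longrightarrow> qm * H t \<le> t * h t"
    and Hu: "\<And>t. t > 0 \<Longrightarrow> t * h t \<le> qp * H t"
    and m: "\<And>s. s > 0 \<Longrightarrow> m s > 0 \<and> G (m s) = s powr - real n"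
    and \<delta>: "\<delta> > 0"
    and HM: "\<And>K. K > 0 \<Longrightarrow>
      \<exists>C>0. \<forall>r. 0 < r \<longrightarrow> r \<le> 1/2 \<longrightarrow> H (K * (r * m r)) \<le> C * r powr (\<delta> - (\<alpha> + real n))"
    and \<gamma>: "\<And>r. 0 < r \<Longrightarrow> r < 1 \<Longrightarrow> \<gamma> r \<ge> 0"
    and \<gamma>_int: "\<And>r t. 0 < r \<Longrightarrow> r \<le> t \<Longrightarrow> t < 1 \<Longrightarrow> set_integrable lborel {r..t} \<gamma>"
    and w: "\<And>r t. 0 < r \<Longrightarrow> r \<le> t \<Longrightarrow> t < 1 \<Longrightarrow> w r - w t = (LINT s:{r..t}|lborel. \<gamma> s)"
    and w_pos: "\<And>r. 0 < r \<Longrightarrow> r < 1 \<Longrightarrow> w r > 0"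
    and energy: "set_integrable lborel {0<..<1} (\<lambda>s. s powr (real n - 1) * G (\<gamma> s))"
    and F_int: "\<And>r. 0 < r \<Longrightarrow> r < 1 \<Longrightarrow> set_integrable lborel {0<..<r} (\<lambda>s. s powr (\<alpha> + real n - 1) * h (w s))"
    and flux: "AE t in lborel. t \<in> {0<..<1} \<longrightarrow>
       t powr (real n - 1) * g (\<gamma> t) = (LINT s:{0<..<t}|lborel. s powr (\<alpha> + real n - 1) * h (w s))"
begin

lemma w_mono: "0 < r \<Longrightarrow> r \<le> t \<Longrightarrow> t < 1 \<Longrightarrow> w t \<le> w r"
proof -
  assume *: "0 < r" "r \<le> t" "t < 1"
  have "0 \<le> (LINT s:{r..t}|lborel. \<gamma> s)"
    unfolding set_lebesgue_integral_def using * \<gamma>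
    by (intro Bochner_Integration.integral_nonneg) (auto simp: indicator_def)
  then show ?thesis using w[OF *] by simp
qed

lemma m_pos: "s > 0 \<Longrightarrow> m s > 0" and G_m: "s > 0 \<Longrightarrow> G (m s) = s powr - real n"
  using m by auto

text \<open>n / pp is the decay exponent of m, so \<kappa> is the power with which r m(r) at least
  grows towards the origin.\<close>

definition \<kappa> :: real where "\<kappa> = real n / pp - 1"

lemma \<kappa>: "\<kappa> > 0"
  using exps by (simp add: \<kappa>_def)

lemma m_decay: "0 < r \<Longrightarrow> r \<le> s \<Longrightarrow> m s \<le> (r / s) powr (\<kappa> + 1) * m r"
  using profile_decay[OF G _ Gu m, of r s] exps by (simp add: \<kappa>_def)

lemma rm_antimono: "0 < r \<Longrightarrow> r \<le> s \<Longrightarrow> s * m s \<le> r * m r"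
  using profile_antimono[OF G _ _ Gu m, of r s] exps by simp

text \<open>Where \<open>\<gamma>\<close> exceeds \<open>m\<close>, it is dominated by the energy density, because \<open>G(t)/t\<close> increases.\<close>

lemma \<gamma>_le:
  assumes "0 < s" "s < 1"
  shows "\<gamma> s \<le> m s + m s * s powr real n * G (\<gamma> s)"
proof (cases "\<gamma> s \<le> m s")
  case True
  then show ?thesis using m_pos[OF assms(1)] N_function_value_nonneg[OF G \<gamma>[OF assms]]
    by (simp add: add_increasing2)
next
  case False
  have "\<gamma> s / m s * G (m s) \<le> G (\<gamma> s / m s * m s)"
    using m_pos[OF assms(1)] False by (intro N_function_superlinear[OF G]) auto
  then have "\<gamma> s / m s * s powr - real n \<le> G (\<gamma> s)"
    using m_pos[OF assms(1)] G_m[OF assms(1)] by simp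
  then have "\<gamma> s \<le> m s * s powr real n * G (\<gamma> s)"
    using m_pos[OF assms(1)] assms by (simp add: field_simps powr_minus)
  then show ?thesis using m_pos[OF assms(1)] by simp
qed

text \<open>Integrate the bound on \<gamma> from r to 1/2. The part m contributes at most r m(r) /
  \<kappa>; in the energy part one factor s joins m, and s m(s) \<le> r m(r) leaves the integral.
  The boundary value w(1/2) is absorbed because r m(r) is at least its value at 1/2. These are the
  three summands of K.\<close>

lemma w_le_profile: "\<exists>K>0. \<forall>r. 0 < r \<longrightarrow> r \<le> 1/2 \<longrightarrow> w r \<le> K * (r * m r)"
proof -
  define E where "E = (LINT s:{0<..<1}|lborel. s powr (real n - 1) * G (\<gamma> s))"
  define K where "K = w (1/2) / (1/2 * m (1/2)) + 1 / \<kappa> + E"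
  have e0: "0 \<le> s powr (real n - 1) * G (\<gamma> s)" if "0 < s" "s < 1" for s
    using N_function_value_nonneg[OF G \<gamma>[OF that]] by simp
  have E: "E \<ge> 0"
    unfolding E_def set_lebesgue_integral_def using e0
    by (intro Bochner_Integration.integral_nonneg) (auto simp: indicator_def)
  have "w r \<le> K * (r * m r)" if r: "0 < r" "r \<le> 1/2" for r
  proof -
    have rm: "r * m r > 0" using m_pos r by simp
    have si1: "set_integrable lborel {r..1/2} (\<lambda>s. (r / s) powr (\<kappa> + 1) * m r)"
      using lint_powr_decay(1)[of "\<kappa>+1" r "1/2"] \<kappa> r by (intro set_integrable_mult_left) auto
    have si2: "set_integrable lborel {r..1/2} (\<lambda>s. (r * m r) * (s powr (real n - 1) * G (\<gamma> s)))"
      using r by (intro set_integrable_mult_right set_integrable_subset[OF energy]) auto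
    have "w r - w (1/2) = (LINT s:{r..1/2}|lborel. \<gamma> s)" using w[of r "1/2"] r by simp
    also have "\<dots> \<le> (LINT s:{r..1/2}|lborel. (r / s) powr (\<kappa> + 1) * m r + (r * m r) * (s powr (real n - 1) * G (\<gamma> s)))"
    proof (rule set_integral_mono)
      show "set_integrable lborel {r..1/2} \<gamma>" using \<gamma>_int r by simp
      show "set_integrable lborel {r..1/2} (\<lambda>s. (r / s) powr (\<kappa> + 1) * m r + (r * m r) * (s powr (real n - 1) * G (\<gamma> s)))"
        by (rule set_integral_add(1)[OF si1 si2])
      fix s assume "s \<in> {r..1/2}"
      then have s: "0 < s" "s < 1" "r \<le> s" using r by auto
      have "\<gamma> s \<le> m s + (s * m s) * (s powr (real n - 1) * G (\<gamma> s))"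
        using \<gamma>_le[OF s(1,2)] s by (simp add: powr_diff mult_ac)
      also have "\<dots> \<le> (r / s) powr (\<kappa> + 1) * m r + (r * m r) * (s powr (real n - 1) * G (\<gamma> s))"
        using s r m_decay[of r s] rm_antimono[of r s] e0[OF s(1,2)]
        by (intro add_mono mult_right_mono) auto
      finally show "\<gamma> s \<le> \<dots>" .
    qed
    also have "\<dots> = (LINT s:{r..1/2}|lborel. (r / s) powr (\<kappa> + 1)) * m r
        + (r * m r) * (LINT s:{r..1/2}|lborel. s powr (real n - 1) * G (\<gamma> s))"
      by (subst set_integral_add(2)[OF si1 si2]) simp
    also have "\<dots> \<le> (r / \<kappa>) * m r + (r * m r) * E"
    proof (intro add_mono mult_right_mono mult_left_mono)
      show "(LINT s:{r..1/2}|lborel. (r / s) powr (\<kappa> + 1)) \<le> r / \<kappa>"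
        using lint_powr_decay(2)[of "\<kappa>+1" r "1/2"] \<kappa> r by simp
      show "(LINT s:{r..1/2}|lborel. s powr (real n - 1) * G (\<gamma> s)) \<le> E"
        unfolding E_def set_lebesgue_integral_def
      proof (rule integral_mono)
        show "integrable lborel (\<lambda>s. indicator {r..1/2} s *\<^sub>R (s powr (real n - 1) * G (\<gamma> s)))"
          using set_integrable_subset[OF energy, of "{r..1/2}"] r by (simp add: set_integrable_def subset_eq)
        show "integrable lborel (\<lambda>s. indicator {0<..<1} s *\<^sub>R (s powr (real n - 1) * G (\<gamma> s)))"
          using energy by (simp add: set_integrable_def)
        show "indicator {r..1/2} s *\<^sub>R (s powr (real n - 1) * G (\<gamma> s))
            \<le> indicator {0<..<1} s *\<^sub>R (s powr (real n - 1) * G (\<gamma> s))" for s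
        proof (cases "0 < s \<and> s < 1")
          case True
          have "indicator {r..1/2} s \<le> (indicator {0<..<1} s :: real)"
            using r by (auto simp: indicator_def)
          then show ?thesis using True e0[of s] by (intro scaleR_right_mono) auto
        qed (use r in auto)
      qed
    qed (use rm m_pos[of r] r in auto)
    finally have "w r \<le> w (1/2) + (1 / \<kappa> + E) * (r * m r)" by (simp add: algebra_simps)
    also have "w (1/2) \<le> w (1/2) / (1/2 * m (1/2)) * (r * m r)"
      using rm_antimono[of r "1/2"] r w_pos[of "1/2"] m_pos[of "1/2"] by (simp add: field_simps)
    finally show ?thesis by (simp add: K_def algebra_simps)
  qed
  moreover have "K > 0" using E \<kappa> w_pos[of "1/2"] m_pos[of "1/2"] by (simp add: K_def add_pos_nonneg)
  ultimately show ?thesis by blast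
qed

section \<open>From the flux to boundedness\<close>

text \<open>Inverts g at small flux. With c = \<gamma> s / m s, convexity gives G (c m) \<le> c m g
  (c m) \<le> c \<mu> G m, while G (c m) \<ge> c^pp G m for c \<le> 1; hence c^(pp - 1) \<le>
  \<mu>.\<close>

lemma \<gamma>_from_flux:
  assumes \<mu>: "0 \<le> \<mu>" "\<mu> \<le> 1" and s: "0 < s" "s < 1" and le: "g (\<gamma> s) \<le> \<mu> * (G (m s) / m s)"
  shows "\<gamma> s \<le> \<mu> powr (1 / (pp - 1)) * m s"
proof (cases "\<gamma> s = 0")
  case True
  then show ?thesis using m_pos[OF s(1)] by simp
next
  case False
  define c where "c = \<gamma> s / m s"
  have ms: "m s > 0" using m_pos s by simp
  have Gm: "G (m s) > 0" using N_function_value_pos[OF G ms] .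
  have c: "c > 0" "\<gamma> s = c * m s" using False \<gamma>[OF s] ms by (auto simp: c_def)
  have up: "G (c * m s) \<le> c * (\<mu> * G (m s))"
  proof -
    have "G (c * m s) \<le> (c * m s) * g (c * m s)" using N_function_le_mult[OF G] c ms by simp
    also have "\<dots> \<le> (c * m s) * (\<mu> * (G (m s) / m s))" using le c ms by (intro mult_left_mono) auto
    also have "\<dots> = c * (\<mu> * G (m s))" using ms by simp
    finally show ?thesis .
  qed
  \<comment> \<open>For c > 1 the lower index would give c^pm \<le> c \<mu> \<le> c, contradicting
    pm > 1.\<close>
  have c1: "c \<le> 1"
  proof (rule ccontr)
    assume "\<not> c \<le> 1"
    then have "c > 1" by simp
    have "c powr pm * G (m s) \<le> G (c * m s)"
      using \<open>c > 1\<close> exps ms Gl by (intro N_function_powr_lower[OF G]) auto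
    also note up
    also have "c * (\<mu> * G (m s)) \<le> c * G (m s)"
      using \<mu> c Gm by (intro mult_left_mono mult_left_le_one_le) auto
    finally have "c powr pm \<le> c powr 1" using Gm c by simp
    moreover have "c powr 1 < c powr pm" using \<open>c > 1\<close> exps by (intro powr_less_mono) auto
    ultimately show False by linarith
  qed
  have "c powr pp * G (m s) \<le> G (c * m s)"
    using c c1 exps ms Gu by (intro N_function_powr_upper[OF G]) auto
  also note up
  finally have "c powr pp \<le> c * \<mu>" using Gm by simp
  then have "c powr (pp - 1) \<le> \<mu>" using c by (simp add: powr_diff field_simps)
  then have "(c powr (pp - 1)) powr (1 / (pp - 1)) \<le> \<mu> powr (1 / (pp - 1))"
    using exps by (intro powr_mono2) auto
  then have "c \<le> \<mu> powr (1 / (pp - 1))" using exps c by (simp add: powr_powr)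
  then show ?thesis using c ms by simp
qed

lemma w_bounded: "\<exists>C>0. \<forall>r. 0 < r \<longrightarrow> r < 1 \<longrightarrow> w r \<le> C"
proof -
  obtain K where K: "K > 0" "\<And>r. 0 < r \<Longrightarrow> r \<le> 1/2 \<Longrightarrow> w r \<le> K * (r * m r)"
    using w_le_profile by blast
  define M where "M r = K * (r * m r)" for r
  have M_pos: "M r > 0" if "r > 0" for r using K m_pos[OF that] that by (simp add: M_def)
  have M_anti: "M s \<le> M r" if "0 < r" "r \<le> s" for r s
    using rm_antimono[OF that] K by (simp add: M_def)
  obtain C1 where C1: "C1 > 0"
      "\<And>r. 0 < r \<Longrightarrow> r \<le> 1/2 \<Longrightarrow> H (M r) \<le> C1 * r powr (\<delta> - (\<alpha> + real n))"
    using HM[OF K(1)] unfolding M_def by blast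
  \<comment> \<open>The quotient w / M is not known to be monotone. Its supremum over (0,r] is, and
    it bounds w by \<Theta> r * M on the whole range of integration that enters the flux at
    r.\<close>
  define \<Theta> where "\<Theta> r = (SUP s\<in>{0<..r}. w s / M s)" for r
  have bdd: "bdd_above ((\<lambda>s. w s / M s) ` {0<..r})" if "r \<le> 1/2" for r
    using that K M_pos by (intro bdd_aboveI2[of _ _ 1]) (auto simp: M_def)
  have \<Theta>_ge: "w s \<le> \<Theta> r * M s" if "0 < s" "s \<le> r" "r \<le> 1/2" for s r
  proof -
    have "w s / M s \<le> \<Theta> r" unfolding \<Theta>_def using that bdd by (intro cSUP_upper) auto
    then show ?thesis using M_pos[of s] that by (simp add: field_simps)
  qed
  have \<Theta>_pos: "\<Theta> r > 0" if "0 < r" "r \<le> 1/2" for r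
  proof -
    have "0 < \<Theta> r * M r" using \<Theta>_ge[of r r] w_pos[of r] that by simp
    then show ?thesis using M_pos[of r] that by (simp add: zero_less_mult_iff)
  qed
  have \<Theta>_le1: "\<Theta> r \<le> 1" if "0 < r" "r \<le> 1/2" for r
    unfolding \<Theta>_def using that K(2) M_pos by (intro cSUP_least) (auto simp: M_def)
  have \<Theta>_mono: "\<Theta> s \<le> \<Theta> r" if "0 < s" "s \<le> r" "r \<le> 1/2" for s r
    unfolding \<Theta>_def using that by (intro cSUP_subset_mono bdd) auto

  \<comment> \<open>Because \<Theta> r \<le> 1, it leaves H with the lower index qm; dividing by the
    argument of h lowers this to qm - 1. The factor 1 / M s is at most 1 / M r, and what remains is
    s^(\<delta> - 1), integrable at 0.\<close>
  have F: "(LINT s:{0<..<r}|lborel. s powr (\<alpha> + real n - 1) * h (w s))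
      \<le> qp * C1 * \<Theta> r powr (qm - 1) * r powr \<delta> / (\<delta> * M r)" if r: "0 < r" "r \<le> 1/2" for r
  proof -
    define c where "c = qp * C1 * \<Theta> r powr (qm - 1) / M r"
    have "(LINT s:{0<..<r}|lborel. s powr (\<alpha> + real n - 1) * h (w s))
        \<le> (LINT s:{0<..<r}|lborel. c * s powr (\<delta> - 1))"
    proof (rule set_integral_mono)
      show "set_integrable lborel {0<..<r} (\<lambda>s. s powr (\<alpha> + real n - 1) * h (w s))"
        using F_int r by simp
      show "set_integrable lborel {0<..<r} (\<lambda>s. c * s powr (\<delta> - 1))"
        using lint_powr_0(1)[OF \<delta>, of r] r by (intro set_integrable_mult_right) auto
      fix s assume "s \<in> {0<..<r}"
      then have s: "0 < s" "s < r" "s \<le> 1/2" using r by auto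
      let ?t = "\<Theta> r * M s"
      have t: "?t > 0" using \<Theta>_pos[OF r] M_pos[OF s(1)] by simp
      have "h (w s) \<le> h ?t"
        using \<Theta>_ge[of s r] w_pos[of s] s r by (intro N_function_mono[OF H]) auto
      also have "\<dots> \<le> qp * H ?t / ?t" using Hu[OF t] t by (simp add: field_simps)
      also have "\<dots> \<le> qp * (\<Theta> r powr qm * H (M s)) / ?t"
        using \<Theta>_pos[OF r] \<Theta>_le1[OF r] M_pos[OF s(1)] exps Hl t
        by (intro divide_right_mono mult_left_mono N_function_powr_lower'[OF H]) auto
      also have "\<dots> = qp * \<Theta> r powr (qm - 1) * (H (M s) / M s)"
        using \<Theta>_pos[OF r] M_pos[OF s(1)] by (simp add: powr_diff field_simps)
      also have "\<dots> \<le> qp * \<Theta> r powr (qm - 1) * (C1 * s powr (\<delta> - (\<alpha> + real n)) / M r)"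
        using C1 s r M_anti[of s r] M_pos exps N_function_value_nonneg[OF H, of "M s"]
        by (intro mult_left_mono frac_le) (auto intro!: mult_nonneg_nonneg)
      finally have "s powr (\<alpha> + real n - 1) * h (w s) \<le> s powr (\<alpha> + real n - 1) * \<dots>"
        by (intro mult_left_mono) auto
      also have "\<dots> = c * (s powr (\<alpha> + real n - 1) * s powr (\<delta> - (\<alpha> + real n)))"
        by (simp add: c_def)
      also have "\<dots> = c * s powr (\<delta> - 1)" by (simp flip: powr_add)
      finally show "s powr (\<alpha> + real n - 1) * h (w s) \<le> c * s powr (\<delta> - 1)" .
    qed
    also have "\<dots> = c * (r powr \<delta> / \<delta>)" using lint_powr_0(2)[OF \<delta>, of r] r by simp
    finally show ?thesis by (simp add: c_def mult_ac)
  qed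

  \<comment> \<open>Dividing the flux bound by r^(n-1) and inserting M r = K r m r and G (m r) =
    r^(-n) yields g (\<gamma> r) \<le> \<mu> G (m r) / m r with \<mu> = C2 r^\<delta> \<Theta>^(qm -
    1). The constants \<epsilon> and C3 come from raising \<mu> to the power 1 / (pp - 1).\<close>
  define C2 where "C2 = qp * C1 / (\<delta> * K)"
  define \<epsilon> where "\<epsilon> = \<delta> / (pp - 1)"
  define C3 where "C3 = C2 powr (1 / (pp - 1))"
  have C2: "C2 > 0" and \<epsilon>: "\<epsilon> > 0" and C3: "C3 > 0"
    using exps C1 \<delta> K by (auto simp: C2_def \<epsilon>_def C3_def)
  have \<gamma>_bound: "AE r in lborel. 0 < r \<and> r \<le> 1/2 \<and> C2 * r powr \<delta> \<le> 1 \<longrightarrow>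
      \<gamma> r \<le> C3 * r powr \<epsilon> * \<Theta> r * m r"
    using flux
  proof eventually_elim
    case (elim r)
    show ?case
    proof (intro impI)
      assume *: "0 < r \<and> r \<le> 1/2 \<and> C2 * r powr \<delta> \<le> 1"
      then have r: "0 < r" "r \<le> 1/2" "r < 1" and C2r: "C2 * r powr \<delta> \<le> 1" by auto
      define \<mu> where "\<mu> = C2 * r powr \<delta> * \<Theta> r powr (qm - 1)"
      have \<Theta>1: "\<Theta> r powr (qm - 1) \<le> 1"
        using \<Theta>_le1[OF r(1,2)] \<Theta>_pos[OF r(1,2)] exps by (intro powr_le1) auto
      have "r powr (real n - 1) * g (\<gamma> r) \<le> qp * C1 * \<Theta> r powr (qm - 1) * r powr \<delta> / (\<delta> * M r)"
        using elim F[OF r(1,2)] r by simp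
      also have "\<dots> = r powr (real n - 1) * (\<mu> * (G (m r) / m r))"
        using r G_m[OF r(1)] \<delta> K m_pos[OF r(1)]
        by (simp add: \<mu>_def C2_def M_def powr_diff powr_minus field_simps)
      finally have "g (\<gamma> r) \<le> \<mu> * (G (m r) / m r)"
        using r by (subst (asm) mult_le_cancel_left_pos) auto
      moreover have "0 \<le> \<mu>" "\<mu> \<le> 1"
        unfolding \<mu>_def using C2 C2r \<Theta>1 by (auto intro!: mult_le_one)
      ultimately have "\<gamma> r \<le> \<mu> powr (1 / (pp - 1)) * m r"
        using r by (intro \<gamma>_from_flux) auto
      also have "\<mu> powr (1 / (pp - 1)) = C3 * r powr \<epsilon> * \<Theta> r powr ((qm - 1) / (pp - 1))"
        using C2 by (simp add: \<mu>_def C3_def \<epsilon>_def powr_mult powr_powr)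
      finally have "\<gamma> r \<le> C3 * r powr \<epsilon> * \<Theta> r powr ((qm - 1) / (pp - 1)) * m r" .
      \<comment> \<open>Here pp \<le> qm enters: the exponent (qm - 1) / (pp - 1) is at least 1 and
        \<Theta> r \<le> 1.\<close>
      also have "\<dots> \<le> C3 * r powr \<epsilon> * \<Theta> r powr 1 * m r"
        using \<Theta>_le1[OF r(1,2)] \<Theta>_pos[OF r(1,2)] exps C3 m_pos[OF r(1)]
        by (intro mult_left_mono mult_right_mono powr_mono') auto
      finally show "\<gamma> r \<le> C3 * r powr \<epsilon> * \<Theta> r * m r"
        using \<Theta>_pos[OF r(1,2)] by simp
    qed
  qed

  have small: "\<exists>r0>0. r0 \<le> b \<and> c * r0 powr d \<le> e" if "0 < b" "0 < c" "0 < d" "0 < e" for b c d e :: real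
  proof -
    define r0 where "r0 = min b ((e / c) powr (1 / d))"
    have "r0 powr d \<le> ((e / c) powr (1 / d)) powr d"
      unfolding r0_def using that by (intro powr_mono2) auto
    also have "\<dots> = e / c" using that by (simp add: powr_powr)
    finally show ?thesis using that by (intro exI[of _ r0]) (auto simp: r0_def field_simps)
  qed
  obtain ra where ra: "0 < ra" "ra \<le> 1/2" "C2 * ra powr \<delta> \<le> 1"
    using small[of "1/2" C2 \<delta> 1] C2 \<delta> by auto
  \<comment> \<open>The threshold \<kappa> K / 2 is chosen so that, by the decay of m, w drops by at
    most \<Theta> r * M t / 2 between any t \<le> r and r.\<close>
  obtain r0 where r0: "0 < r0" "r0 \<le> ra" "C3 * r0 powr \<epsilon> \<le> \<kappa> * K / 2"
    using small[of ra C3 \<epsilon> "\<kappa> * K / 2"] C3 \<epsilon> \<kappa> K ra by auto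
  have small_r: "C2 * r powr \<delta> \<le> 1" "C3 * r powr \<epsilon> \<le> \<kappa> * K / 2" "r \<le> 1/2" if "0 < r" "r \<le> r0" for r
  proof -
    have "C2 * r powr \<delta> \<le> C2 * ra powr \<delta>" using that r0 C2 \<delta> by (intro mult_left_mono powr_mono2) auto
    then show "C2 * r powr \<delta> \<le> 1" using ra by simp
    have "C3 * r powr \<epsilon> \<le> C3 * r0 powr \<epsilon>" using that C3 \<epsilon> by (intro mult_left_mono powr_mono2) auto
    then show "C3 * r powr \<epsilon> \<le> \<kappa> * K / 2" using r0 by simp
    show "r \<le> 1/2" using that r0 ra by simp
  qed

  \<comment> \<open>Some t \<le> r nearly attains the supremum, w t > 3/4 \<Theta> r * M t. Up to r
    at most half of \<Theta> r * M t is lost, so a quarter survives; finally M t \<ge> M r.\<close>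
  have w_ge: "\<Theta> r * M r / 4 \<le> w r" if r: "0 < r" "r \<le> r0" for r
  proof -
    have r12: "r \<le> 1/2" using small_r(3)[OF r] .
    have "3/4 * \<Theta> r < \<Theta> r" using \<Theta>_pos[OF r(1) r12] by simp
    then obtain t where t: "0 < t" "t \<le> r" "3/4 * \<Theta> r < w t / M t"
      unfolding \<Theta>_def using r bdd[OF r12] by (subst (asm) less_cSUP_iff) auto
    have wt: "3/4 * \<Theta> r * M t < w t" using t M_pos[of t] by (simp add: field_simps)
    define c where "c = (\<kappa> * K / 2) * \<Theta> r * m t"
    have "w t - w r = (LINT s:{t..r}|lborel. \<gamma> s)" using w[of t r] t r12 by simp
    also have "\<dots> \<le> (LINT s:{t..r}|lborel. c * (t / s) powr (\<kappa> + 1))"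
    proof (rule set_integral_mono_AE)
      show "set_integrable lborel {t..r} \<gamma>" using \<gamma>_int t r12 by simp
      show "set_integrable lborel {t..r} (\<lambda>s. c * (t / s) powr (\<kappa> + 1))"
        using lint_powr_decay(1)[of "\<kappa>+1" t r] \<kappa> t by (intro set_integrable_mult_right) auto
      show "AE s\<in>{t..r} in lborel. \<gamma> s \<le> c * (t / s) powr (\<kappa> + 1)"
        using \<gamma>_bound
      proof eventually_elim
        case (elim s)
        show ?case
        proof
          assume "s \<in> {t..r}"
          then have s: "0 < s" "t \<le> s" "s \<le> r" "s \<le> r0" using t r by auto
          have "\<gamma> s \<le> C3 * s powr \<epsilon> * \<Theta> s * m s"
            using elim small_r[OF s(1,4)] s by auto
          also have "\<dots> \<le> (\<kappa> * K / 2) * \<Theta> r * ((t / s) powr (\<kappa> + 1) * m t)"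
            using small_r[OF s(1,4)] s r12 \<Theta>_mono[of s r] \<Theta>_pos[of s] m_decay[of t s] t
              \<kappa> K m_pos[of s] C3 \<Theta>_pos[of r] r
            by (intro mult_mono) (auto intro!: mult_nonneg_nonneg)
          finally show "\<gamma> s \<le> c * (t / s) powr (\<kappa> + 1)" by (simp add: c_def mult_ac)
        qed
      qed
    qed
    also have "\<dots> = c * (LINT s:{t..r}|lborel. (t / s) powr (\<kappa> + 1))" by simp
    also have "\<dots> \<le> c * (t / \<kappa>)"
      using lint_powr_decay(2)[of "\<kappa>+1" t r] \<kappa> t K \<Theta>_pos[OF r(1) r12] m_pos[of t]
      by (intro mult_left_mono) (auto simp: c_def)
    also have "\<dots> = \<Theta> r * M t / 2" using \<kappa> by (simp add: c_def M_def field_simps)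
    finally have "\<Theta> r * M t / 4 \<le> w r" using wt by (simp add: field_simps)
    moreover have "\<Theta> r * M r \<le> \<Theta> r * M t"
      using M_anti[of t r] t \<Theta>_pos[OF r(1) r12] by simp
    ultimately show ?thesis by simp
  qed

  \<comment> \<open>Substituting \<Theta> s * M s \<le> 4 w s with M s = K s m s turns the slope
    bound into \<gamma> s \<le> C4 w s s^(\<epsilon> - 1).\<close>
  define C4 where "C4 = 4 * C3 / K"
  have C4: "C4 > 0" using C3 K by (simp add: C4_def)
  \<comment> \<open>On (0,r1) the weight C4 s^(\<epsilon> - 1) has integral at most 1/2. Bounding w
    s by the larger value w r then lets half of w r be absorbed, which replaces a Gronwall
    argument.\<close>
  obtain r1 where r1: "0 < r1" "r1 \<le> r0" "C4 / \<epsilon> * r1 powr \<epsilon> \<le> 1/2"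
    using small[of r0 "C4 / \<epsilon>" \<epsilon> "1/2"] C4 \<epsilon> r0 by auto
  have r1_less: "r1 < 1" using r1 r0 ra by simp
  have near: "w r \<le> 2 * w r1" if r: "0 < r" "r \<le> r1" for r
  proof -
    have wr: "w r > 0" using w_pos r r1_less by simp
    have si: "set_integrable lborel {0<..<r1} (\<lambda>s. C4 * w r * s powr (\<epsilon> - 1))"
      using lint_powr_0(1)[OF \<epsilon> r1(1)] by (intro set_integrable_mult_right) auto
    have "w r - w r1 = (LINT s:{r..r1}|lborel. \<gamma> s)" using w[of r r1] r r1_less by simp
    also have "\<dots> \<le> (LINT s:{0<..<r1}|lborel. C4 * w r * s powr (\<epsilon> - 1))"
      unfolding set_lebesgue_integral_def
    proof (rule integral_mono_AE)
      show "integrable lborel (\<lambda>s. indicator {r..r1} s *\<^sub>R \<gamma> s)"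
        using \<gamma>_int[of r r1] r r1_less by (simp add: set_integrable_def)
      show "integrable lborel (\<lambda>s. indicator {0<..<r1} s *\<^sub>R (C4 * w r * s powr (\<epsilon> - 1)))"
        using si by (simp add: set_integrable_def)
      show "AE s in lborel. indicator {r..r1} s *\<^sub>R \<gamma> s
          \<le> indicator {0<..<r1} s *\<^sub>R (C4 * w r * s powr (\<epsilon> - 1))"
        using \<gamma>_bound AE_lborel_singleton[of r1]
      proof eventually_elim
        case (elim s)
        have "\<gamma> s \<le> C4 * w r * s powr (\<epsilon> - 1)" if s: "r \<le> s" "s \<le> r1"
        proof -
          have s': "0 < s" "s \<le> r0" using s r r1 by auto
          have "K * s * (\<Theta> s * m s) / 4 = \<Theta> s * M s / 4" by (simp add: M_def)
          also have "\<dots> \<le> w s" by (rule w_ge[OF s'])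
          also have "\<dots> \<le> w r" using w_mono[of r s] r s r1_less by simp
          finally have le: "\<Theta> s * m s \<le> 4 * w r / (K * s)" using K s' by (simp add: field_simps)
          have "\<gamma> s \<le> C3 * s powr \<epsilon> * (\<Theta> s * m s)"
            using elim(1) small_r[OF s'] s' by auto
          also have "\<dots> \<le> C3 * s powr \<epsilon> * (4 * w r / (K * s))"
            using le C3 by (intro mult_left_mono) auto
          also have "\<dots> = C4 * w r * s powr (\<epsilon> - 1)"
            using s' by (simp add: C4_def powr_diff)
          finally show ?thesis .
        qed
        then show ?case using elim(2) r C4 wr by (auto simp: indicator_def)
      qed
    qed
    also have "\<dots> = C4 * w r * (r1 powr \<epsilon> / \<epsilon>)"
      using lint_powr_0(2)[OF \<epsilon> r1(1)] by simp
    also have "\<dots> = w r * (C4 / \<epsilon> * r1 powr \<epsilon>)" by simp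
    also have "\<dots> \<le> w r * (1/2)" using wr r1 by (intro mult_left_mono) auto
    finally show ?thesis by simp
  qed
  have "w r \<le> 2 * w r1" if "0 < r" "r < 1" for r
    using near[OF that(1)] w_mono[of r1 r] that r1 w_pos[of r1] r1_less by (cases "r \<le> r1") auto
  moreover have "2 * w r1 > 0" using w_pos r1 r1_less by simp
  ultimately show ?thesis by blast
qed

end

section \<open>Smooth functions\<close>

text \<open>A one-dimensional counterpart of \<open>C_k\<close> relative to a set, so that powers
  and the square root, smooth only on (0,\<infinity>), can be treated. For open S the iterated
  \<open>deriv\<close> on S depends only on the values on S.\<close>

fun smooth_upto :: "nat \<Rightarrow> real set \<Rightarrow> (real \<Rightarrow> real) \<Rightarrow> bool" where
  "smooth_upto 0 S f \<longleftrightarrow> continuous_on S f"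
| "smooth_upto (Suc k) S f \<longleftrightarrow>
     (\<forall>x\<in>S. f field_differentiable (at x)) \<and> smooth_upto k S (deriv f)"

lemma smooth_upto_cong:
  assumes "open S" "\<And>x. x \<in> S \<Longrightarrow> f x = g x"
  shows "smooth_upto k S f \<longleftrightarrow> smooth_upto k S g"
  using assms(2)
proof (induction k arbitrary: f g)
  case 0
  then show ?case by (simp cong: continuous_on_cong)
next
  case (Suc k)
  have ev: "\<forall>\<^sub>F y in nhds x. f y = g y" if "x \<in> S" for x
    using assms(1) that Suc.prems by (auto simp: eventually_nhds)
  have "f field_differentiable (at x) \<longleftrightarrow> g field_differentiable (at x)" if "x \<in> S" for x
    using DERIV_cong_ev[OF refl ev[OF that] refl] by (simp add: field_differentiable_def)
  moreover have "deriv f x = deriv g x" if "x \<in> S" for x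
    using ev[OF that] by (intro deriv_cong_ev) auto
  ultimately show ?case using Suc.IH[of "deriv f" "deriv g"] by auto
qed

lemma smooth_upto_SucI:
  assumes "open S" "\<And>x. x \<in> S \<Longrightarrow> (f has_real_derivative f' x) (at x)" "smooth_upto k S f'"
  shows "smooth_upto (Suc k) S f"
proof -
  have "smooth_upto k S (deriv f)"
    using smooth_upto_cong[OF assms(1), of "deriv f" f'] assms(2,3) DERIV_imp_deriv by blast
  then show ?thesis using assms(2) by (auto simp: field_differentiable_def)
qed

lemma smooth_upto_deriv:
  "smooth_upto (Suc k) S f \<Longrightarrow> x \<in> S \<Longrightarrow> (f has_real_derivative deriv f x) (at x)"
  by (simp add: field_differentiable_derivI)

lemma smooth_upto_continuous:
  assumes "smooth_upto k S f"
  shows "continuous_on S f"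
proof (cases k)
  case (Suc j)
  show ?thesis
    by (rule continuous_at_imp_continuous_on)
      (use assms Suc field_differentiable_imp_continuous_at in auto)
qed (use assms in simp)

lemma smooth_upto_Suc_imp: "smooth_upto (Suc k) S f \<Longrightarrow> smooth_upto k S f"
proof (induction k arbitrary: f)
  case 0
  then show ?case using smooth_upto_continuous[OF 0] by simp
next
  case (Suc k)
  then show ?case by simp
qed

lemma smooth_upto_subset: "smooth_upto k T f \<Longrightarrow> S \<subseteq> T \<Longrightarrow> smooth_upto k S f"
  by (induction k arbitrary: f) (auto intro: continuous_on_subset)

lemma smooth_upto_Un:
  "open S \<Longrightarrow> open T \<Longrightarrow> smooth_upto k S f \<Longrightarrow> smooth_upto k T f \<Longrightarrow> smooth_upto k (S \<union> T) f"
  by (induction k arbitrary: f) (auto intro: continuous_on_open_Un)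

lemma smooth_upto_const: "open S \<Longrightarrow> smooth_upto k S (\<lambda>x. c)"
proof (induction k arbitrary: c)
  case (Suc k)
  show ?case
    by (rule smooth_upto_SucI[where f'="\<lambda>x. 0"]) (use Suc in auto)
qed auto

lemma smooth_upto_ident: "open S \<Longrightarrow> smooth_upto k S (\<lambda>x. x)"
proof (cases k)
  case (Suc j)
  assume "open S"
  then show ?thesis unfolding Suc
    by (intro smooth_upto_SucI[where f'="\<lambda>x. 1"] smooth_upto_const) auto
qed auto

lemma smooth_upto_add:
  assumes "open S"
  shows "smooth_upto k S f \<Longrightarrow> smooth_upto k S g \<Longrightarrow> smooth_upto k S (\<lambda>x. f x + g x)"
proof (induction k arbitrary: f g)
  case (Suc k)
  show ?case
  proof (rule smooth_upto_SucI[OF assms, where f'="\<lambda>x. deriv f x + deriv g x"])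
    fix x assume xS: "x \<in> S"
    show "((\<lambda>x. f x + g x) has_real_derivative deriv f x + deriv g x) (at x)"
      by (rule DERIV_add[OF smooth_upto_deriv[OF Suc.prems(1) xS] smooth_upto_deriv[OF Suc.prems(2) xS]])
  next
    show "smooth_upto k S (\<lambda>x. deriv f x + deriv g x)"
      using Suc.prems by (intro Suc.IH) auto
  qed
qed (simp add: continuous_on_add)

lemma smooth_upto_mult:
  assumes "open S"
  shows "smooth_upto k S f \<Longrightarrow> smooth_upto k S g \<Longrightarrow> smooth_upto k S (\<lambda>x. f x * g x)"
proof (induction k arbitrary: f g)
  case (Suc k)
  show ?case
  proof (rule smooth_upto_SucI[OF assms, where f'="\<lambda>x. f x * deriv g x + deriv f x * g x"])
    fix x assume xS: "x \<in> S"
    show "((\<lambda>x. f x * g x) has_real_derivative f x * deriv g x + deriv f x * g x) (at x)"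
      by (rule DERIV_mult'[OF smooth_upto_deriv[OF Suc.prems(1) xS] smooth_upto_deriv[OF Suc.prems(2) xS]])
  next
    show "smooth_upto k S (\<lambda>x. f x * deriv g x + deriv f x * g x)"
      using Suc.prems smooth_upto_Suc_imp[OF Suc.prems(1)] smooth_upto_Suc_imp[OF Suc.prems(2)]
      by (intro smooth_upto_add[OF assms] Suc.IH) auto
  qed
qed (simp add: continuous_on_mult)

lemma smooth_upto_compose:
  assumes "open S" "open T" "\<And>x. x \<in> S \<Longrightarrow> p x \<in> T"
  shows "smooth_upto k T f \<Longrightarrow> smooth_upto k S p \<Longrightarrow> smooth_upto k S (\<lambda>x. f (p x))"
proof (induction k arbitrary: f)
  case 0
  then show ?case using assms(3) continuous_on_compose2[of T f S p] by auto
next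
  case (Suc k)
  show ?case
  proof (rule smooth_upto_SucI[OF assms(1), where f'="\<lambda>x. deriv f (p x) * deriv p x"])
    fix x assume xS: "x \<in> S"
    show "((\<lambda>x. f (p x)) has_real_derivative deriv f (p x) * deriv p x) (at x)"
      by (rule DERIV_chain2[OF smooth_upto_deriv[OF Suc.prems(1) assms(3)[OF xS]] smooth_upto_deriv[OF Suc.prems(2) xS]])
  next
    show "smooth_upto k S (\<lambda>x. deriv f (p x) * deriv p x)"
      by (rule smooth_upto_mult[OF assms(1) Suc.IH[OF _ smooth_upto_Suc_imp[OF Suc.prems(2)]]])
        (use Suc.prems in simp_all)
  qed
qed

lemma smooth_upto_powr: "smooth_upto k {0<..} (\<lambda>x. x powr a)"
proof (induction k arbitrary: a)
  case 0
  show ?case by (auto intro!: continuous_intros)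
next
  case (Suc k)
  show ?case
    by (rule smooth_upto_SucI[where f'="\<lambda>x. a * x powr (a - 1)"])
      (use Suc in \<open>auto intro!: smooth_upto_mult smooth_upto_const has_real_derivative_powr\<close>)
qed

text \<open>The family is closed under differentiation: the derivative of the \<open>j\<close>-th function is
  the \<open>(j+2)\<close>-nd minus \<open>j\<close> times the \<open>(j+1)\<close>-st.\<close>

definition exp_cutoff :: "nat \<Rightarrow> real \<Rightarrow> real" where
  "exp_cutoff j t = (if t > 0 then (1 / t) ^ j * exp (- 1 / t) else 0)"

lemma exp_cutoff_tendsto: "(exp_cutoff j \<longlongrightarrow> 0) (at_right 0)"
proof -
  have "((\<lambda>t::real. (1 / t) ^ j / exp (1 / t)) \<longlongrightarrow> 0) (at_right 0)"
    using filterlim_compose[OF tendsto_power_div_exp_0[of j] filterlim_inverse_at_top_right]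
    by (simp add: inverse_eq_divide)
  then show ?thesis
    by (rule Lim_transform_eventually)
      (auto simp: eventually_at_filter exp_cutoff_def exp_minus field_simps)
qed

lemma exp_cutoff_deriv:
  "(exp_cutoff j has_real_derivative (exp_cutoff (j + 2) t + (- real j) * exp_cutoff (j + 1) t)) (at t)"
proof -
  consider "t > 0" | "t < 0" | "t = 0" by linarith
  then show ?thesis
  proof cases
    case 1
    have d: "((\<lambda>t. 1 / t) has_real_derivative - (1 / (t * t))) (at t)"
      using 1 by (auto intro!: derivative_eq_intros)
    have "((\<lambda>t. exp (- 1 / t)) has_real_derivative exp (- 1 / t) * (1 / (t * t))) (at t)"
      using 1 by (auto intro!: derivative_eq_intros)
    from DERIV_mult[OF DERIV_power[OF d, of j] this]
    have "((\<lambda>t. (1 / t) ^ j * exp (- 1 / t)) has_real_derivative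
        real j * (- (1 / (t * t)) * (1 / t) ^ (j - Suc 0)) * exp (- 1 / t)
        + exp (- 1 / t) * (1 / (t * t)) * (1 / t) ^ j) (at t)" .
    also have "real j * (- (1 / (t * t)) * (1 / t) ^ (j - Suc 0)) * exp (- 1 / t)
        + exp (- 1 / t) * (1 / (t * t)) * (1 / t) ^ j
        = exp_cutoff (j + 2) t + (- real j) * exp_cutoff (j + 1) t"
      using 1 by (cases j) (auto simp: exp_cutoff_def field_simps)
    finally show ?thesis
      by (rule has_field_derivative_transform_within_open[where S="{0<..}"])
        (use 1 in \<open>auto simp: exp_cutoff_def\<close>)
  next
    case 2
    have "((\<lambda>t. 0) has_real_derivative 0) (at t)" by simp
    then have "(exp_cutoff j has_real_derivative 0) (at t)"
      by (rule has_field_derivative_transform_within_open[where S="{..<0}"])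
        (use 2 in \<open>auto simp: exp_cutoff_def\<close>)
    then show ?thesis using 2 by (simp add: exp_cutoff_def)
  next
    case 3
    \<comment> \<open>On the right the difference quotient at 0 is \<open>exp_cutoff (j + 1)\<close>
      itself, on the left it is 0.\<close>
    have "((\<lambda>h. (exp_cutoff j (0 + h) - exp_cutoff j 0) / h) \<longlongrightarrow> 0) (at 0)"
    proof (rule filterlim_split_at_real)
      have "(exp_cutoff (j + 1) \<longlongrightarrow> 0) (at_right 0)" by (rule exp_cutoff_tendsto)
      then show "((\<lambda>h. (exp_cutoff j (0 + h) - exp_cutoff j 0) / h) \<longlongrightarrow> 0) (at_right 0)"
        by (rule Lim_transform_eventually)
          (auto simp: eventually_at_filter exp_cutoff_def field_simps)
      have "((\<lambda>h::real. 0::real) \<longlongrightarrow> 0) (at_left 0)" by simp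
      then show "((\<lambda>h. (exp_cutoff j (0 + h) - exp_cutoff j 0) / h) \<longlongrightarrow> 0) (at_left 0)"
        by (rule Lim_transform_eventually)
          (auto simp: eventually_at_filter exp_cutoff_def)
    qed
    then have "(exp_cutoff j has_real_derivative 0) (at 0)" by (simp add: DERIV_def)
    then show ?thesis using 3 by (simp add: exp_cutoff_def)
  qed
qed

lemma smooth_upto_exp_cutoff: "smooth_upto k UNIV (exp_cutoff j)"
proof (induction k arbitrary: j)
  case 0
  show ?case
    by (auto intro!: continuous_at_imp_continuous_on DERIV_isCont[OF exp_cutoff_deriv])
next
  case (Suc k)
  show ?case
    by (rule smooth_upto_SucI[OF open_UNIV exp_cutoff_deriv])
      (intro smooth_upto_add smooth_upto_mult smooth_upto_const Suc open_UNIV)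
qed

lemma smooth_upto_antideriv:
  assumes "open S" "\<And>x. x \<in> S \<Longrightarrow> (F has_real_derivative f x) (at x)" "\<And>k. smooth_upto k S f"
  shows "smooth_upto k S F"
  by (rule smooth_upto_Suc_imp, rule smooth_upto_SucI[OF assms(1,2)], assumption, rule assms(3))

section \<open>Smooth functions of several variables\<close>

lemma C_k_continuous: "C_k k f \<Longrightarrow> continuous_on UNIV f"
proof (cases k)
  case (Suc j)
  assume "C_k k f"
  then show ?thesis unfolding Suc
    by (intro continuous_at_imp_continuous_on ballI differentiable_imp_continuous_within) simp
qed simp

lemma C_k_SucI:
  fixes f :: "'a::euclidean_space \<Rightarrow> real"
  assumes "\<And>x. (f has_derivative f' x) (at x)" "\<And>b. b \<in> Basis \<Longrightarrow> C_k k (\<lambda>x. f' x b)"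
  shows "C_k (Suc k) f"
proof -
  have "frechet_derivative f (at x) = f' x" for x
    using frechet_derivative_at[OF assms(1), of x] by simp
  then show ?thesis
    using assms(2) by (simp add: differentiableI[OF assms(1)])
qed

lemma C_k_has_derivative:
  "C_k (Suc k) f \<Longrightarrow> (f has_derivative frechet_derivative f (at x)) (at x)"
  by (simp add: frechet_derivative_works[symmetric])

lemma C_k_Suc_imp: "C_k (Suc k) f \<Longrightarrow> C_k k f"
proof (induction k arbitrary: f)
  case 0
  then show ?case using C_k_continuous[OF 0] by simp
qed simp

lemma C_k_const: "C_k k (\<lambda>x::'a::euclidean_space. c)"
proof (induction k arbitrary: c)
  case (Suc k)
  show ?case
    by (rule C_k_SucI[OF has_derivative_const]) (rule Suc.IH)
qed simp

lemma C_k_inner: "C_k k (\<lambda>x::'a::euclidean_space. x \<bullet> a)"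
proof (cases k)
  case (Suc j)
  show ?thesis unfolding Suc
    by (rule C_k_SucI[OF has_derivative_inner_left[OF has_derivative_ident]]) (rule C_k_const)
qed (simp add: continuous_on_inner)

lemma C_k_add: "C_k k f \<Longrightarrow> C_k k g \<Longrightarrow> C_k k (\<lambda>x. f x + g x)"
proof (induction k arbitrary: f g)
  case (Suc k)
  show ?case
    by (rule C_k_SucI[OF has_derivative_add[OF C_k_has_derivative[OF Suc.prems(1)] C_k_has_derivative[OF Suc.prems(2)]]])
      (intro Suc.IH; use Suc.prems in simp)
qed (simp add: continuous_on_add)

lemma C_k_mult: "C_k k f \<Longrightarrow> C_k k g \<Longrightarrow> C_k k (\<lambda>x. f x * g x)"
proof (induction k arbitrary: f g)
  case (Suc k)
  show ?case
    by (rule C_k_SucI[OF has_derivative_mult[OF C_k_has_derivative[OF Suc.prems(1)] C_k_has_derivative[OF Suc.prems(2)]]])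
      (intro C_k_add Suc.IH C_k_Suc_imp[OF Suc.prems(1)] C_k_Suc_imp[OF Suc.prems(2)];
        use Suc.prems in simp)
qed (simp add: continuous_on_mult)

lemma C_k_prod: "finite I \<Longrightarrow> (\<And>i. i \<in> I \<Longrightarrow> C_k k (f i)) \<Longrightarrow> C_k k (\<lambda>x. \<Prod>i\<in>I. f i x)"
  by (induction I rule: finite_induct) (simp_all add: C_k_mult C_k_const)

lemma C_k_sum: "finite I \<Longrightarrow> (\<And>i. i \<in> I \<Longrightarrow> C_k k (f i)) \<Longrightarrow> C_k k (\<lambda>x. \<Sum>i\<in>I. f i x)"
  by (induction I rule: finite_induct) (simp_all add: C_k_add C_k_const)

text \<open>The squared norm is a polynomial in the coordinates and hence smooth also at the origin,
  where the norm is not. It is the inner function for all radial test functions.\<close>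

lemma C_k_norm_power2: "C_k k (\<lambda>x::'a::euclidean_space. (norm x)\<^sup>2)"
proof -
  have "C_k k (\<lambda>x::'a. \<Sum>b\<in>Basis. (x \<bullet> b) * (x \<bullet> b))"
    by (intro C_k_sum C_k_mult C_k_inner) auto
  also have "(\<lambda>x::'a. \<Sum>b\<in>Basis. (x \<bullet> b) * (x \<bullet> b)) = (\<lambda>x. (norm x)\<^sup>2)"
    by (rule ext, subst power2_norm_eq_inner, subst euclidean_inner, rule refl)
  finally show ?thesis .
qed

lemma C_k_compose: "smooth_upto k UNIV f \<Longrightarrow> C_k k p \<Longrightarrow> C_k k (\<lambda>x. f (p x))"
proof (induction k arbitrary: f)
  case 0
  then show ?case using continuous_on_compose2[of UNIV f UNIV p] by auto
next
  case (Suc k)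
  have d: "((\<lambda>x. f (p x)) has_derivative (\<lambda>y. deriv f (p x) * frechet_derivative p (at x) y)) (at x)" for x
    using has_derivative_compose[OF C_k_has_derivative[OF Suc.prems(2)]
        smooth_upto_deriv[OF Suc.prems(1), unfolded has_field_derivative_def]] by auto
  show ?case
    by (rule C_k_SucI[OF d])
      (rule C_k_mult[OF Suc.IH[OF _ C_k_Suc_imp[OF Suc.prems(2)]]]; use Suc.prems in simp)
qed

lemma C_k_imp_smooth_upto: "C_k k f \<Longrightarrow> smooth_upto k UNIV f" for f :: "real \<Rightarrow> real"
proof (induction k arbitrary: f)
  case (Suc k)
  have "(f has_real_derivative frechet_derivative f (at x) 1) (at x)" for x
  proof -
    have d: "(f has_derivative frechet_derivative f (at x)) (at x)"
      using C_k_has_derivative[OF Suc.prems] .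
    have "frechet_derivative f (at x) y = frechet_derivative f (at x) 1 * y" for y
      using linear_scale[OF has_derivative_linear[OF d], of y 1]
      by (simp only: real_scaleR_def mult_1_right mult.commute[of "frechet_derivative f (at x) 1"])
    then have "frechet_derivative f (at x) = (*) (frechet_derivative f (at x) 1)" by (rule ext)
    then show ?thesis using d unfolding has_field_derivative_def by simp
  qed
  moreover have "smooth_upto k UNIV (\<lambda>x. frechet_derivative f (at x) 1)"
    using Suc.prems by (intro Suc.IH) simp
  ultimately show ?case by (rule smooth_upto_SucI[OF open_UNIV])
qed simp

section \<open>Integration by parts\<close>

lemma integrable_compact_support:
  fixes f :: "'a::euclidean_space \<Rightarrow> real"
  assumes "continuous_on UNIV f" "compact S" "\<And>x. x \<notin> S \<Longrightarrow> f x = 0"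
  shows "integrable lborel f"
proof -
  have "integrable lborel (\<lambda>x. indicator S x *\<^sub>R f x)"
    by (rule borel_integrable_compact[OF assms(2)]) (rule continuous_on_subset[OF assms(1)], simp)
  also have "(\<lambda>x. indicator S x *\<^sub>R f x) = f"
  proof
    fix x show "indicator S x *\<^sub>R f x = f x" using assms(3)[of x] by (cases "x \<in> S") auto
  qed
  finally show ?thesis .
qed

text \<open>By translation invariance every difference quotient of f in direction b has integral 0.
  The mean value theorem dominates the quotients by a constant on a ball, so the limit has integral
  0 too; no slicing into lines is needed.\<close>

lemma integral_directional_derivative:
  fixes f :: "'a::euclidean_space \<Rightarrow> real"
  assumes d: "\<And>x. (f has_derivative f' x) (at x)" and c: "continuous_on UNIV (\<lambda>x. f' x b)"
    and S: "compact S" "\<And>x. x \<notin> S \<Longrightarrow> f x = 0"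
  shows "integrable lborel (\<lambda>x. f' x b)" "(LINT x|lborel. f' x b) = 0"
proof -
  have S': "f' x b = 0" if "x \<notin> S" for x
  proof -
    have "open (- S)" using S(1) by (simp add: compact_imp_closed open_Compl)
    have "(f has_derivative (\<lambda>_. 0)) (at x)"
      by (rule has_derivative_transform_within_open[of "\<lambda>_. 0" _ x UNIV "- S"])
        (use \<open>open (- S)\<close> that S(2) in auto)
    then have "f' x = (\<lambda>_. 0)" using d has_derivative_unique by blast
    then show ?thesis by simp
  qed
  show "integrable lborel (\<lambda>x. f' x b)"
    by (rule integrable_compact_support[OF c S(1) S'])
  have "bounded ((\<lambda>x. f' x b) ` S)"
    by (intro compact_imp_bounded compact_continuous_image S(1) continuous_on_subset[OF c]) simp
  then obtain L0 where L0: "\<And>x. x \<in> S \<Longrightarrow> \<bar>f' x b\<bar> \<le> L0"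
    by (auto simp: bounded_iff)
  define L where "L = max L0 0"
  have L: "L \<ge> 0" "\<And>x. x \<in> S \<Longrightarrow> \<bar>f' x b\<bar> \<le> L"
    using L0 by (auto simp: L_def le_max_iff_disj)
  have L': "\<bar>f' x b\<bar> \<le> L" for x using L S'[of x] by (cases "x \<in> S") auto
  obtain r where r: "\<And>x. x \<in> S \<Longrightarrow> norm x \<le> r" using compact_imp_bounded[OF S(1)] by (auto simp: bounded_iff)
  have f_cont: "continuous_on UNIV f"
    using d by (intro continuous_at_imp_continuous_on ballI has_derivative_continuous) auto
  have f_int: "integrable lborel f" by (rule integrable_compact_support[OF f_cont S])
  define t where "t j = 1 / real (Suc j)" for j
  have t: "t j > 0" "t j \<le> 1" for j by (auto simp: t_def)
  define q where "q j x = (f (t j *\<^sub>R b + x) - f x) / t j" for j x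
  have shift: "integrable lborel (\<lambda>x. f (v + x))" "(LINT x|lborel. f (v + x)) = (LINT x|lborel. f x)" for v
  proof -
    have "integrable (distr lborel borel ((+) v)) f" using f_int by (simp add: lborel_distr_plus)
    then show "integrable lborel (\<lambda>x. f (v + x))"
      by (subst (asm) integrable_distr_eq) (use f_int in auto)
    have "(LINT x|lborel. f x) = (LINT x|distr lborel borel ((+) v). f x)" by (simp add: lborel_distr_plus)
    also have "\<dots> = (LINT x|lborel. f (v + x))"
      by (subst integral_distr) (use f_int in auto)
    finally show "(LINT x|lborel. f (v + x)) = (LINT x|lborel. f x)" by simp
  qed
  have q0: "(LINT x|lborel. q j x) = 0" for j
    unfolding q_def using shift[of "t j *\<^sub>R b"] f_int by simp
  \<comment> \<open>The ball is enlarged by \<open>norm b\<close> because the support is shifted by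
    t_j b with t_j \<le> 1.\<close>
  have qb: "\<bar>q j x\<bar> \<le> L * indicator (cball 0 (r + norm b)) x" for j x
  proof (cases "x \<in> cball 0 (r + norm b)")
    case True
    have dl: "((\<lambda>s. f (s *\<^sub>R b + x)) has_real_derivative f' (s *\<^sub>R b + x) b) (at s)" for s
    proof -
      have "((\<lambda>s. s *\<^sub>R b + x) has_derivative (\<lambda>h. h *\<^sub>R b)) (at s)"
        by (auto intro!: derivative_eq_intros)
      from has_derivative_compose[OF this d]
      have "((\<lambda>s. f (s *\<^sub>R b + x)) has_derivative (\<lambda>h. f' (s *\<^sub>R b + x) (h *\<^sub>R b))) (at s)" .
      moreover have "f' (s *\<^sub>R b + x) (h *\<^sub>R b) = f' (s *\<^sub>R b + x) b * h" for h
        using linear_scale[OF has_derivative_linear[OF d]] by simp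
      ultimately show ?thesis by (simp add: has_field_derivative_def fun_eq_iff[symmetric])
    qed
    obtain z where "f (t j *\<^sub>R b + x) - f (0 *\<^sub>R b + x) = (t j - 0) * f' (z *\<^sub>R b + x) b"
      using MVT2[OF t(1)[of j] dl] by blast
    then have "q j x = f' (z *\<^sub>R b + x) b" using t(1)[of j] by (simp add: q_def)
    then show ?thesis using L' True by simp
  next
    case False
    have "x \<notin> S" using False r[of x] norm_ge_zero[of b] by (force simp: not_le)
    moreover have "t j *\<^sub>R b + x \<notin> S"
    proof
      assume "t j *\<^sub>R b + x \<in> S"
      then have "norm (t j *\<^sub>R b + x) \<le> r" by (rule r)
      moreover have "norm x \<le> norm (t j *\<^sub>R b + x) + norm (t j *\<^sub>R b)"
        using norm_triangle_ineq4[of "t j *\<^sub>R b + x" "t j *\<^sub>R b"] by simp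
      moreover have "norm (t j *\<^sub>R b) \<le> norm b" using t[of j] by (simp add: mult_left_le_one_le)
      ultimately show False using False by simp
    qed
    ultimately show ?thesis using S(2) False by (simp add: q_def)
  qed
  have qlim: "(\<lambda>j. q j x) \<longlonglongrightarrow> f' x b" for x
  proof -
    have dl: "((\<lambda>s. f (s *\<^sub>R b + x)) has_real_derivative f' x b) (at 0)"
    proof -
      have "((\<lambda>s. s *\<^sub>R b + x) has_derivative (\<lambda>h. h *\<^sub>R b)) (at 0)"
        by (auto intro!: derivative_eq_intros)
      from has_derivative_compose[OF this, of f "f' x"] d[of x]
      have "((\<lambda>s. f (s *\<^sub>R b + x)) has_derivative (\<lambda>h. f' x (h *\<^sub>R b))) (at 0)" by simp
      moreover have "f' x (h *\<^sub>R b) = f' x b * h" for h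
        using linear_scale[OF has_derivative_linear[OF d]] by simp
      ultimately show ?thesis by (simp add: has_field_derivative_def fun_eq_iff[symmetric])
    qed
    have "filterlim t (at 0) sequentially"
      unfolding filterlim_at t_def
      using LIMSEQ_Suc[OF lim_1_over_n] by (auto simp del: of_nat_Suc)
    from filterlim_compose[OF dl[unfolded DERIV_def] this]
    show ?thesis by (simp add: q_def)
  qed
  have "(\<lambda>j. LINT x|lborel. q j x) \<longlonglongrightarrow> (LINT x|lborel. f' x b)"
  proof (rule integral_dominated_convergence[where w="\<lambda>x. L * indicator (cball 0 (r + norm b)) x"])
    show "(\<lambda>x. f' x b) \<in> borel_measurable lborel"
      using borel_measurable_continuous_onI[OF c] by simp
    show "q j \<in> borel_measurable lborel" for j
      unfolding q_def using borel_measurable_continuous_onI[OF f_cont] by measurable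
    show "integrable lborel (\<lambda>x. L * indicator (cball 0 (r + norm b)) x :: real)"
      by (intro integrable_mult_right integrable_real_indicator) (auto simp: emeasure_compact_finite[OF compact_cball, unfolded infinity_ennreal_def])
  qed (use qb qlim in auto)
  then show "(LINT x|lborel. f' x b) = 0" using q0 LIMSEQ_unique[of "\<lambda>_. 0::real"] by simp
qed

text \<open>Only \<phi> has compact support, which suffices because the product \<phi> \<psi>
  inherits it.\<close>

lemma integral_by_parts_test:
  fixes \<phi> \<psi> :: "'a::euclidean_space \<Rightarrow> real"
  assumes \<phi>: "C_k 1 \<phi>" and \<psi>: "C_k 1 \<psi>" and S: "compact S" "\<And>x. x \<notin> S \<Longrightarrow> \<phi> x = 0" and b: "b \<in> Basis"
  shows "(LINT x|lborel. \<phi> x * frechet_derivative \<psi> (at x) b)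
    = - (LINT x|lborel. frechet_derivative \<phi> (at x) b * \<psi> x)"
proof -
  have c\<phi>: "continuous_on UNIV \<phi>" "continuous_on UNIV (\<lambda>x. frechet_derivative \<phi> (at x) b)"
    and c\<psi>: "continuous_on UNIV \<psi>" "continuous_on UNIV (\<lambda>x. frechet_derivative \<psi> (at x) b)"
    using C_k_continuous[OF \<phi>] C_k_continuous[OF \<psi>] \<phi> \<psi> b by simp_all
  have d: "((\<lambda>x. \<phi> x * \<psi> x) has_derivative
      (\<lambda>h. \<phi> x * frechet_derivative \<psi> (at x) h + frechet_derivative \<phi> (at x) h * \<psi> x)) (at x)" for x
    using has_derivative_mult[OF C_k_has_derivative C_k_has_derivative, of 0 \<phi> 0 \<psi> x] \<phi> \<psi> by simp
  have c: "continuous_on UNIV (\<lambda>x. \<phi> x * frechet_derivative \<psi> (at x) b + frechet_derivative \<phi> (at x) b * \<psi> x)"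
    by (intro continuous_on_add continuous_on_mult c\<phi> c\<psi>)
  have i1: "integrable lborel (\<lambda>x. \<phi> x * frechet_derivative \<psi> (at x) b)"
    by (rule integrable_compact_support[OF continuous_on_mult[OF c\<phi>(1) c\<psi>(2)] S(1)]) (simp add: S(2))
  have z: "(LINT x|lborel. \<phi> x * frechet_derivative \<psi> (at x) b + frechet_derivative \<phi> (at x) b * \<psi> x) = 0"
    "integrable lborel (\<lambda>x. \<phi> x * frechet_derivative \<psi> (at x) b + frechet_derivative \<phi> (at x) b * \<psi> x)"
    using integral_directional_derivative[OF d c S(1)] S(2) by simp_all
  have i2: "integrable lborel (\<lambda>x. frechet_derivative \<phi> (at x) b * \<psi> x)"
    using Bochner_Integration.integrable_diff[OF z(2) i1] by simp
  show ?thesis using z(1) Bochner_Integration.integral_add[OF i1 i2] by simp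
qed

section \<open>The fundamental lemma of the calculus of variations\<close>

lemma enn2real_eqD: "enn2real a = enn2real b \<Longrightarrow> a \<noteq> \<infinity> \<Longrightarrow> b \<noteq> \<infinity> \<Longrightarrow> a = b"
  by (cases a; cases b) auto

text \<open>The positive and the negative part of f are densities of two measures that agree on
  boxes, an intersection-stable generator of the Borel sets. Hence the measures agree, and
  uniqueness of densities forces both parts to coincide, so both vanish.\<close>

lemma AE_zero_of_box_integrals:
  fixes f :: "'a::euclidean_space \<Rightarrow> real"
  assumes f: "integrable lborel f" and z: "\<And>a b. (LINT x|lborel. indicator (box a b) x * f x) = 0"
  shows "AE x in lborel. f x = 0"
proof -
  have [measurable]: "f \<in> borel_measurable borel" using f by auto
  have i: "integrable lborel (\<lambda>x. indicator A x * f x)" if "A \<in> sets borel" for A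
    using integrable_mult_indicator[OF _ f, of A] that by simp
  have "density lborel (\<lambda>x. ennreal (f x)) = density lborel (\<lambda>x. ennreal (- f x))"
  proof (rule measure_eqI_generator_eq[where E="range (\<lambda>(a, b). box a b)" and \<Omega>=UNIV
        and A="\<lambda>n. box (- (real n *\<^sub>R One)) (real n *\<^sub>R One)"])
    show "Int_stable (range (\<lambda>(a, b). box a b :: 'a set))"
      unfolding Int_stable_def
    proof (intro ballI)
      fix X Y :: "'a set"
      assume "X \<in> range (\<lambda>(a, b). box a b)" "Y \<in> range (\<lambda>(a, b). box a b)"
      then obtain a b c d where X: "X = box a b" and Y: "Y = box c d" by auto
      show "X \<inter> Y \<in> range (\<lambda>(a, b). box a b)"
        unfolding X Y box_Int_box by (rule range_eqI[where x="(_, _)"]) (simp only: prod.case)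
    qed
    fix X :: "'a set" assume "X \<in> range (\<lambda>(a, b). box a b)"
    then obtain a b where X: "X = box a b" by auto
    have "enn2real (\<integral>\<^sup>+x. ennreal (indicator X x * f x) \<partial>lborel)
        = enn2real (\<integral>\<^sup>+x. ennreal (- (indicator X x * f x)) \<partial>lborel)"
      using real_lebesgue_integral_def[OF i[of X]] z[of a b] by (simp add: X)
    moreover have "(\<integral>\<^sup>+x. ennreal (indicator X x * f x) \<partial>lborel) \<noteq> \<infinity>"
      "(\<integral>\<^sup>+x. ennreal (- (indicator X x * f x)) \<partial>lborel) \<noteq> \<infinity>"
      using i[of X] by (auto simp: X real_integrable_def)
    ultimately have eq: "(\<integral>\<^sup>+x. ennreal (indicator X x * f x) \<partial>lborel) = (\<integral>\<^sup>+x. ennreal (- (indicator X x * f x)) \<partial>lborel)"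
      by (rule enn2real_eqD)
    have arith: "ennreal (indicator X x * f x) = ennreal (f x) * indicator X x"
      "ennreal (- (indicator X x * f x)) = ennreal (- f x) * indicator X x" for x
      by (auto simp: indicator_def)
    have "X \<in> sets lborel" by (simp add: X)
    then show "emeasure (density lborel (\<lambda>x. ennreal (f x))) X = emeasure (density lborel (\<lambda>x. ennreal (- f x))) X"
      using eq unfolding arith by (subst (1 2) emeasure_density) simp_all
  next
    show "sets (density lborel (\<lambda>x. ennreal (f x))) = sigma_sets UNIV (range (\<lambda>(a, b). box a b))"
      "sets (density lborel (\<lambda>x. ennreal (- f x))) = sigma_sets UNIV (range (\<lambda>(a, b). box a b))"
      by (simp_all add: borel_eq_box)
    show "(\<Union>n. box (- (real n *\<^sub>R One)) (real n *\<^sub>R One) :: 'a set) = UNIV"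
      by (rule UN_box_eq_UNIV)
    show "emeasure (density lborel (\<lambda>x. ennreal (f x))) (box (- (real n *\<^sub>R One)) (real n *\<^sub>R One)) \<noteq> \<infinity>" for n
    proof -
      have "emeasure (density lborel (\<lambda>x. ennreal (f x))) (box (- (real n *\<^sub>R One)) (real n *\<^sub>R One))
          \<le> (\<integral>\<^sup>+x. ennreal (f x) \<partial>lborel)"
        by (subst emeasure_density) (auto intro!: nn_integral_mono simp: indicator_def)
      then show ?thesis using f by (auto simp: real_integrable_def top_unique)
    qed
    show "range (\<lambda>n. box (- (real n *\<^sub>R One)) (real n *\<^sub>R One)) \<subseteq> range (\<lambda>(a, b). box a b :: 'a set)"
      by (rule image_subsetI, rule range_eqI[where x="(_, _)"], simp only: prod.case)
  qed simp
  then have "AE x in lborel. ennreal (f x) = ennreal (- f x)"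
    using sigma_finite_measure.density_unique_iff[OF sigma_finite_lborel, of "\<lambda>x. ennreal (f x)" "\<lambda>x. ennreal (- f x)"] by simp
  moreover have "f x = 0" if "ennreal (f x) = ennreal (- f x)" for x
  proof (cases "0 \<le> f x")
    case True
    then have "ennreal (f x) = 0" unfolding that by (intro ennreal_neg) simp
    then show ?thesis using True unfolding ennreal_eq_0_iff by linarith
  next
    case False
    then have "ennreal (- f x) = 0" unfolding that[symmetric] by (intro ennreal_neg) simp
    then show ?thesis using False unfolding ennreal_eq_0_iff by linarith
  qed
  ultimately show ?thesis by (rule eventually_mono)
qed

text \<open>A smooth approximation of the indicator of the open box from inside: the factor j pushes
  each argument to \<infinity> within the box, where exp(-1/t) tends to 1, without moving the
  support.\<close>

definition box_bump :: "'a::euclidean_space \<Rightarrow> 'a \<Rightarrow> nat \<Rightarrow> 'a \<Rightarrow> real" where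
  "box_bump a b j x = (\<Prod>i\<in>Basis. exp_cutoff 0 (real j * ((x \<bullet> i - a \<bullet> i) * (b \<bullet> i - x \<bullet> i))))"

lemma exp_cutoff_0_bounds: "0 \<le> exp_cutoff 0 t" "exp_cutoff 0 t \<le> 1"
  by (auto simp: exp_cutoff_def)

lemma exp_cutoff_nonpos: "t \<le> 0 \<Longrightarrow> exp_cutoff j t = 0"
  by (simp add: exp_cutoff_def)

lemma box_bump_bounds: "0 \<le> box_bump a b j x" "box_bump a b j x \<le> 1"
  unfolding box_bump_def using exp_cutoff_0_bounds by (auto intro!: prod_nonneg prod_le_1)

lemma C_k_box_bump: "C_k k (box_bump a b j)"
proof -
  have "C_k k (\<lambda>x::'a. \<Prod>i\<in>Basis. exp_cutoff 0 (real j * ((x \<bullet> i + (- (a \<bullet> i))) * (b \<bullet> i + (-1) * (x \<bullet> i)))))"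
    by (intro C_k_prod C_k_compose[OF smooth_upto_exp_cutoff] C_k_mult C_k_add C_k_const C_k_inner) simp
  then show ?thesis by (simp add: box_bump_def[abs_def])
qed

text \<open>The ordering of a and b is essential: for b < x < a the product of the two negative
  factors would be positive although the box is empty.\<close>

lemma box_bump_outside:
  assumes "x \<notin> box a b" "\<And>i. i \<in> Basis \<Longrightarrow> a \<bullet> i \<le> b \<bullet> i"
  shows "box_bump a b j x = 0"
proof -
  obtain i where i: "i \<in> Basis" "\<not> (a \<bullet> i < x \<bullet> i \<and> x \<bullet> i < b \<bullet> i)"
    using assms(1) by (auto simp: mem_box)
  have "(x \<bullet> i - a \<bullet> i) * (b \<bullet> i - x \<bullet> i) \<le> 0"
  proof (cases "x \<bullet> i \<le> a \<bullet> i")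
    case True
    then show ?thesis using assms(2)[OF i(1)] by (intro mult_nonpos_nonneg) auto
  next
    case False
    then show ?thesis using i(2) by (intro mult_nonneg_nonpos) auto
  qed
  then have "real j * ((x \<bullet> i - a \<bullet> i) * (b \<bullet> i - x \<bullet> i)) \<le> 0"
    by (rule mult_nonneg_nonpos[OF of_nat_0_le_iff])
  then have "exp_cutoff 0 (real j * ((x \<bullet> i - a \<bullet> i) * (b \<bullet> i - x \<bullet> i))) = 0"
    by (rule exp_cutoff_nonpos)
  then show ?thesis unfolding box_bump_def using i(1) by (intro prod_zero) auto
qed

lemma box_bump_tendsto:
  assumes "x \<in> box a b"
  shows "(\<lambda>j. box_bump a b j x) \<longlonglongrightarrow> 1"
proof -
  have "(\<lambda>j. box_bump a b j x) \<longlonglongrightarrow> (\<Prod>i\<in>(Basis::'a set). 1)"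
    unfolding box_bump_def
  proof (rule tendsto_prod)
    fix i :: 'a assume i: "i \<in> Basis"
    define c where "c = (x \<bullet> i - a \<bullet> i) * (b \<bullet> i - x \<bullet> i)"
    have c: "c > 0" using assms i by (auto simp: c_def mem_box)
    have "(\<lambda>j. exp (- 1 / (real j * c))) \<longlonglongrightarrow> 1" using c by real_asymp
    then have "(\<lambda>j. exp_cutoff 0 (real j * c)) \<longlonglongrightarrow> 1"
      by (rule Lim_transform_eventually)
        (use eventually_gt_at_top[of 0] in eventually_elim, use c in \<open>auto simp: exp_cutoff_def\<close>)
    then show "(\<lambda>j. exp_cutoff 0 (real j * ((x \<bullet> i - a \<bullet> i) * (b \<bullet> i - x \<bullet> i)))) \<longlonglongrightarrow> 1"
      by (simp add: c_def)
  qed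
  then show ?thesis by simp
qed

lemma test_functionsI:
  assumes "\<And>k. C_k k \<phi>" "compact S" "S \<subseteq> \<Omega>" "\<And>x. x \<notin> S \<Longrightarrow> \<phi> x = 0"
  shows "\<phi> \<in> test_functions \<Omega>"
proof -
  have "closure {x. \<phi> x \<noteq> 0} \<subseteq> S"
    using assms(2,4) by (intro closure_minimal compact_imp_closed) auto
  moreover from this have "compact (closure {x. \<phi> x \<noteq> 0})"
    using assms(2) by (metis closed_closure compact_Int_closed inf.absorb_iff2)
  ultimately show ?thesis using assms by (auto simp: test_functions_def)
qed

lemma box_bump_test_function:
  assumes "cbox a b \<subseteq> \<Omega>" "\<And>i. i \<in> Basis \<Longrightarrow> a \<bullet> i \<le> b \<bullet> i"
  shows "box_bump a b j \<in> test_functions \<Omega>"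
proof (rule test_functionsI[OF C_k_box_bump compact_cbox assms(1)])
  fix x assume "x \<notin> cbox a b"
  then have "x \<notin> box a b" using box_subset_cbox by blast
  then show "box_bump a b j x = 0" by (rule box_bump_outside) (rule assms(2))
qed

lemma integral_lebesgue_on:
  fixes f :: "'a::euclidean_space \<Rightarrow> 'b::{banach, second_countable_topology}"
  assumes "S \<in> sets lebesgue"
  shows "(LINT x|lebesgue_on S. f x) = (LINT x|lebesgue. indicator S x *\<^sub>R f x)"
    "integrable (lebesgue_on S) f \<longleftrightarrow> integrable lebesgue (\<lambda>x. indicator S x *\<^sub>R f x)"
  using assms by (simp_all add: integral_restrict_space integrable_restrict_space)

text \<open>Box bumps transfer the hypothesis to integrals of f over boxes by dominated convergence.
  Inside one closed box f is integrable, so the box criterion applies to its truncation; countably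
  many boxes exhaust \<Omega>.\<close>

lemma fundamental_lemma:
  fixes f :: "'a::euclidean_space \<Rightarrow> real"
  assumes \<Omega>: "open \<Omega>" and f: "locally_integrable \<Omega> f"
    and z: "\<And>\<phi>. \<phi> \<in> test_functions \<Omega> \<Longrightarrow> (LINT x|lebesgue_on \<Omega>. f x * \<phi> x) = 0"
  shows "AE x in lebesgue_on \<Omega>. f x = 0"
proof -
  have \<Omega>_sets: "\<Omega> \<in> sets lebesgue" using \<Omega> by auto
  have loc: "integrable lebesgue (\<lambda>x. indicator (cbox a b) x * f x)" if "cbox a b \<subseteq> \<Omega>" for a b
    using f that integral_lebesgue_on(2)[of "cbox a b" f] by (auto simp: locally_integrable_def)
  have boxes: "(LINT x|lebesgue. indicator (box a b) x * f x) = 0" if ab: "cbox a b \<subseteq> \<Omega>" for a b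
  proof (cases "box a b = {}")
    case False
    then have le: "a \<bullet> i \<le> b \<bullet> i" if "i \<in> Basis" for i
      using that by (auto simp: box_ne_empty less_imp_le)
    have "(\<lambda>j. LINT x|lebesgue. indicator (cbox a b) x * f x * box_bump a b j x)
        \<longlonglongrightarrow> (LINT x|lebesgue. indicator (box a b) x * f x)"
    proof (rule integral_dominated_convergence[where w="\<lambda>x. \<bar>indicator (cbox a b) x * f x\<bar>"])
      have m: "(\<lambda>x. indicator (cbox a b) x * f x) \<in> borel_measurable lebesgue"
        using loc[OF ab] by auto
      show "(\<lambda>x. indicator (cbox a b) x * f x * box_bump a b j x) \<in> borel_measurable lebesgue" for j
        using borel_measurable_continuous_onI[OF C_k_continuous[OF C_k_box_bump[of 0 a b j]]]
        by (intro borel_measurable_times[OF m] measurable_completion) simp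
      have "(\<lambda>x. indicator (box a b) x * (indicator (cbox a b) x * f x)) \<in> borel_measurable lebesgue"
        by (rule borel_measurable_times[OF borel_measurable_indicator m]) simp
      moreover have "(\<lambda>x. indicator (box a b) x * (indicator (cbox a b) x * f x)) = (\<lambda>x. indicator (box a b) x * f x)"
        using box_subset_cbox[of a b] by (auto simp: indicator_def fun_eq_iff)
      ultimately show "(\<lambda>x. indicator (box a b) x * f x) \<in> borel_measurable lebesgue" by simp
      show "integrable lebesgue (\<lambda>x. \<bar>indicator (cbox a b) x * f x\<bar>)" using loc[OF ab] by (rule integrable_abs)
      show "AE x in lebesgue. (\<lambda>j. indicator (cbox a b) x * f x * box_bump a b j x) \<longlonglongrightarrow> indicator (box a b) x * f x"
      proof (rule AE_I2)
        fix x
        show "(\<lambda>j. indicator (cbox a b) x * f x * box_bump a b j x) \<longlonglongrightarrow> indicator (box a b) x * f x"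
        proof (cases "x \<in> box a b")
          case True
          then have "x \<in> cbox a b" using box_subset_cbox by blast
          then show ?thesis using tendsto_mult[OF tendsto_const box_bump_tendsto[OF True], of "f x"] True by simp
        qed (simp add: box_bump_outside[OF _ le])
      qed
      show "AE x in lebesgue. norm (indicator (cbox a b) x * f x * box_bump a b j x) \<le> \<bar>indicator (cbox a b) x * f x\<bar>" for j
        using box_bump_bounds[of a b j] by (intro AE_I2) (auto simp: abs_mult indicator_def mult_left_le)
    qed
    moreover have "(LINT x|lebesgue. indicator (cbox a b) x * f x * box_bump a b j x) = 0" for j
    proof -
      have "(LINT x|lebesgue. indicator (cbox a b) x * f x * box_bump a b j x)
          = (LINT x|lebesgue. indicator \<Omega> x *\<^sub>R (f x * box_bump a b j x))"
      proof (rule Bochner_Integration.integral_cong[OF refl])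
        fix x
        show "indicator (cbox a b) x * f x * box_bump a b j x = indicator \<Omega> x *\<^sub>R (f x * box_bump a b j x)"
        proof (cases "x \<in> box a b")
          case True
          then have "x \<in> cbox a b" "x \<in> \<Omega>" using ab box_subset_cbox by blast+
          then show ?thesis by simp
        next
          case False
          then have "box_bump a b j x = 0" by (rule box_bump_outside[OF _ le])
          then show ?thesis by simp
        qed
      qed
      also have "\<dots> = 0"
        using z[OF box_bump_test_function[OF ab le]]
        unfolding integral_lebesgue_on(1)[OF \<Omega>_sets] .
      finally show ?thesis .
    qed
    ultimately show ?thesis using LIMSEQ_unique[of "\<lambda>_. 0::real"] by simp
  qed simp
  have zero: "AE x in lebesgue. x \<in> box a b \<longrightarrow> f x = 0" if ab: "cbox a b \<subseteq> \<Omega>" for a b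
  proof -
    let ?f = "\<lambda>x. indicator (box a b) x * f x"
    have "(\<lambda>x. indicator (box a b) x * (indicator (cbox a b) x * f x)) = ?f"
      using box_subset_cbox[of a b] by (auto simp: indicator_def fun_eq_iff)
    then have int: "integrable lebesgue ?f"
      using integrable_mult_indicator[OF _ loc[OF ab], of "box a b"] by simp
    \<comment> \<open>f is only Lebesgue measurable, while the box criterion compares Borel
      measures, so a Borel representative takes its place.\<close>
    obtain f' where f': "f' \<in> borel_measurable lborel" "AE x in lborel. ?f x = f' x"
      using completion_ex_borel_measurable_real[of ?f lborel] int by auto
    have ae: "AE x in lebesgue. ?f x = f' x" using f'(2) by (rule AE_completion)
    have m: "f' \<in> borel_measurable lebesgue" using f'(1) by (rule measurable_completion)
    have int': "integrable lborel f'"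
      using int f' integrable_cong_AE[OF _ m ae] by (simp add: integrable_completion)
    have "AE x in lborel. f' x = 0"
    proof (rule AE_zero_of_box_integrals[OF int'])
      fix c d :: 'a
      have "(LINT x|lborel. indicator (box c d) x * f' x) = (LINT x|lebesgue. indicator (box c d) x * f' x)"
        by (rule integral_completion[symmetric]) (use f' in auto)
      also have "\<dots> = (LINT x|lebesgue. indicator (box c d) x * ?f x)"
      proof (rule integral_cong_AE)
        show "(\<lambda>x. indicator (box c d) x * f' x) \<in> borel_measurable lebesgue"
          by (rule borel_measurable_times[OF borel_measurable_indicator m]) simp
        show "(\<lambda>x. indicator (box c d) x * ?f x) \<in> borel_measurable lebesgue"
          by (rule borel_measurable_times[OF borel_measurable_indicator borel_measurable_integrable[OF int]]) simp
        show "AE x in lebesgue. indicator (box c d) x * f' x = indicator (box c d) x * ?f x"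
          using ae by eventually_elim simp
      qed
      also have "\<dots> = (LINT x|lebesgue. indicator (box c d \<inter> box a b) x * f x)"
        by (simp add: indicator_inter_arith mult.assoc)
      also have "\<dots> = 0"
      proof (cases "box c d \<inter> box a b = {}")
        case False
        obtain p q where pq: "box c d \<inter> box a b = box p q"
          by (rule that[OF box_Int_box])
        \<comment> \<open>Nonemptiness is needed here: for an empty intersection the corners p, q
          could describe a closed box not contained in the given one.\<close>
        have "cbox p q = closure (box p q)" using False pq by (simp add: closure_box)
        also have "\<dots> \<subseteq> cbox a b"
          using pq box_subset_cbox[of a b] by (intro closure_minimal) auto
        finally show ?thesis using ab boxes[of p q] pq by simp
      qed simp
      finally show "(LINT x|lborel. indicator (box c d) x * f' x) = 0" .
    qed
    then have "AE x in lebesgue. f' x = 0" by (rule AE_completion)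
    with ae show ?thesis by eventually_elim (auto simp: indicator_def)
  qed
  obtain \<D> where \<D>: "countable \<D>" "\<D> \<subseteq> Pow \<Omega>" "\<And>X. X \<in> \<D> \<Longrightarrow> \<exists>a b. X = cbox a b" "\<Union>\<D> = \<Omega>"
    using open_countable_Union_open_cbox[OF \<Omega>] by blast
  have "AE x in lebesgue. x \<in> X \<longrightarrow> f x = 0" if X: "X \<in> \<D>" for X
  proof -
    obtain a b where ab: "X = cbox a b" using \<D>(3)[OF X] by auto
    have "negligible (cbox a b - box a b)" by (rule negligible_frontier_interval)
    then have 1: "AE x in lebesgue. x \<notin> cbox a b - box a b"
      by (intro AE_not_in) (simp add: negligible_iff_null_sets)
    have "cbox a b \<subseteq> \<Omega>" using \<D>(2) X ab by auto
    from zero[OF this] 1 show ?thesis unfolding ab by eventually_elim blast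
  qed
  then have "AE x in lebesgue. \<forall>X\<in>\<D>. x \<in> X \<longrightarrow> f x = 0"
    by (subst AE_ball_countable[OF \<D>(1)]) blast
  then have "AE x in lebesgue. x \<in> \<Omega> \<longrightarrow> f x = 0"
    by eventually_elim (use \<D>(4) in auto)
  then show ?thesis using AE_restrict_space_iff[of \<Omega> lebesgue] \<Omega>_sets by simp
qed

section \<open>Weak gradients and test functions\<close>

lemma locally_integrable_diff:
  "locally_integrable \<Omega> f \<Longrightarrow> locally_integrable \<Omega> g \<Longrightarrow> locally_integrable \<Omega> (\<lambda>x. f x - g x)"
  by (auto simp: locally_integrable_def)

lemma locally_integrable_inner:
  "locally_integrable \<Omega> f \<Longrightarrow> locally_integrable \<Omega> (\<lambda>x. f x \<bullet> b)"
  by (auto simp: locally_integrable_def)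

lemma compact_support_bounded:
  fixes f :: "'a::euclidean_space \<Rightarrow> 'b::real_normed_vector"
  assumes "continuous_on UNIV f" "compact S" "\<And>x. x \<notin> S \<Longrightarrow> f x = 0"
  obtains L where "L > 0" "\<And>x. norm (f x) \<le> L"
proof -
  have "bounded (f ` S)"
    by (intro compact_imp_bounded compact_continuous_image assms(2) continuous_on_subset[OF assms(1)]) simp
  then obtain L0 where L0: "\<And>x. x \<in> S \<Longrightarrow> norm (f x) \<le> L0" by (auto simp: bounded_iff)
  have b: "norm (f x) \<le> max L0 1" for x
    using L0[of x] assms(3)[of x] by (cases "x \<in> S") auto
  show ?thesis by (rule that[OF _ b]) simp
qed

lemma test_functionsD:
  assumes "\<phi> \<in> test_functions \<Omega>"
  shows "compact (closure {x. \<phi> x \<noteq> 0})" "closure {x. \<phi> x \<noteq> 0} \<subseteq> \<Omega>"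
    "x \<notin> closure {x. \<phi> x \<noteq> 0} \<Longrightarrow> \<phi> x = 0" "C_k k \<phi>"
proof -
  show "\<phi> x = 0" if "x \<notin> closure {x. \<phi> x \<noteq> 0}"
    using contra_subsetD[OF closure_subset that] by simp
qed (use assms in \<open>simp_all only: test_functions_def mem_Collect_eq\<close>)

lemma frechet_derivative_outside:
  assumes "closed S" "\<And>x. x \<notin> S \<Longrightarrow> f x = 0" "x \<notin> S"
  shows "frechet_derivative f (at x) = (\<lambda>_. 0)"
proof -
  have "(f has_derivative (\<lambda>_. 0)) (at x)"
    by (rule has_derivative_transform_within_open[of "\<lambda>_. 0" _ x UNIV "- S"])
      (use assms in \<open>auto simp: open_Compl\<close>)
  from frechet_derivative_at[OF this] show ?thesis by (rule sym)
qed

lemma locally_integrable_mult_test: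
  fixes f :: "'a::euclidean_space \<Rightarrow> real"
  assumes \<Omega>: "open \<Omega>" and f: "locally_integrable \<Omega> f" and \<phi>: "\<phi> \<in> test_functions \<Omega>"
  shows "integrable (lebesgue_on \<Omega>) (\<lambda>x. f x * \<phi> x)"
proof -
  define S where "S = closure {x. \<phi> x \<noteq> 0}"
  note S = test_functionsD(1-3)[OF \<phi>, folded S_def] and C = test_functionsD(4)[OF \<phi>]
  have cont: "continuous_on UNIV \<phi>" by (rule C_k_continuous[OF C[of 0]])
  obtain L where L: "\<And>x. norm (\<phi> x) \<le> L" using compact_support_bounded[OF cont S(1,3)] by blast
  have S_sets: "S \<in> sets lebesgue" using S(1) by (simp add: compact_imp_closed)
  have int: "integrable lebesgue (\<lambda>x. indicator S x *\<^sub>R f x)"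
    using f S integral_lebesgue_on(2)[OF S_sets, of f] by (simp add: locally_integrable_def)
  have "integrable lebesgue (\<lambda>x. indicator S x *\<^sub>R f x * \<phi> x)"
  proof (rule Bochner_Integration.integrable_bound[OF integrable_mult_right[OF integrable_norm[OF int], of L]])
    have "\<phi> \<in> borel_measurable lebesgue"
      using borel_measurable_continuous_onI[OF cont] by (intro measurable_completion) simp
    then show "(\<lambda>x. indicator S x *\<^sub>R f x * \<phi> x) \<in> borel_measurable lebesgue"
      by (rule borel_measurable_times[OF borel_measurable_integrable[OF int]])
    show "AE x in lebesgue. norm (indicator S x *\<^sub>R f x * \<phi> x) \<le> norm (L * norm (indicator S x *\<^sub>R f x))"
    proof (rule AE_I2)
      fix x
      have "norm (indicator S x *\<^sub>R f x * \<phi> x) \<le> norm (indicator S x *\<^sub>R f x) * L"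
        unfolding norm_mult by (intro mult_left_mono L norm_ge_zero)
      then show "norm (indicator S x *\<^sub>R f x * \<phi> x) \<le> norm (L * norm (indicator S x *\<^sub>R f x))"
        by (simp add: mult.commute)
    qed
  qed
  also have "(\<lambda>x. indicator S x *\<^sub>R f x * \<phi> x) = (\<lambda>x. indicator \<Omega> x *\<^sub>R (f x * \<phi> x))"
  proof
    fix x show "indicator S x *\<^sub>R f x * \<phi> x = indicator \<Omega> x *\<^sub>R (f x * \<phi> x)"
      using S(2,3) by (cases "x \<in> S") auto
  qed
  finally show ?thesis using \<Omega> integral_lebesgue_on(2)[of \<Omega> "\<lambda>x. f x * \<phi> x"] by auto
qed

text \<open>Makes the choice in \<open>weak_gradient\<close> harmless: whatever gradient is computed
  explicitly agrees with the chosen one almost everywhere.\<close>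

lemma weak_gradient_unique:
  fixes u :: "'a::euclidean_space \<Rightarrow> real"
  assumes \<Omega>: "open \<Omega>" and U: "has_weak_gradient \<Omega> u U" and V: "has_weak_gradient \<Omega> u V"
  shows "AE x in lebesgue_on \<Omega>. U x = V x"
proof -
  have "AE x in lebesgue_on \<Omega>. U x \<bullet> b - V x \<bullet> b = 0" if b: "b \<in> Basis" for b
  proof (rule fundamental_lemma[OF \<Omega>])
    have lU: "locally_integrable \<Omega> (\<lambda>x. U x \<bullet> b)" and lV: "locally_integrable \<Omega> (\<lambda>x. V x \<bullet> b)"
      using U V by (simp_all add: has_weak_gradient_def locally_integrable_inner)
    then show "locally_integrable \<Omega> (\<lambda>x. U x \<bullet> b - V x \<bullet> b)" by (rule locally_integrable_diff)
    fix \<phi> :: "'a \<Rightarrow> real" assume \<phi>: "\<phi> \<in> test_functions \<Omega>"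
    have "(LINT x|lebesgue_on \<Omega>. (U x \<bullet> b) * \<phi> x) = (LINT x|lebesgue_on \<Omega>. (V x \<bullet> b) * \<phi> x)"
      using U V \<phi> b unfolding has_weak_gradient_def by simp
    then show "(LINT x|lebesgue_on \<Omega>. (U x \<bullet> b - V x \<bullet> b) * \<phi> x) = 0"
      using Bochner_Integration.integral_diff[OF locally_integrable_mult_test[OF \<Omega> lU \<phi>] locally_integrable_mult_test[OF \<Omega> lV \<phi>]]
      by (simp add: left_diff_distrib)
  qed
  then have "AE x in lebesgue_on \<Omega>. \<forall>b\<in>Basis. U x \<bullet> b - V x \<bullet> b = 0"
    by (intro eventually_ball_finite) auto
  then show ?thesis
    by (rule eventually_mono) (auto intro: euclidean_eqI)
qed

definition grad :: "('a::euclidean_space \<Rightarrow> real) \<Rightarrow> 'a \<Rightarrow> 'a" where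
  "grad \<phi> x = (\<Sum>b\<in>Basis. frechet_derivative \<phi> (at x) b *\<^sub>R b)"

lemma grad_inner: "b \<in> Basis \<Longrightarrow> grad \<phi> x \<bullet> b = frechet_derivative \<phi> (at x) b"
  by (simp add: grad_def)

lemma continuous_measurable_lebesgue_on:
  fixes f :: "'a::euclidean_space \<Rightarrow> 'b::euclidean_space"
  assumes "continuous_on UNIV f"
  shows "f \<in> borel_measurable (lebesgue_on \<Omega>)"
  using borel_measurable_continuous_onI[OF assms]
  by (intro measurable_restrict_space1 measurable_completion) simp

lemma continuous_locally_integrable:
  fixes f :: "'a::euclidean_space \<Rightarrow> 'b::euclidean_space"
  assumes "continuous_on UNIV f"
  shows "locally_integrable \<Omega> f"
  unfolding locally_integrable_def
proof (intro allI impI)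
  fix K :: "'a set" assume "compact K \<and> K \<subseteq> \<Omega>"
  then have K: "compact K" by simp
  have i: "integrable lborel (\<lambda>x. indicator K x *\<^sub>R f x)"
    by (rule borel_integrable_compact[OF K]) (rule continuous_on_subset[OF assms], simp)
  then have "integrable lebesgue (\<lambda>x. indicator K x *\<^sub>R f x)"
    by (subst integrable_completion[OF borel_measurable_integrable[OF i]])
  then show "integrable (lebesgue_on K) f"
    using K integral_lebesgue_on(2)[of K f] by (simp add: compact_imp_closed)
qed

lemma integral_lebesgue_on_lborel:
  fixes f :: "'a::euclidean_space \<Rightarrow> real"
  assumes "\<Omega> \<in> sets lebesgue" "f \<in> borel_measurable borel" "\<And>x. x \<notin> \<Omega> \<Longrightarrow> f x = 0"
  shows "(LINT x|lebesgue_on \<Omega>. f x) = (LINT x|lborel. f x)"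
    "integrable (lebesgue_on \<Omega>) f \<longleftrightarrow> integrable lborel f"
proof -
  have "(\<lambda>x. indicator \<Omega> x *\<^sub>R f x) = f"
  proof
    fix x show "indicator \<Omega> x *\<^sub>R f x = f x" using assms(3)[of x] by (cases "x \<in> \<Omega>") auto
  qed
  then show "(LINT x|lebesgue_on \<Omega>. f x) = (LINT x|lborel. f x)"
    "integrable (lebesgue_on \<Omega>) f \<longleftrightarrow> integrable lborel f"
    using integral_lebesgue_on[OF assms(1), of f] assms(2)
    by (simp_all add: integral_completion integrable_completion)
qed

lemma grad_continuous:
  assumes "C_k 1 \<phi>"
  shows "continuous_on UNIV (grad \<phi>)" "b \<in> Basis \<Longrightarrow> continuous_on UNIV (\<lambda>x. frechet_derivative \<phi> (at x) b)"
proof -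
  have c: "continuous_on UNIV (\<lambda>x. frechet_derivative \<phi> (at x) b)" if "b \<in> Basis" for b
    using assms that by simp
  then show "b \<in> Basis \<Longrightarrow> continuous_on UNIV (\<lambda>x. frechet_derivative \<phi> (at x) b)" .
  show "continuous_on UNIV (grad \<phi>)"
    unfolding grad_def[abs_def] by (intro continuous_on_sum continuous_on_scaleR continuous_on_const c)
qed

text \<open>In the integration by parts the compact support is supplied by the test function \<psi>
  of the definition, so all integrals over \<Omega> extend to the whole space.\<close>

lemma test_has_weak_gradient:
  fixes \<phi> :: "'a::euclidean_space \<Rightarrow> real"
  assumes \<Omega>: "open \<Omega>" and \<phi>: "\<phi> \<in> test_functions \<Omega>"
  shows "has_weak_gradient \<Omega> \<phi> (grad \<phi>)"
proof -
  have C: "C_k k \<phi>" for k using \<phi> by (simp add: test_functions_def)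
  have c: "continuous_on UNIV \<phi>" "continuous_on UNIV (grad \<phi>)"
    using C_k_continuous[OF C[of 0]] grad_continuous[OF C[of 1]] by auto
  have "(LINT x|lebesgue_on \<Omega>. \<phi> x * frechet_derivative \<psi> (at x) b)
      = - (LINT x|lebesgue_on \<Omega>. (grad \<phi> x \<bullet> b) * \<psi> x)"
    if \<psi>: "\<psi> \<in> test_functions \<Omega>" and b: "b \<in> Basis" for \<psi> b
  proof -
    define S where "S = closure {x. \<psi> x \<noteq> 0}"
  note S = test_functionsD(1-3)[OF \<psi>, folded S_def] and C' = test_functionsD(4)[OF \<psi>]
    have c': "continuous_on UNIV \<psi>" "continuous_on UNIV (\<lambda>x. frechet_derivative \<psi> (at x) b)"
      using C_k_continuous[OF C'[of 0]] grad_continuous(2)[OF C'[of 1] b] by auto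
    have z: "frechet_derivative \<psi> (at x) b = 0" if "x \<notin> \<Omega>" for x
    proof -
      have "x \<notin> S" using that S(2) by blast
      from frechet_derivative_outside[OF compact_imp_closed[OF S(1)] S(3) this] show ?thesis by simp
    qed
    have z': "\<psi> x = 0" if "x \<notin> \<Omega>" for x using S(2,3) that by blast
    have \<Omega>': "\<Omega> \<in> sets lebesgue" using \<Omega> by simp
    have "(LINT x|lebesgue_on \<Omega>. \<phi> x * frechet_derivative \<psi> (at x) b)
      = (LINT x|lborel. \<phi> x * frechet_derivative \<psi> (at x) b)"
      by (rule integral_lebesgue_on_lborel(1)[OF \<Omega>'])
        (simp_all add: z borel_measurable_continuous_onI[OF continuous_on_mult[OF c(1) c'(2)]])
    also have "\<dots> = (LINT x|lborel. frechet_derivative \<psi> (at x) b * \<phi> x)"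
      by (simp add: mult.commute)
    also have "\<dots> = - (LINT x|lborel. \<psi> x * frechet_derivative \<phi> (at x) b)"
      using integral_by_parts_test[OF C'[of 1] C[of 1] S(1,3) b] by simp
    also have "\<dots> = - (LINT x|lborel. frechet_derivative \<phi> (at x) b * \<psi> x)"
      by (simp add: mult.commute)
    also have "(LINT x|lborel. frechet_derivative \<phi> (at x) b * \<psi> x)
        = (LINT x|lebesgue_on \<Omega>. frechet_derivative \<phi> (at x) b * \<psi> x)"
      by (rule integral_lebesgue_on_lborel(1)[OF \<Omega>', symmetric])
        (simp_all add: z' borel_measurable_continuous_onI[OF continuous_on_mult[OF grad_continuous(2)[OF C[of 1] b] c'(1)]])
    finally show ?thesis by (simp add: grad_inner[OF b])
  qed
  then show ?thesis
    unfolding has_weak_gradient_def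
    using continuous_measurable_lebesgue_on[OF c(1)] continuous_measurable_lebesgue_on[OF c(2)]
      continuous_locally_integrable[OF c(1)] continuous_locally_integrable[OF c(2)] by blast
qed

lemma weak_gradient_test:
  assumes "open \<Omega>" "\<phi> \<in> test_functions \<Omega>"
  shows "has_weak_gradient \<Omega> \<phi> (weak_gradient \<Omega> \<phi>)"
    "AE x in lebesgue_on \<Omega>. weak_gradient \<Omega> \<phi> x = grad \<phi> x"
proof -
  show "has_weak_gradient \<Omega> \<phi> (weak_gradient \<Omega> \<phi>)"
    unfolding weak_gradient_def
    by (rule someI[where P="has_weak_gradient \<Omega> \<phi>", OF test_has_weak_gradient[OF assms]])
  then show "AE x in lebesgue_on \<Omega>. weak_gradient \<Omega> \<phi> x = grad \<phi> x"
    using weak_gradient_unique[OF assms(1)] test_has_weak_gradient[OF assms] by blast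
qed

lemma zero_test_function: "(\<lambda>x::'a::euclidean_space. 0) \<in> test_functions \<Omega>"
  by (rule test_functionsI[of _ "{}"]) (auto intro: C_k_const)

lemma grad_zero: "grad (\<lambda>x::'a::euclidean_space. 0) x = 0"
  by (simp add: grad_def)

text \<open>Every l > 0 is admissible since G 0 = 0.\<close>

lemma luxemburg_norm_zero:
  assumes G: "N_function g G" and f: "AE x in M. f x = 0"
  shows "luxemburg_norm M G f = 0"
proof -
  have "luxemburg_norm M G f \<le> ennreal e" if "e > 0" for e :: real
    unfolding luxemburg_norm_def
  proof (rule INF_lower, simp add: that)
    have "(\<integral>\<^sup>+x. ennreal (G (\<bar>f x\<bar> / e)) \<partial>M) = (\<integral>\<^sup>+x. 0 \<partial>M)"
      by (rule nn_integral_cong_AE) (use f in eventually_elim, simp add: N_function_zero[OF G])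
    then show "(\<integral>\<^sup>+x. ennreal (G (\<bar>f x\<bar> / e)) \<partial>M) \<le> 1" by simp
  qed
  then show ?thesis by (metis ennreal_le_epsilon add_0 le_zero_eq)
qed

lemma modular_finite:
  fixes f :: "'a::euclidean_space \<Rightarrow> 'b::real_normed_vector"
  assumes G: "N_function g G" and \<Omega>: "open \<Omega>" "bounded \<Omega>"
    and L: "AE x in lebesgue_on \<Omega>. norm (f x) \<le> L"
  shows "(\<integral>\<^sup>+x. ennreal (G (norm (f x))) \<partial>lebesgue_on \<Omega>) < \<infinity>"
proof -
  have "(\<integral>\<^sup>+x. ennreal (G (norm (f x))) \<partial>lebesgue_on \<Omega>) \<le> (\<integral>\<^sup>+x. ennreal (G L) \<partial>lebesgue_on \<Omega>)"
    by (rule nn_integral_mono_AE)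
      (use L in eventually_elim, auto intro!: ennreal_leI N_function_le[OF G])
  also have "\<dots> = ennreal (G L) * emeasure lborel \<Omega>"
    using \<Omega> by (simp add: emeasure_restrict_space)
  also have "\<dots> < \<infinity>"
    using emeasure_bounded_finite[OF \<Omega>(2)] by (simp add: ennreal_mult_less_top)
  finally show ?thesis .
qed

text \<open>\<phi> approximates itself, so the relevant norm is that of the zero function, whose
  chosen weak gradient vanishes only almost everywhere. The result makes test functions admissible
  in the weak formulation.\<close>

lemma test_function_orlicz_sobolev_0:
  fixes \<phi> :: "'a::euclidean_space \<Rightarrow> real"
  assumes G: "N_function g G" and \<Omega>: "open \<Omega>" "bounded \<Omega>" and \<phi>: "\<phi> \<in> test_functions \<Omega>"
  shows "\<phi> \<in> orlicz_sobolev_0 \<Omega> G"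
proof -
  define S where "S = closure {x. \<phi> x \<noteq> 0}"
  note S = test_functionsD(1-3)[OF \<phi>, folded S_def] and C = test_functionsD(4)[OF \<phi>]
  have c: "continuous_on UNIV \<phi>" "continuous_on UNIV (grad \<phi>)"
    using C_k_continuous[OF C[of 0]] grad_continuous[OF C[of 1]] by auto
  obtain L where L: "\<And>x. norm (\<phi> x) \<le> L" using compact_support_bounded[OF c(1) S(1,3)] by blast
  have "grad \<phi> x = 0" if "x \<notin> S" for x
    using frechet_derivative_outside[OF compact_imp_closed[OF S(1)] S(3) that] by (simp add: grad_def)
  then obtain L' where L': "\<And>x. norm (grad \<phi> x) \<le> L'" using compact_support_bounded[OF c(2) S(1)] by blast
  note wg = weak_gradient_test[OF \<Omega>(1) \<phi>]
  have "(\<integral>\<^sup>+x. ennreal (G \<bar>\<phi> x\<bar>) \<partial>lebesgue_on \<Omega>) < \<infinity>"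
    using modular_finite[OF G \<Omega>, of \<phi> L] L by simp
  moreover have "(\<integral>\<^sup>+x. ennreal (G (norm (weak_gradient \<Omega> \<phi> x))) \<partial>lebesgue_on \<Omega>) < \<infinity>"
    by (rule modular_finite[OF G \<Omega>, of _ L'])
      (use wg(2) in eventually_elim, simp add: L')
  ultimately have 1: "\<phi> \<in> orlicz_sobolev \<Omega> G"
    using wg(1) continuous_measurable_lebesgue_on[OF c(1)]
    by (auto simp: orlicz_sobolev_def orlicz_space_def)
  have "AE x in lebesgue_on \<Omega>. norm (weak_gradient \<Omega> (\<lambda>x. 0) x) = 0"
    using weak_gradient_test(2)[OF \<Omega>(1) zero_test_function] by eventually_elim (simp add: grad_zero)
  then have "orlicz_sobolev_norm \<Omega> G (\<lambda>x. \<phi> x - \<phi> x) = 0"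
    by (simp add: orlicz_sobolev_norm_def luxemburg_norm_zero[OF G])
  then have "orlicz_sobolev_norm \<Omega> G (\<lambda>x. \<phi> x - \<phi> x) < ennreal e" if "e > 0" for e
    using that by simp
  then have "\<forall>e>0. \<exists>\<psi>\<in>test_functions \<Omega>. orlicz_sobolev_norm \<Omega> G (\<lambda>x. \<phi> x - \<psi> x) < ennreal e"
    using \<phi> by blast
  then show ?thesis unfolding orlicz_sobolev_0_def using 1 by simp
qed

section \<open>Weak derivatives on the unit interval\<close>

text \<open>Test functions on the line with the interval containing the support as explicit data.
  For 0 < a and b < 1 they stay away from both ends of (0,1), and the bounds can be followed through
  derivatives and primitives.\<close>

definition smooth_supp :: "real \<Rightarrow> real \<Rightarrow> (real \<Rightarrow> real) set" where
  "smooth_supp a b = {\<xi>. (\<forall>k. smooth_upto k UNIV \<xi>) \<and> (\<forall>t. t \<notin> {a..b} \<longrightarrow> \<xi> t = 0)}"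

lemma smooth_suppD:
  assumes "\<xi> \<in> smooth_supp a b"
  shows "smooth_upto k UNIV \<xi>" "t \<notin> {a..b} \<Longrightarrow> \<xi> t = 0" "continuous_on S \<xi>" "\<xi> \<in> borel_measurable borel"
    "(\<xi> has_real_derivative deriv \<xi> t) (at t)"
proof -
  show s: "smooth_upto k UNIV \<xi>" for k using assms by (simp only: smooth_supp_def mem_Collect_eq)
  show "t \<notin> {a..b} \<Longrightarrow> \<xi> t = 0" using assms unfolding smooth_supp_def by blast
  have c: "continuous_on UNIV \<xi>" by (rule smooth_upto_continuous[OF s[of 0]])
  then show "continuous_on S \<xi>" by (rule continuous_on_subset) simp
  show "\<xi> \<in> borel_measurable borel" by (rule borel_measurable_continuous_onI[OF c])
  show "(\<xi> has_real_derivative deriv \<xi> t) (at t)" by (rule smooth_upto_deriv[OF s[of "Suc 0"]]) simp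
qed

lemma smooth_supp_deriv:
  assumes "\<xi> \<in> smooth_supp a b"
  shows "deriv \<xi> \<in> smooth_supp a b"
proof -
  have "smooth_upto k UNIV (deriv \<xi>)" for k using smooth_suppD(1)[OF assms, of "Suc k"] by simp
  moreover have "deriv \<xi> t = 0" if "t \<notin> {a..b}" for t
  proof -
    have "((\<lambda>_. 0) has_real_derivative 0) (at t)" by simp
    then have "(\<xi> has_real_derivative 0) (at t)"
      by (rule has_field_derivative_transform_within_open[where S="- {a..b}"])
        (use that smooth_suppD(2)[OF assms] in \<open>auto simp: open_Compl\<close>)
    then show ?thesis by (rule DERIV_imp_deriv)
  qed
  ultimately show ?thesis by (simp only: smooth_supp_def mem_Collect_eq) blast
qed

lemma smooth_supp_integrable:
  assumes "\<xi> \<in> smooth_supp a b"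
  shows "integrable lborel \<xi>"
  by (rule integrable_compact_support[OF smooth_suppD(3)[OF assms] compact_Icc smooth_suppD(2)[OF assms]])

lemma smooth_supp_mono:
  assumes "\<xi> \<in> smooth_supp a b" "a' \<le> a" "b \<le> b'"
  shows "\<xi> \<in> smooth_supp a' b'"
proof -
  have "\<xi> t = 0" if "t \<notin> {a'..b'}" for t
    using smooth_suppD(2)[OF assms(1), of t] that assms(2,3) by auto
  then show ?thesis
    using smooth_suppD(1)[OF assms(1)] by (simp only: smooth_supp_def mem_Collect_eq) blast
qed

lemma smooth_supp_linear:
  assumes "\<xi> \<in> smooth_supp a b" "\<eta> \<in> smooth_supp a b"
  shows "(\<lambda>t. \<xi> t + c * \<eta> t) \<in> smooth_supp a b"
proof -
  have "smooth_upto k UNIV (\<lambda>t. \<xi> t + c * \<eta> t)" for k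
    by (rule smooth_upto_add[OF open_UNIV smooth_suppD(1)[OF assms(1)]
          smooth_upto_mult[OF open_UNIV smooth_upto_const[OF open_UNIV] smooth_suppD(1)[OF assms(2)]]])
  moreover have "\<xi> t + c * \<eta> t = 0" if "t \<notin> {a..b}" for t
    using smooth_suppD(2)[OF assms(1) that] smooth_suppD(2)[OF assms(2) that] by simp
  ultimately show ?thesis by (simp only: smooth_supp_def mem_Collect_eq) blast
qed

lemma smooth_supp_positive:
  "\<exists>\<xi>\<in>smooth_supp a b. (\<forall>t. 0 \<le> \<xi> t) \<and> (\<forall>t\<in>{a<..<b}. 0 < \<xi> t)"
proof (cases "a < b")
  case True
  define \<xi> where "\<xi> t = exp_cutoff 0 ((t + (- a)) * (b + (-1) * t))" for t :: real
  have s: "smooth_upto k UNIV \<xi>" for k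
    unfolding \<xi>_def[abs_def]
    by (rule smooth_upto_compose[OF open_UNIV open_UNIV _ smooth_upto_exp_cutoff])
      (simp, intro smooth_upto_mult smooth_upto_add smooth_upto_const smooth_upto_ident open_UNIV)
  have z: "\<xi> t = 0" if "t \<notin> {a..b}" for t
    unfolding \<xi>_def
  proof (rule exp_cutoff_nonpos)
    show "(t + (- a)) * (b + (-1) * t) \<le> 0"
    proof (cases "t < a")
      case True
      then show ?thesis using \<open>a < b\<close> by (intro mult_nonpos_nonneg) auto
    next
      case False
      then show ?thesis using that by (intro mult_nonneg_nonpos) auto
    qed
  qed
  have \<xi>: "\<xi> \<in> smooth_supp a b" using s z by (simp only: smooth_supp_def mem_Collect_eq) blast
  have "0 \<le> \<xi> t" for t unfolding \<xi>_def by (rule exp_cutoff_0_bounds)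
  moreover have "0 < \<xi> t" if "t \<in> {a<..<b}" for t
  proof -
    have "(t + (- a)) * (b + (-1) * t) > 0" using that by (intro mult_pos_pos) auto
    then show ?thesis by (simp add: \<xi>_def exp_cutoff_def)
  qed
  ultimately show ?thesis using \<xi> by blast
next
  case False
  have "smooth_upto k UNIV (\<lambda>t. 0)" for k by (rule smooth_upto_const) simp
  then have "(\<lambda>t. 0) \<in> smooth_supp a b" by (simp only: smooth_supp_def mem_Collect_eq) blast
  then show ?thesis using False by (intro bexI[of _ "\<lambda>t. 0"]) auto
qed

lemma smooth_supp_bump:
  assumes "a < b"
  shows "\<exists>\<xi>\<in>smooth_supp a b. (LINT t|lborel. \<xi> t) = 1"
proof -
  obtain \<xi> where \<xi>: "\<xi> \<in> smooth_supp a b" and nonneg: "\<And>t. 0 \<le> \<xi> t" and pos: "\<And>t. t \<in> {a<..<b} \<Longrightarrow> 0 < \<xi> t"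
    using smooth_supp_positive[of a b] by blast
  have "(LINT t|lborel. \<xi> t) \<noteq> 0"
  proof
    assume "(LINT t|lborel. \<xi> t) = 0"
    then have "AE t in lborel. \<xi> t = 0"
      using integral_nonneg_eq_0_iff_AE[OF smooth_supp_integrable[OF \<xi>]] nonneg by simp
    then have "AE t in lborel. t \<notin> {a<..<b}"
      by (rule eventually_mono) (use pos less_irrefl in metis)
    then have "{a<..<b} \<in> null_sets lborel"
      by (rule AE_iff_null_sets[THEN iffD2, rotated]) simp
    from null_setsD1[OF this] show False using assms by simp
  qed
  then have "(LINT t|lborel. \<xi> t) > 0"
    using Bochner_Integration.integral_nonneg[of lborel \<xi>] nonneg by (simp add: less_le)
  define c where "c = 1 / (LINT t|lborel. \<xi> t)"
  \<comment> \<open>Multiplication by c is written as addition of (c - 1) \<xi>, the form covered by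
    \<open>smooth_supp_linear\<close>.\<close>
  have "(\<lambda>t. \<xi> t + (c - 1) * \<xi> t) \<in> smooth_supp a b" by (rule smooth_supp_linear[OF \<xi> \<xi>])
  moreover have "(LINT t|lborel. \<xi> t + (c - 1) * \<xi> t) = 1"
  proof -
    have "(\<lambda>t. \<xi> t + (c - 1) * \<xi> t) = (\<lambda>t. c * \<xi> t)" by (simp add: algebra_simps)
    then show ?thesis using \<open>(LINT t|lborel. \<xi> t) > 0\<close> by (simp add: c_def)
  qed
  ultimately show ?thesis by blast
qed

lemma compact_subset_unit_interval:
  assumes "compact K" "K \<subseteq> {0<..<1::real}"
  shows "\<exists>a b. 0 < a \<and> a < b \<and> b < 1 \<and> K \<subseteq> {a..b}"
proof (cases "K = {}")
  case True
  then show ?thesis by (intro exI[of _ "1/4"] exI[of _ "1/2"]) auto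
next
  case False
  obtain p q where p: "p \<in> K" "\<forall>x\<in>K. p \<le> x" and q: "q \<in> K" "\<forall>x\<in>K. x \<le> q"
    using compact_attains_inf[OF assms(1) False] compact_attains_sup[OF assms(1) False] by blast
  have pq: "0 < p" "p \<le> q" "q < 1" using p q assms(2) by auto
  \<comment> \<open>Moving halfway towards 0 and 1 gives a proper interval even if K is a single
    point.\<close>
  have "K \<subseteq> {p/2..(1+q)/2}"
  proof
    fix x assume "x \<in> K"
    then have "p \<le> x" "x \<le> q" using p(2) q(2) by blast+
    then show "x \<in> {p/2..(1+q)/2}" using pq by simp
  qed
  then show ?thesis using pq by (intro exI[of _ "p/2"] exI[of _ "(1+q)/2"]) simp
qed

lemma set_integrable_mult_smooth_supp:
  assumes k: "set_integrable lborel {a..b} k" and \<xi>: "\<xi> \<in> smooth_supp a b"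
  shows "integrable lborel (\<lambda>s. k s * \<xi> s)"
proof -
  obtain L where L: "\<And>x. norm (\<xi> x) \<le> L"
    using compact_support_bounded[OF smooth_suppD(3)[OF \<xi>] compact_Icc smooth_suppD(2)[OF \<xi>]] by blast
  have i: "integrable lborel (\<lambda>s. indicator {a..b} s *\<^sub>R k s)" using k by (simp add: set_integrable_def)
  have "integrable lborel (\<lambda>s. indicator {a..b} s *\<^sub>R k s * \<xi> s)"
  proof (rule Bochner_Integration.integrable_bound[OF integrable_mult_right[OF integrable_norm[OF i], of L]])
    show "(\<lambda>s. indicator {a..b} s *\<^sub>R k s * \<xi> s) \<in> borel_measurable lborel"
      by (rule borel_measurable_times[OF borel_measurable_integrable[OF i]]) (simp add: smooth_suppD(4)[OF \<xi>])
    show "AE s in lborel. norm (indicator {a..b} s *\<^sub>R k s * \<xi> s) \<le> norm (L * norm (indicator {a..b} s *\<^sub>R k s))"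
    proof (rule AE_I2)
      fix x
      have "norm (indicator {a..b} x *\<^sub>R k x * \<xi> x) \<le> norm (indicator {a..b} x *\<^sub>R k x) * L"
        unfolding norm_mult by (intro mult_left_mono L norm_ge_zero)
      then show "norm (indicator {a..b} x *\<^sub>R k x * \<xi> x) \<le> norm (L * norm (indicator {a..b} x *\<^sub>R k x))"
        by (simp add: mult.commute)
    qed
  qed
  also have "(\<lambda>s. indicator {a..b} s *\<^sub>R k s * \<xi> s) = (\<lambda>s. k s * \<xi> s)"
  proof
    fix s show "indicator {a..b} s *\<^sub>R k s * \<xi> s = k s * \<xi> s"
      using smooth_suppD(2)[OF \<xi>, of s] by (cases "s \<in> {a..b}") auto
  qed
  finally show ?thesis .
qed

lemma fundamental_lemma_unit_interval:
  fixes k :: "real \<Rightarrow> real"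
  assumes k: "\<And>a b. 0 < a \<Longrightarrow> a < b \<Longrightarrow> b < 1 \<Longrightarrow> set_integrable lborel {a..b} k"
    and z: "\<And>a b \<xi>. 0 < a \<Longrightarrow> a < b \<Longrightarrow> b < 1 \<Longrightarrow> \<xi> \<in> smooth_supp a b \<Longrightarrow> (LINT s|lborel. k s * \<xi> s) = 0"
  shows "AE s in lborel. s \<in> {0<..<1} \<longrightarrow> k s = 0"
proof -
  have "AE s in lebesgue_on {0<..<1}. k s = 0"
  proof (rule fundamental_lemma)
    show "locally_integrable {0<..<1} k"
      unfolding locally_integrable_def
    proof (intro allI impI)
      fix K :: "real set" assume "compact K \<and> K \<subseteq> {0<..<1}"
      then have K: "compact K" "K \<subseteq> {0<..<1}" by auto
      then obtain a b where ab: "0 < a" "a < b" "b < 1" "K \<subseteq> {a..b}"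
        using compact_subset_unit_interval by blast
      have "set_integrable lborel K k"
        using set_integrable_subset[OF k[OF ab(1-3)] _ ab(4)] K by (simp add: compact_imp_closed)
      then have i: "integrable lborel (\<lambda>x. indicator K x *\<^sub>R k x)" by (simp add: set_integrable_def)
      then have "integrable lebesgue (\<lambda>x. indicator K x *\<^sub>R k x)"
        by (subst integrable_completion[OF borel_measurable_integrable[OF i]])
      then show "integrable (lebesgue_on K) k"
        using K integral_lebesgue_on(2)[of K k] by (simp add: compact_imp_closed)
    qed
    fix \<phi> :: "real \<Rightarrow> real" assume \<phi>: "\<phi> \<in> test_functions {0<..<1}"
    define S where "S = closure {x. \<phi> x \<noteq> 0}"
    note S = test_functionsD(1-3)[OF \<phi>, folded S_def] and C = test_functionsD(4)[OF \<phi>]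
    obtain a b where ab: "0 < a" "a < b" "b < 1" "S \<subseteq> {a..b}"
      using compact_subset_unit_interval[OF S(1,2)] by blast
    have "\<phi> t = 0" if "t \<notin> {a..b}" for t using S(3) ab(4) that by blast
    then have \<phi>': "\<phi> \<in> smooth_supp a b"
      using C_k_imp_smooth_upto[OF C] by (simp only: smooth_supp_def mem_Collect_eq) blast
    have i: "integrable lborel (\<lambda>s. k s * \<phi> s)" by (rule set_integrable_mult_smooth_supp[OF k[OF ab(1-3)] \<phi>'])
    have "(LINT x|lebesgue_on {0<..<1}. k x * \<phi> x) = (LINT x|lborel. k x * \<phi> x)"
    proof (rule integral_lebesgue_on_lborel)
      show "(\<lambda>x. k x * \<phi> x) \<in> borel_measurable borel" using borel_measurable_integrable[OF i] by simp
      fix x :: real assume "x \<notin> {0<..<1}"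
      then have "x \<notin> {a..b}" using ab by auto
      then show "k x * \<phi> x = 0" using smooth_suppD(2)[OF \<phi>'] by simp
    qed simp
    also have "\<dots> = 0" by (rule z[OF ab(1-3) \<phi>'])
    finally show "(LINT x|lebesgue_on {0<..<1}. k x * \<phi> x) = 0" .
  qed simp
  then have "AE s in lebesgue. s \<in> {0<..<1} \<longrightarrow> k s = 0"
    by (subst (asm) AE_restrict_space_iff) auto
  then show ?thesis by (simp only: AE_completion_iff)
qed

section \<open>Primitives of test functions\<close>

text \<open>The primitive of -\<xi> that vanishes to the right of the support. To the left it is
  constant, so composing it with the norm gives a function smooth at the origin. As a Lebesgue
  integral over a half line it also makes sense for merely integrable functions.\<close>

definition tail :: "(real \<Rightarrow> real) \<Rightarrow> real \<Rightarrow> real" where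
  "tail \<xi> t = (LINT s|lborel. indicator {t..} s * \<xi> s)"

lemma tail_eq_integral:
  assumes \<xi>: "\<xi> \<in> smooth_supp a b" and c: "b \<le> c"
  shows "tail \<xi> t = integral {t..c} \<xi>"
proof -
  have "(\<lambda>s. indicator {t..} s * \<xi> s) = (\<lambda>s. indicator {t..c} s *\<^sub>R \<xi> s)"
  proof
    fix s show "indicator {t..} s * \<xi> s = indicator {t..c} s *\<^sub>R \<xi> s"
      using smooth_suppD(2)[OF \<xi>, of s] c by (cases "s \<le> c") (auto simp: indicator_def)
  qed
  then have "tail \<xi> t = (LINT s:{t..c}|lborel. \<xi> s)"
    by (simp add: tail_def set_lebesgue_integral_def)
  also have "\<dots> = integral {t..c} \<xi>"
    by (rule set_borel_integral_eq_integral(2)) (rule borel_integrable_atLeastAtMost'[OF smooth_suppD(3)[OF \<xi>]])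
  finally show ?thesis .
qed

lemma tail_deriv:
  assumes \<xi>: "\<xi> \<in> smooth_supp a b"
  shows "(tail \<xi> has_real_derivative - \<xi> t) (at t)"
proof -
  define c where "c = max b (t + 1)"
  have "((\<lambda>x. integral {x..c} \<xi>) has_real_derivative - \<xi> t) (at t within {t - 1..c})"
    by (rule integral_has_real_derivative'[OF smooth_suppD(3)[OF \<xi>]]) (auto simp: c_def)
  moreover have "(\<lambda>x. integral {x..c} \<xi>) = tail \<xi>"
    using tail_eq_integral[OF \<xi>, of c] by (auto simp: c_def)
  moreover have "at t within {t - 1..c} = at t"
    by (rule at_within_interior) (auto simp: c_def)
  ultimately show ?thesis by simp
qed

lemma tail_smooth: "\<xi> \<in> smooth_supp a b \<Longrightarrow> smooth_upto k UNIV (tail \<xi>)"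
proof (rule smooth_upto_antideriv[OF open_UNIV tail_deriv])
  fix k assume \<xi>: "\<xi> \<in> smooth_supp a b"
  have "smooth_upto k UNIV (\<lambda>t. (-1) * \<xi> t)"
    by (rule smooth_upto_mult[OF open_UNIV smooth_upto_const[OF open_UNIV] smooth_suppD(1)[OF \<xi>]])
  then show "smooth_upto k UNIV (\<lambda>t. - \<xi> t)" by simp
qed

lemma tail_ge: "\<xi> \<in> smooth_supp a b \<Longrightarrow> b < t \<Longrightarrow> tail \<xi> t = 0"
  using tail_eq_integral[of \<xi> a b b t] by simp

lemma tail_le:
  assumes \<xi>: "\<xi> \<in> smooth_supp a b" and "t < a"
  shows "tail \<xi> t = (LINT s|lborel. \<xi> s)"
proof -
  have "(\<lambda>s. indicator {t..} s * \<xi> s) = \<xi>"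
  proof
    fix s show "indicator {t..} s * \<xi> s = \<xi> s"
      using smooth_suppD(2)[OF \<xi>, of s] assms(2) by (cases "t \<le> s") auto
  qed
  then show ?thesis by (simp add: tail_def)
qed

text \<open>Mean value zero is exactly what makes the constant value to the left of the support
  vanish.\<close>

lemma tail_smooth_supp:
  assumes \<xi>: "\<xi> \<in> smooth_supp a b" and 0: "(LINT s|lborel. \<xi> s) = 0"
  shows "tail \<xi> \<in> smooth_supp a b"
proof -
  have "tail \<xi> t = 0" if "t \<notin> {a..b}" for t
    using that tail_ge[OF \<xi>, of t] tail_le[OF \<xi>, of t] 0 by (cases "t < a") auto
  then show ?thesis using tail_smooth[OF \<xi>] by (simp only: smooth_supp_def mem_Collect_eq) blast
qed

lemma tail_of_deriv:
  assumes \<xi>: "\<xi> \<in> smooth_supp a b"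
  shows "tail (deriv \<xi>) t = - \<xi> t"
proof -
  define c where "c = max (b + 1) t"
  have "tail (deriv \<xi>) t = integral {t..c} (deriv \<xi>)"
    by (rule tail_eq_integral[OF smooth_supp_deriv[OF \<xi>]]) (simp add: c_def)
  also have "(deriv \<xi> has_integral (\<xi> c - \<xi> t)) {t..c}"
    by (rule fundamental_theorem_of_calculus)
      (auto simp: c_def has_real_derivative_iff_has_vector_derivative[symmetric]
        intro!: has_field_derivative_at_within smooth_suppD(5)[OF \<xi>])
  then have "integral {t..c} (deriv \<xi>) = \<xi> c - \<xi> t" by (rule integral_unique)
  also have "\<xi> c = 0" by (rule smooth_suppD(2)[OF \<xi>]) (simp add: c_def)
  finally show ?thesis by simp
qed

text \<open>Fubini on the half plane s \<le> t: integration to the right and integration to the left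
  are adjoint. This serves as integration by parts for functions that are only integrable.\<close>

lemma Fubini_tail:
  fixes f \<xi> :: "real \<Rightarrow> real"
  assumes f: "integrable lborel f" and \<xi>: "integrable lborel \<xi>"
  shows "(LINT s|lborel. f s * tail \<xi> s) = (LINT t|lborel. \<xi> t * (LINT s|lborel. indicator {..t} s * f s))"
    "integrable lborel (\<lambda>t. \<xi> t * (LINT s|lborel. indicator {..t} s * f s))"
proof -
  have [measurable]: "f \<in> borel_measurable borel" "\<xi> \<in> borel_measurable borel" using f \<xi> by auto
  define F where "F s t = (if s \<le> t then f s * \<xi> t else 0)" for s t
  have m[measurable]: "case_prod F \<in> borel_measurable (lborel \<Otimes>\<^sub>M lborel)"
    unfolding F_def by measurable
  have "integrable (lborel \<Otimes>\<^sub>M lborel) (\<lambda>(s, t). f s * \<xi> t)"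
  proof (rule lborel_pair.Fubini_integrable)
    have "(\<lambda>s. LINT t|lborel. norm (case (s, t) of (s, t) \<Rightarrow> f s * \<xi> t)) = (\<lambda>s. norm (f s) * (LINT t|lborel. norm (\<xi> t)))"
      by (simp add: abs_mult)
    then show "integrable lborel (\<lambda>s. LINT t|lborel. norm (case (s, t) of (s, t) \<Rightarrow> f s * \<xi> t))"
      using f by simp
  qed (use \<xi> in auto)
  then have i: "integrable (lborel \<Otimes>\<^sub>M lborel) (case_prod F)"
    by (rule Bochner_Integration.integrable_bound) (auto simp: F_def)
  have 1: "(LINT t|lborel. F s t) = f s * tail \<xi> s" for s
  proof -
    have "(\<lambda>t. F s t) = (\<lambda>t. f s * (indicator {s..} t * \<xi> t))" by (auto simp: F_def indicator_def)
    then show ?thesis by (simp add: tail_def)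
  qed
  have 2: "(LINT s|lborel. F s t) = \<xi> t * (LINT s|lborel. indicator {..t} s * f s)" for t
  proof -
    have "(\<lambda>s. F s t) = (\<lambda>s. \<xi> t * (indicator {..t} s * f s))" by (auto simp: F_def indicator_def)
    then show ?thesis by simp
  qed
  show "(LINT s|lborel. f s * tail \<xi> s) = (LINT t|lborel. \<xi> t * (LINT s|lborel. indicator {..t} s * f s))"
    using lborel_pair.Fubini_integral[OF i] unfolding 1 2 by (rule sym)
  show "integrable lborel (\<lambda>t. \<xi> t * (LINT s|lborel. indicator {..t} s * f s))"
    using lborel_pair.integrable_snd[OF i] unfolding 2 .
qed

text \<open>The du Bois-Reymond argument. A primitive of d has weak derivative d, so its difference
  with a has weak derivative 0; since test functions of mean zero are derivatives of test functions,
  that difference is constant.\<close>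

lemma weak_derivative_unit_interval:
  fixes a d :: "real \<Rightarrow> real"
  assumes a: "\<And>x y. 0 < x \<Longrightarrow> x < y \<Longrightarrow> y < 1 \<Longrightarrow> set_integrable lborel {x..y} a"
    and d: "\<And>x y. 0 < x \<Longrightarrow> x < y \<Longrightarrow> y < 1 \<Longrightarrow> set_integrable lborel {x..y} d"
    and eq: "\<And>x y \<zeta>. 0 < x \<Longrightarrow> x < y \<Longrightarrow> y < 1 \<Longrightarrow> \<zeta> \<in> smooth_supp x y \<Longrightarrow>
      (LINT s|lborel. a s * deriv \<zeta> s) = - (LINT s|lborel. d s * \<zeta> s)"
  shows "\<exists>W. (\<forall>x y. 0 < x \<longrightarrow> x \<le> y \<longrightarrow> y < 1 \<longrightarrow> W y - W x = (LINT s:{x..y}|lborel. d s)) \<and>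
    (AE s in lborel. s \<in> {0<..<1} \<longrightarrow> a s = W s)"
proof -
  \<comment> \<open>The oriented integral from 1/2 allows arguments on both sides of the base point,
    and additivity gives all increments at once.\<close>
  define W where "W t = (LBINT s=ereal (1/2)..ereal t. d s)" for t :: real
  have W: "W y - W x = (LINT s:{x..y}|lborel. d s)" if xy: "0 < x" "x \<le> y" "y < 1" for x y
  proof -
    let ?l = "min x (1/2) / 2" and ?u = "(1 + max y (1/2)) / 2"
    have "set_integrable lborel {?l..?u} d"
      using xy by (intro d) (auto simp: min_def max_def)
    then have si: "set_integrable lborel {min (1/2) (min x y)<..<max (1/2) (max x y)} d"
      by (rule set_integrable_subset) (use xy in \<open>auto simp: min_def max_def split: if_splits\<close>)
    have mm: "min (ereal (1/2)) (min (ereal x) (ereal y)) = ereal (min (1/2) (min x y))"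
      "max (ereal (1/2)) (max (ereal x) (ereal y)) = ereal (max (1/2) (max x y))"
      by (simp_all add: min_def max_def)
    have le: "min (1/2) (min x y) \<le> max (1/2) (max x y)" by simp
    have "interval_lebesgue_integrable lborel (min (ereal (1/2)) (min (ereal x) (ereal y))) (max (ereal (1/2)) (max (ereal x) (ereal y))) d"
      unfolding mm interval_lebesgue_integrable_def einterval_eq ereal_less_eq(3) if_P[OF le] by (rule si)
    from interval_integral_sum[OF this] interval_integral_Icc[OF xy(2), of d]
    show ?thesis by (simp add: W_def)
  qed
  have Wc: "continuous_on {x..y} W" if xy: "0 < x" "x < y" "y < 1" for x y
  proof -
    have si: "set_integrable lborel {x..t} d" if "t \<le> y" for t
      using that xy by (intro set_integrable_subset[OF d[OF xy]]) auto
    have "continuous_on {x..y} (\<lambda>t. W x + integral {x..t} d)"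
      using set_borel_integral_eq_integral(1)[OF si[of y]]
      by (intro continuous_intros indefinite_integral_continuous_1) auto
    then show ?thesis
    proof (rule continuous_on_eq)
      fix t assume t: "t \<in> {x..y}"
      then show "W x + integral {x..t} d = W t"
        using W[of x t] xy set_borel_integral_eq_integral(2)[OF si[of t]] by simp
    qed
  qed
  have Wi: "set_integrable lborel {x..y} W" if "0 < x" "x < y" "y < 1" for x y
    by (rule borel_integrable_atLeastAtMost'[OF Wc[OF that]])
  have Weq: "(LINT s|lborel. W s * deriv \<zeta> s) = - (LINT s|lborel. d s * \<zeta> s)"
    if xy: "0 < x" "x < y" "y < 1" and \<zeta>: "\<zeta> \<in> smooth_supp x y" for x y \<zeta>
  proof -
    note \<zeta>' = smooth_supp_deriv[OF \<zeta>]
    define d1 where "d1 s = indicator {x..y} s * d s" for s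
    have d1: "integrable lborel d1" using d[OF xy] by (simp add: d1_def[abs_def] set_integrable_def)
    have z: "(LINT s|lborel. deriv \<zeta> s) = 0"
      using tail_of_deriv[OF \<zeta>, of "x - 1"] tail_le[OF \<zeta>', of "x - 1"] smooth_suppD(2)[OF \<zeta>, of "x - 1"] by simp
    \<comment> \<open>On the support W is its value at x plus the integral of d from x. The constant
      part drops out because \<open>deriv \<zeta>\<close> has mean zero, and
      \<open>Fubini_tail\<close> handles the rest.\<close>
    have p: "W t * deriv \<zeta> t = W x * deriv \<zeta> t + deriv \<zeta> t * (LINT s|lborel. indicator {..t} s * d1 s)" for t
    proof (cases "t \<in> {x..y}")
      case True
      have "(\<lambda>s. indicator {..t} s * d1 s) = (\<lambda>s. indicator {x..t} s *\<^sub>R d s)"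
        using True by (auto simp: d1_def indicator_def)
      then have E: "(LINT s|lborel. indicator {..t} s * d1 s) = W t - W x"
        using W[of x t] True xy by (simp add: set_lebesgue_integral_def)
      show ?thesis unfolding E by (simp add: algebra_simps)
    qed (simp add: smooth_suppD(2)[OF \<zeta>'])
    have "(LINT t|lborel. W t * deriv \<zeta> t) = (LINT t|lborel. W x * deriv \<zeta> t)
        + (LINT t|lborel. deriv \<zeta> t * (LINT s|lborel. indicator {..t} s * d1 s))"
      unfolding p
      by (rule Bochner_Integration.integral_add[OF integrable_mult_right[OF smooth_supp_integrable[OF \<zeta>']]
            Fubini_tail(2)[OF d1 smooth_supp_integrable[OF \<zeta>']]])
    also have "\<dots> = (LINT s|lborel. d1 s * tail (deriv \<zeta>) s)"
      using Fubini_tail(1)[OF d1 smooth_supp_integrable[OF \<zeta>']] z by simp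
    also have "\<dots> = (LINT s|lborel. - (d s * \<zeta> s))"
    proof (rule Bochner_Integration.integral_cong[OF refl])
      fix s show "d1 s * tail (deriv \<zeta>) s = - (d s * \<zeta> s)"
        using smooth_suppD(2)[OF \<zeta>, of s] tail_of_deriv[OF \<zeta>, of s] by (cases "s \<in> {x..y}") (auto simp: d1_def)
    qed
    finally show ?thesis by simp
  qed
  obtain \<xi>0 where \<xi>0: "\<xi>0 \<in> smooth_supp (1/4) (3/4)" "(LINT t|lborel. \<xi>0 t) = 1" using smooth_supp_bump[of "1/4" "3/4"] by auto
  define c where "c s = a s - W s" for s
  have ci: "set_integrable lborel {x..y} c" if "0 < x" "x < y" "y < 1" for x y
    unfolding c_def[abs_def] by (rule set_integral_diff(1)[OF a[OF that] Wi[OF that]])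
  \<comment> \<open>The candidate for the constant: the average of a - W against a fixed bump of
    mass 1.\<close>
  define C where "C = (LINT s|lborel. c s * \<xi>0 s)"
  have "AE s in lborel. s \<in> {0<..<1} \<longrightarrow> c s - C = 0"
  proof (rule fundamental_lemma_unit_interval)
    fix x y :: real assume "0 < x" "x < y" "y < 1"
    then show "set_integrable lborel {x..y} (\<lambda>s. c s - C)"
      by (intro set_integral_diff(1) ci borel_integrable_atLeastAtMost' continuous_on_const)
  next
    fix x y :: real and \<xi> assume xy: "0 < x" "x < y" "y < 1" and \<xi>: "\<xi> \<in> smooth_supp x y"
    \<comment> \<open>The interval is enlarged to contain the supports of both \<xi> and the fixed
      bump.\<close>
    define x' y' where "x' = min x (1/4)" and "y' = max y (3/4)"
    have xy': "0 < x'" "x' < y'" "y' < 1" using xy by (auto simp: x'_def y'_def)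
    have \<xi>': "\<xi> \<in> smooth_supp x' y'" by (rule smooth_supp_mono[OF \<xi>]) (auto simp: x'_def y'_def)
    have \<xi>0': "\<xi>0 \<in> smooth_supp x' y'" by (rule smooth_supp_mono[OF \<xi>0(1)]) (auto simp: x'_def y'_def)
    define I where "I = (LINT s|lborel. \<xi> s)"
    \<comment> \<open>Subtracting the mass of \<xi> times the bump produces mean zero, so that
      \<open>tail \<eta>\<close> is an admissible test function with derivative -\<eta>.\<close>
    define \<eta> where "\<eta> t = \<xi> t + (- I) * \<xi>0 t" for t
    have \<eta>: "\<eta> \<in> smooth_supp x' y'" unfolding \<eta>_def[abs_def] by (rule smooth_supp_linear[OF \<xi>' \<xi>0'])
    have "(LINT s|lborel. \<eta> s) = I + (- I) * 1"
      unfolding \<eta>_def using smooth_supp_integrable[OF \<xi>] smooth_supp_integrable[OF \<xi>0(1)] \<xi>0(2) by (simp add: I_def)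
    then have \<eta>0: "(LINT s|lborel. \<eta> s) = 0" by simp
    have \<zeta>: "tail \<eta> \<in> smooth_supp x' y'" by (rule tail_smooth_supp[OF \<eta> \<eta>0])
    have d\<zeta>: "deriv (tail \<eta>) s = - \<eta> s" for s by (rule DERIV_imp_deriv[OF tail_deriv[OF \<eta>]])
    have "(LINT s|lborel. c s * deriv (tail \<eta>) s) = (LINT s|lborel. a s * deriv (tail \<eta>) s - W s * deriv (tail \<eta>) s)"
      by (simp add: c_def left_diff_distrib)
    also have "\<dots> = (LINT s|lborel. a s * deriv (tail \<eta>) s) - (LINT s|lborel. W s * deriv (tail \<eta>) s)"
      by (intro Bochner_Integration.integral_diff set_integrable_mult_smooth_supp[OF a[OF xy']]
          set_integrable_mult_smooth_supp[OF Wi[OF xy']] smooth_supp_deriv \<zeta>)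
    also have "\<dots> = 0" using eq[OF xy' \<zeta>] Weq[OF xy' \<zeta>] by simp
    finally have "(LINT s|lborel. c s * \<eta> s) = 0" unfolding d\<zeta> by simp
    moreover have "(\<lambda>s. (c s - C) * \<xi> s) = (\<lambda>s. c s * \<eta> s + (I * (c s * \<xi>0 s) - C * \<xi> s))"
      by (auto simp: \<eta>_def algebra_simps)
    moreover have "(LINT s|lborel. c s * \<eta> s + (I * (c s * \<xi>0 s) - C * \<xi> s))
        = (LINT s|lborel. c s * \<eta> s) + (I * (LINT s|lborel. c s * \<xi>0 s) - C * (LINT s|lborel. \<xi> s))"
      using set_integrable_mult_smooth_supp[OF ci[OF xy'] \<eta>] set_integrable_mult_smooth_supp[OF ci[OF xy'] \<xi>0']
        smooth_supp_integrable[OF \<xi>] by simp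
    ultimately show "(LINT s|lborel. (c s - C) * \<xi> s) = 0" by (simp add: C_def I_def)
  qed
  then have "AE s in lborel. s \<in> {0<..<1} \<longrightarrow> a s = W s + C"
    by (rule eventually_mono) (auto simp: c_def)
  moreover have "(W y + C) - (W x + C) = (LINT s:{x..y}|lborel. d s)" if "0 < x" "x \<le> y" "y < 1" for x y
    using W[OF that] by simp
  ultimately show ?thesis by (intro exI[of _ "\<lambda>s. W s + C"]) blast
qed

section \<open>Polar coordinates for radial functions\<close>

text \<open>The area of the sphere of radius s, as the derivative of the volume of the ball.\<close>

definition polar_density :: "nat \<Rightarrow> real \<Rightarrow> real" where
  "polar_density n s = indicator {0<..} s * (unit_ball_vol (real n) * (real n * s ^ (n - 1)))"

lemma polar_density_measurable[measurable]: "polar_density n \<in> borel_measurable borel"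
  unfolding polar_density_def[abs_def] by measurable

lemma polar_density_nonneg: "0 \<le> polar_density n s"
  by (simp add: polar_density_def indicator_def)

lemma polar_density_pos: "n > 0 \<Longrightarrow> 0 < s \<Longrightarrow> 0 < polar_density n s"
  by (simp add: polar_density_def)

lemma polar_density_eq_powr:
  "n > 0 \<Longrightarrow> 0 < s \<Longrightarrow> polar_density n s = unit_ball_vol (real n) * real n * s powr (real n - 1)"
  by (simp add: polar_density_def powr_realpow[symmetric] of_nat_diff)

lemma nn_integral_polar_density:
  assumes "n > 0" "a \<ge> 0"
  shows "(\<integral>\<^sup>+s. ennreal (polar_density n s) * indicator {..a} s \<partial>lborel) = ennreal (unit_ball_vol (real n) * a ^ n)"
proof -
  have "(\<integral>\<^sup>+s. ennreal (polar_density n s) * indicator {..a} s \<partial>lborel)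
      = (\<integral>\<^sup>+s. ennreal (unit_ball_vol (real n) * (real n * s ^ (n - 1))) * indicator {0..a} s \<partial>lborel)"
    by (rule nn_integral_cong_AE)
      (use AE_lborel_singleton[of "0::real"] in eventually_elim, auto simp: polar_density_def indicator_def)
  also have "\<dots> = ennreal (unit_ball_vol (real n) * a ^ n - unit_ball_vol (real n) * 0 ^ n)"
  proof (rule nn_integral_FTC_Icc)
    fix s :: real assume s: "s \<in> {0..a}"
    show "((\<lambda>s. unit_ball_vol (real n) * s ^ n) has_real_derivative unit_ball_vol (real n) * (real n * s ^ (n - 1))) (at s)"
      using DERIV_cmult[OF DERIV_pow[of n s], of "unit_ball_vol (real n)"] by simp
    show "0 \<le> unit_ball_vol (real n) * (real n * s ^ (n - 1))"
      using s by simp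
  qed (use assms in auto)
  finally show ?thesis using assms by simp
qed

text \<open>On a half line both measures give the volume of a ball, and half lines form an
  intersection-stable generator.\<close>

lemma distr_norm:
  "distr lebesgue borel (norm :: 'a::euclidean_space \<Rightarrow> real) = density lborel (\<lambda>s. ennreal (polar_density DIM('a) s))"
proof (rule measure_eqI_generator_eq[where E="range (\<lambda>a. {..a})" and \<Omega>=UNIV and A="\<lambda>j. {..real j}"])
  have m: "norm \<in> lebesgue \<rightarrow>\<^sub>M (borel :: real measure)" by (intro measurable_completion) simp
  have e: "emeasure (distr lebesgue borel (norm :: 'a \<Rightarrow> real)) {..a} = (if a \<ge> 0 then ennreal (unit_ball_vol (real DIM('a)) * a ^ DIM('a)) else 0)" for a
  proof -
    have "emeasure (distr lebesgue borel (norm :: 'a \<Rightarrow> real)) {..a} = emeasure lebesgue (norm -` {..a} \<inter> space lebesgue :: 'a set)"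
      by (rule emeasure_distr[OF m]) simp
    also have "norm -` {..a} \<inter> space lebesgue = (cball 0 a :: 'a set)" by auto
    also have "emeasure lebesgue (cball 0 a :: 'a set) = emeasure lborel (cball 0 a :: 'a set)"
      by simp
    also have "\<dots> = (if a \<ge> 0 then ennreal (unit_ball_vol (real DIM('a)) * a ^ DIM('a)) else 0)"
      using emeasure_cball[of a "0::'a"] by (cases "a \<ge> 0") auto
    finally show ?thesis .
  qed
  show "Int_stable (range (\<lambda>a::real. {..a}))" by (auto simp: Int_stable_def)
  show "sets (distr lebesgue borel (norm :: 'a \<Rightarrow> real)) = sigma_sets UNIV (range (\<lambda>a::real. {..a}))"
    "sets (density lborel (\<lambda>s. ennreal (polar_density DIM('a) s))) = sigma_sets UNIV (range (\<lambda>a::real. {..a}))"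
    by (simp_all add: borel_eq_atMost)
  show "(\<Union>j. {..real j}) = UNIV" using real_arch_simple by auto
  show "emeasure (distr lebesgue borel (norm :: 'a \<Rightarrow> real)) {..real j} \<noteq> \<infinity>" for j
    by (simp add: e)
  fix X :: "real set" assume "X \<in> range (\<lambda>a. {..a})"
  then obtain a where X: "X = {..a}" by auto
  have "emeasure (density lborel (\<lambda>s. ennreal (polar_density DIM('a) s))) {..a}
      = (\<integral>\<^sup>+s. ennreal (polar_density DIM('a) s) * indicator {..a} s \<partial>lborel)"
    by (rule emeasure_density) auto
  also have "\<dots> = (if a \<ge> 0 then ennreal (unit_ball_vol (real DIM('a)) * a ^ DIM('a)) else 0)"
  proof (cases "a \<ge> 0")
    case True
    then show ?thesis using nn_integral_polar_density[of "DIM('a)" a] by simp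
  next
    case False
    then have "(\<lambda>s. ennreal (polar_density DIM('a) s) * indicator {..a} s) = (\<lambda>s. 0)"
      by (auto simp: polar_density_def indicator_def)
    then show ?thesis using False by simp
  qed
  finally show "emeasure (distr lebesgue borel (norm :: 'a \<Rightarrow> real)) X
      = emeasure (density lborel (\<lambda>s. ennreal (polar_density DIM('a) s))) X"
    by (simp add: X e)
qed auto

lemma norm_measurable_lebesgue[measurable]: "norm \<in> lebesgue \<rightarrow>\<^sub>M (borel :: real measure)"
  by (intro measurable_completion) simp

lemma measurable_norm_compose:
  "\<beta> \<in> borel_measurable borel \<Longrightarrow> (\<lambda>x::'a::euclidean_space. \<beta> (norm x)) \<in> borel_measurable lebesgue"
  by (rule measurable_compose[OF norm_measurable_lebesgue])

lemma radial_integral: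
  fixes \<beta> :: "real \<Rightarrow> real"
  assumes \<beta>: "\<beta> \<in> borel_measurable borel"
  shows "integrable lebesgue (\<lambda>x::'a::euclidean_space. \<beta> (norm x)) \<longleftrightarrow> integrable lborel (\<lambda>s. polar_density DIM('a) s * \<beta> s)"
    "(LINT x::'a|lebesgue. \<beta> (norm x)) = (LINT s|lborel. polar_density DIM('a) s * \<beta> s)"
proof -
  have "integrable lebesgue (\<lambda>x::'a. \<beta> (norm x)) \<longleftrightarrow> integrable (distr lebesgue borel (norm :: 'a \<Rightarrow> real)) \<beta>"
    by (rule integrable_distr_eq[OF norm_measurable_lebesgue \<beta>, symmetric])
  also have "\<dots> \<longleftrightarrow> integrable lborel (\<lambda>s. polar_density DIM('a) s *\<^sub>R \<beta> s)"
    unfolding distr_norm by (rule integrable_density) (use \<beta> polar_density_nonneg in auto)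
  finally show "integrable lebesgue (\<lambda>x::'a::euclidean_space. \<beta> (norm x)) \<longleftrightarrow> integrable lborel (\<lambda>s. polar_density DIM('a) s * \<beta> s)"
    by simp
  have "(LINT x::'a|lebesgue. \<beta> (norm x)) = (LINT s|distr lebesgue borel (norm :: 'a \<Rightarrow> real). \<beta> s)"
    by (rule integral_distr[OF norm_measurable_lebesgue \<beta>, symmetric])
  also have "\<dots> = (LINT s|lborel. polar_density DIM('a) s *\<^sub>R \<beta> s)"
    unfolding distr_norm by (rule integral_density) (use \<beta> polar_density_nonneg in auto)
  finally show "(LINT x::'a|lebesgue. \<beta> (norm x)) = (LINT s|lborel. polar_density DIM('a) s * \<beta> s)" by simp
qed

lemma AE_radial:
  assumes "AE s in lborel. 0 < s \<longrightarrow> P s"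
  shows "AE x::'a::euclidean_space in lebesgue. P (norm x)"
proof (rule AE_distrD[OF norm_measurable_lebesgue])
  show "AE s in distr lebesgue borel (norm :: 'a \<Rightarrow> real). P s"
    unfolding distr_norm
    by (subst AE_density) (use assms in \<open>auto simp: polar_density_def elim!: eventually_mono split: split_indicator\<close>)
qed

lemma AE_radialD:
  assumes "AE x::'a::euclidean_space in lebesgue. norm x \<notin> A" "A \<in> sets borel"
  shows "AE s in lborel. 0 < s \<longrightarrow> s \<notin> A"
proof -
  have "AE s in distr lebesgue borel (norm :: 'a \<Rightarrow> real). s \<notin> A"
    by (subst AE_distr_iff[OF norm_measurable_lebesgue]) (use assms in auto)
  then have "AE s in lborel. 0 < ennreal (polar_density DIM('a) s) \<longrightarrow> s \<notin> A"
    unfolding distr_norm by (subst (asm) AE_density) auto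
  then show ?thesis
    by (rule eventually_mono) (auto simp: polar_density_pos)
qed

text \<open>The radial density plays the role of the integral over spheres: it is the density of the
  image of the signed measure \<open>f dx\<close> under the norm, provided by the Radon--Nikodym theorem.\<close>

definition has_radial_density :: "('a::euclidean_space \<Rightarrow> real) \<Rightarrow> (real \<Rightarrow> real) \<Rightarrow> bool" where
  "has_radial_density f k \<longleftrightarrow> integrable lborel k \<and>
     (\<forall>\<beta>\<in>borel_measurable borel. integrable lebesgue (\<lambda>x. \<beta> (norm x) * f x) \<longrightarrow>
        integrable lborel (\<lambda>s. \<beta> s * k s) \<and>
        (LINT x|lebesgue. \<beta> (norm x) * f x) = (LINT s|lborel. \<beta> s * k s))"

section \<open>Existence of radial densities\<close>

text \<open>The image of f dx under the norm is finite because f is integrable, and absolutely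
  continuous because a null set of radii pulls back to a null set in space
  (\<open>AE_radial\<close>).\<close>

lemma radial_density_nonneg:
  fixes f :: "'a::euclidean_space \<Rightarrow> real"
  assumes f: "integrable lebesgue f" and nonneg: "\<And>x. 0 \<le> f x"
  shows "\<exists>k. has_radial_density f k"
proof -
  define \<nu> where "\<nu> = distr (density lebesgue (\<lambda>x. ennreal (f x))) borel norm"
  have fm[measurable]: "f \<in> borel_measurable lebesgue" using f by auto
  have nm: "norm \<in> density lebesgue (\<lambda>x. ennreal (f x)) \<rightarrow>\<^sub>M (borel :: real measure)"
    using norm_measurable_lebesgue by (simp cong: measurable_cong_sets)
  have fin: "finite_measure \<nu>"
  proof (rule finite_measureI)
    have "emeasure \<nu> (space \<nu>) = (\<integral>\<^sup>+x. ennreal (f x) \<partial>lebesgue)"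
      unfolding \<nu>_def by (subst emeasure_distr[OF nm]) (auto simp: emeasure_density)
    then show "emeasure \<nu> (space \<nu>) \<noteq> \<infinity>" using f nonneg by (simp add: nn_integral_eq_integral)
  qed
  have ac: "absolutely_continuous lborel \<nu>"
    unfolding absolutely_continuous_def
  proof
    fix A :: "real set" assume A: "A \<in> null_sets lborel"
    then have "AE s in lborel. 0 < s \<longrightarrow> s \<notin> A" using AE_not_in[OF A] by (auto elim: eventually_mono)
    then have ae: "AE x::'a in lebesgue. norm x \<notin> A" by (rule AE_radial)
    have A': "A \<in> sets borel" using A by auto
    have S: "norm -` A \<inter> space (density lebesgue (\<lambda>x. ennreal (f x))) \<in> sets (lebesgue :: 'a measure)"
      using measurable_sets[OF norm_measurable_lebesgue A'] by simp
    have "emeasure \<nu> A = (\<integral>\<^sup>+x. ennreal (f x) * indicator (norm -` A \<inter> space (density lebesgue (\<lambda>x. ennreal (f x)))) x \<partial>lebesgue)"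
      unfolding \<nu>_def by (subst emeasure_distr[OF nm A']) (rule emeasure_density, use S in auto)
    also have "\<dots> = (\<integral>\<^sup>+x. 0 \<partial>(lebesgue :: 'a measure))"
      by (rule nn_integral_cong_AE) (use ae in eventually_elim, auto)
    finally show "A \<in> null_sets \<nu>" using A' by (auto simp: null_sets_def \<nu>_def)
  qed
  obtain D where D: "D \<in> borel_measurable lborel" "AE x in lborel. RN_deriv lborel \<nu> x = ennreal (D x)" "\<And>x. 0 \<le> D x"
    using sigma_finite_measure.real_RN_deriv[OF sigma_finite_lborel fin ac] by (auto simp: \<nu>_def)
  have "density lborel (RN_deriv lborel \<nu>) = \<nu>"
    by (rule sigma_finite_measure.density_RN_deriv[OF sigma_finite_lborel ac]) (simp add: \<nu>_def)
  moreover have "density lborel (RN_deriv lborel \<nu>) = density lborel (\<lambda>s. ennreal (D s))"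
    by (rule density_cong) (use D in auto)
  ultimately have \<nu>: "\<nu> = density lborel (\<lambda>s. ennreal (D s))" by simp
  have eq: "integrable lebesgue (\<lambda>x. \<beta> (norm x) * f x) \<longleftrightarrow> integrable lborel (\<lambda>s. \<beta> s * D s)"
    "(LINT x|lebesgue. \<beta> (norm x) * f x) = (LINT s|lborel. \<beta> s * D s)"
    if \<beta>: "\<beta> \<in> borel_measurable borel" for \<beta> :: "real \<Rightarrow> real"
  proof -
    have \<beta>n: "(\<lambda>x::'a. \<beta> (norm x)) \<in> borel_measurable lebesgue" by (rule measurable_norm_compose[OF \<beta>])
    have 1: "integrable (density lebesgue (\<lambda>x. ennreal (f x))) (\<lambda>x. \<beta> (norm x)) \<longleftrightarrow> integrable lebesgue (\<lambda>x. f x *\<^sub>R \<beta> (norm x))"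
      by (rule integrable_density[OF \<beta>n fm]) (simp add: nonneg)
    have i1: "(LINT x|density lebesgue (\<lambda>x. ennreal (f x)). \<beta> (norm x)) = (LINT x|lebesgue. f x *\<^sub>R \<beta> (norm x))"
      by (rule integral_density[OF \<beta>n fm]) (simp add: nonneg)
    have \<beta>l: "\<beta> \<in> borel_measurable lborel" using \<beta> by simp
    have 2: "integrable \<nu> \<beta> \<longleftrightarrow> integrable lborel (\<lambda>s. D s *\<^sub>R \<beta> s)"
      unfolding \<nu> by (rule integrable_density[OF \<beta>l D(1)]) (simp add: D(3))
    have i2: "(LINT s|\<nu>. \<beta> s) = (LINT s|lborel. D s *\<^sub>R \<beta> s)"
      unfolding \<nu> by (rule integral_density[OF \<beta>l D(1)]) (simp add: D(3))
    have 3: "integrable \<nu> \<beta> \<longleftrightarrow> integrable (density lebesgue (\<lambda>x. ennreal (f x))) (\<lambda>x. \<beta> (norm x))"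
      unfolding \<nu>_def by (rule integrable_distr_eq[OF nm \<beta>])
    have i3: "(LINT s|\<nu>. \<beta> s) = (LINT x|density lebesgue (\<lambda>x. ennreal (f x)). \<beta> (norm x))"
      unfolding \<nu>_def by (rule integral_distr[OF nm \<beta>])
    show "integrable lebesgue (\<lambda>x. \<beta> (norm x) * f x) \<longleftrightarrow> integrable lborel (\<lambda>s. \<beta> s * D s)"
      using 1 2 3 by (simp add: mult.commute)
    show "(LINT x|lebesgue. \<beta> (norm x) * f x) = (LINT s|lborel. \<beta> s * D s)"
      using i1 i2 i3 by (simp add: mult.commute)
  qed
  have "integrable lborel D" using eq(1)[of "\<lambda>_. 1"] f by simp
  then show ?thesis unfolding has_radial_density_def using eq by blast
qed

lemma radial_density_exists:
  fixes f :: "'a::euclidean_space \<Rightarrow> real"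
  assumes f: "integrable lebesgue f"
  obtains k where "has_radial_density f k"
proof -
  have fm: "f \<in> borel_measurable lebesgue" using f by auto
  obtain k1 where k1: "has_radial_density (\<lambda>x. max 0 (f x)) k1"
    using radial_density_nonneg[of "\<lambda>x. max 0 (f x)"] f by (auto intro: integrable_max)
  obtain k2 where k2: "has_radial_density (\<lambda>x. max 0 (- f x)) k2"
    using radial_density_nonneg[of "\<lambda>x. max 0 (- f x)"] f by (auto intro: integrable_max)
  have "has_radial_density f (\<lambda>s. k1 s - k2 s)"
    unfolding has_radial_density_def
  proof (intro conjI ballI impI)
    show "integrable lborel (\<lambda>s. k1 s - k2 s)" using k1 k2 by (simp add: has_radial_density_def)
    fix \<beta> :: "real \<Rightarrow> real" assume \<beta>: "\<beta> \<in> borel_measurable borel" and i: "integrable lebesgue (\<lambda>x. \<beta> (norm x) * f x)"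
    have i1: "integrable lebesgue (\<lambda>x. \<beta> (norm x) * max 0 (f x))"
      by (rule Bochner_Integration.integrable_bound[OF i])
        (use measurable_norm_compose[OF \<beta>] fm in \<open>auto intro!: borel_measurable_times borel_measurable_max AE_I2 mult_left_mono simp: abs_mult\<close>)
    have i2: "integrable lebesgue (\<lambda>x. \<beta> (norm x) * max 0 (- f x))"
      by (rule Bochner_Integration.integrable_bound[OF i])
        (use measurable_norm_compose[OF \<beta>] fm in \<open>auto intro!: borel_measurable_times borel_measurable_max AE_I2 mult_left_mono simp: abs_mult\<close>)
    have s: "\<beta> (norm x) * f x = \<beta> (norm x) * max 0 (f x) - \<beta> (norm x) * max 0 (- f x)" for x
      by (auto simp: max_def)
    have j: "integrable lborel (\<lambda>s. \<beta> s * k1 s)" "integrable lborel (\<lambda>s. \<beta> s * k2 s)"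
      and e: "(LINT x|lebesgue. \<beta> (norm x) * max 0 (f x)) = (LINT s|lborel. \<beta> s * k1 s)"
        "(LINT x|lebesgue. \<beta> (norm x) * max 0 (- f x)) = (LINT s|lborel. \<beta> s * k2 s)"
      using k1 k2 \<beta> i1 i2 by (auto simp: has_radial_density_def)
    show "integrable lborel (\<lambda>s. \<beta> s * (k1 s - k2 s))"
      using Bochner_Integration.integrable_diff[OF j] by (simp add: right_diff_distrib)
    show "(LINT x|lebesgue. \<beta> (norm x) * f x) = (LINT s|lborel. \<beta> s * (k1 s - k2 s))"
      unfolding s right_diff_distrib
      using Bochner_Integration.integral_diff[OF i1 i2] Bochner_Integration.integral_diff[OF j] e by simp
  qed
  then show ?thesis by (rule that)
qed

lemma has_radial_density_uminus:
  assumes "has_radial_density f k"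
  shows "has_radial_density (\<lambda>x. - f x) (\<lambda>s. - k s)"
  using assms by (simp add: has_radial_density_def)

lemma integrable_mult_bounded:
  fixes f g :: "'a \<Rightarrow> real"
  assumes f: "integrable M f" and g: "g \<in> borel_measurable M" and L: "\<And>x. \<bar>g x\<bar> \<le> L"
  shows "integrable M (\<lambda>x. f x * g x)"
proof (rule Bochner_Integration.integrable_bound[OF integrable_mult_right[OF integrable_norm[OF f], of L]])
  show "(\<lambda>x. f x * g x) \<in> borel_measurable M"
    by (rule borel_measurable_times[OF borel_measurable_integrable[OF f] g])
  show "AE x in M. norm (f x * g x) \<le> norm (L * norm (f x))"
  proof (rule AE_I2)
    fix x
    have "norm (f x * g x) \<le> norm (f x) * L"
      unfolding norm_mult by (intro mult_left_mono) (use L in auto)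
    then show "norm (f x * g x) \<le> norm (L * norm (f x))" by (simp add: mult.commute)
  qed
qed

section \<open>Radial test functions\<close>

lemma smooth_upto_sqrt: "smooth_upto k {0<..} sqrt"
  using smooth_upto_cong[of "{0<..}" "\<lambda>x. x powr (1/2)" sqrt k] smooth_upto_powr[of k "1/2"]
  by (simp add: powr_half_sqrt)

text \<open>Radial functions are written as smooth functions of \<open>|x|\<^sup>2\<close>; constancy near the origin
  removes the singularity of the square root.\<close>

lemma C_k_radial:
  assumes \<rho>: "\<And>k. smooth_upto k {0<..} \<rho>" and a: "0 < a" and c: "\<And>t. t < a \<Longrightarrow> \<rho> t = c"
  shows "C_k k (\<lambda>x::'a::euclidean_space. \<rho> (norm x))"
proof -
  have 1: "smooth_upto k {0<..} (\<lambda>t. \<rho> (sqrt t))"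
    by (rule smooth_upto_compose[where T="{0<..}", OF _ _ _ \<rho> smooth_upto_sqrt]) auto
  have "smooth_upto k {..<a\<^sup>2} (\<lambda>t. c)" by (rule smooth_upto_const) simp
  also have "smooth_upto k {..<a\<^sup>2} (\<lambda>t. c) \<longleftrightarrow> smooth_upto k {..<a\<^sup>2} (\<lambda>t. \<rho> (sqrt t))"
  proof (rule smooth_upto_cong)
    fix t assume "t \<in> {..<a\<^sup>2}"
    then have "sqrt t < a" using a by (simp add: real_less_lsqrt real_sqrt_less_iff[of t "a\<^sup>2", unfolded real_sqrt_abs] abs_of_pos)
    then show "c = \<rho> (sqrt t)" using c by simp
  qed simp
  finally have 2: "smooth_upto k {..<a\<^sup>2} (\<lambda>t. \<rho> (sqrt t))" .
  have "smooth_upto k ({0<..} \<union> {..<a\<^sup>2}) (\<lambda>t. \<rho> (sqrt t))"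
    by (rule smooth_upto_Un[OF _ _ 1 2]) auto
  moreover have "{0<..} \<union> {..<a\<^sup>2} = UNIV" using a by (auto simp: not_less) (metis le_less_trans not_le zero_less_power)
  ultimately have "smooth_upto k UNIV (\<lambda>t. \<rho> (sqrt t))" by simp
  from C_k_compose[OF this C_k_norm_power2] show ?thesis by simp
qed

text \<open>At the origin the chain rule through the norm fails; there the function is locally
  constant, and the convention sgn 0 = 0 keeps the formula valid.\<close>

lemma has_derivative_radial:
  fixes x :: "'a::euclidean_space"
  assumes "(\<rho> has_real_derivative D) (at (norm x))" and 0: "x = 0 \<Longrightarrow> D = 0"
    and a: "0 < a" "\<And>t. t < a \<Longrightarrow> \<rho> t = c"
  shows "((\<lambda>x. \<rho> (norm x)) has_derivative (\<lambda>h. D * (sgn x \<bullet> h))) (at x)"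
proof (cases "x = 0")
  case True
  have "((\<lambda>x::'a. \<rho> (norm x)) has_derivative (\<lambda>h. 0)) (at x)"
    by (rule has_derivative_transform_within_open[of "\<lambda>_. c" _ x UNIV "ball 0 a"]) (use a True in auto)
  then show ?thesis using 0[OF True] by simp
next
  case False
  have "((\<lambda>x. \<rho> (norm x)) has_derivative (\<lambda>h. D * (h \<bullet> sgn x))) (at x)"
    using has_derivative_compose[OF has_derivative_norm[OF False] assms(1)[unfolded has_field_derivative_def]]
    by simp
  then show ?thesis by (simp add: inner_commute)
qed

text \<open>Two families. The fields \<zeta>(|x|) |x|^e x vanish near the origin and probe the
  radial derivative of u; the scalar functions \<open>tail \<zeta>\<close> of the norm are constant
  there, have radial derivative -\<zeta>, and are inserted into the equation.\<close>

lemma radial_test_function: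
  fixes \<Omega> :: "'a::euclidean_space set"
  assumes \<zeta>: "\<zeta> \<in> smooth_supp a b" and ab: "0 < a" "b < 1"
  shows "C_k k (\<lambda>x::'a. \<zeta> (norm x) * norm x powr e)"
    "(\<lambda>x::'a. \<zeta> (norm x) * norm x powr e * (x \<bullet> i)) \<in> test_functions (ball 0 1)"
    "C_k k (\<lambda>x::'a. tail \<zeta> (norm x))"
    "(\<lambda>x::'a. tail \<zeta> (norm x)) \<in> test_functions (ball 0 1)"
proof -
  have s: "smooth_upto k {0<..} (\<lambda>t. \<zeta> t * t powr e)" for k
    by (rule smooth_upto_mult[OF _ smooth_upto_subset[OF smooth_suppD(1)[OF \<zeta>]] smooth_upto_powr]) auto
  show C: "C_k k (\<lambda>x::'a. \<zeta> (norm x) * norm x powr e)" for k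
    by (rule C_k_radial[OF s ab(1), of 0]) (simp add: smooth_suppD(2)[OF \<zeta>])
  have C2: "C_k k (\<lambda>x::'a. \<zeta> (norm x) * norm x powr e * (x \<bullet> i))" for k
    by (rule C_k_mult[OF C C_k_inner])
  have sub: "cball 0 b \<subseteq> (ball 0 1 :: 'a set)" using ab by auto
  show "(\<lambda>x::'a. \<zeta> (norm x) * norm x powr e * (x \<bullet> i)) \<in> test_functions (ball 0 1)"
    by (rule test_functionsI[OF C2 compact_cball sub]) (simp add: smooth_suppD(2)[OF \<zeta>])
  show C3: "C_k k (\<lambda>x::'a. tail \<zeta> (norm x))" for k
    by (rule C_k_radial[OF smooth_upto_subset[OF tail_smooth[OF \<zeta>]] ab(1), of "LINT s|lborel. \<zeta> s"])
      (auto simp: tail_le[OF \<zeta>])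
  show "(\<lambda>x::'a. tail \<zeta> (norm x)) \<in> test_functions (ball 0 1)"
    by (rule test_functionsI[OF C3 compact_cball sub]) (simp add: tail_ge[OF \<zeta>])
qed

lemma frechet_tail_radial:
  fixes x :: "'a::euclidean_space"
  assumes \<zeta>: "\<zeta> \<in> smooth_supp a b" and ab: "0 < a"
  shows "frechet_derivative (\<lambda>x. tail \<zeta> (norm x)) (at x) h = - \<zeta> (norm x) * (sgn x \<bullet> h)"
proof -
  have "((\<lambda>x. tail \<zeta> (norm x)) has_derivative (\<lambda>h. - \<zeta> (norm x) * (sgn x \<bullet> h))) (at x)"
    by (rule has_derivative_radial[OF tail_deriv[OF \<zeta>] _ ab, of _ "LINT s|lborel. \<zeta> s"])
      (use ab in \<open>auto simp: smooth_suppD(2)[OF \<zeta>] tail_le[OF \<zeta>]\<close>)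
  from frechet_derivative_at[OF this] show ?thesis by metis
qed

lemma inner_sgn_norm: "y \<bullet> x = norm x * (y \<bullet> sgn x)"
  by (cases "x = 0") (simp_all add: sgn_div_norm)

text \<open>For a field q(|x|) x the divergence is n q + |x| q'. With q = t^(-n) \<zeta> the two
  terms free of \<zeta>' cancel, since |x|^(-n) x is divergence-free away from the origin.\<close>

lemma frechet_radial_field:
  fixes x :: "'a::euclidean_space"
  assumes \<zeta>: "\<zeta> \<in> smooth_supp a b" and ab: "0 < a"
  shows "(\<Sum>i\<in>Basis. frechet_derivative (\<lambda>x. \<zeta> (norm x) * norm x powr - real DIM('a) * (x \<bullet> i)) (at x) i)
    = deriv \<zeta> (norm x) * norm x powr (1 - real DIM('a))"
proof -
  let ?n = "real DIM('a)"
  define q where "q t = \<zeta> t * t powr - ?n" for t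
  define q' where "q' = (if x = 0 then 0 else deriv \<zeta> (norm x) * norm x powr - ?n + (- ?n * norm x powr (- ?n - 1)) * \<zeta> (norm x))"
  have q: "((\<lambda>x. q (norm x)) has_derivative (\<lambda>h. q' * (sgn x \<bullet> h))) (at x)"
  proof (cases "x = 0")
    case True
    have "((\<lambda>x::'a. q (norm x)) has_derivative (\<lambda>h. 0)) (at x)"
      by (rule has_derivative_transform_within_open[of "\<lambda>_. 0" _ x UNIV "ball 0 a"])
        (use ab True smooth_suppD(2)[OF \<zeta>] in \<open>auto simp: q_def\<close>)
    then show ?thesis using True by (simp add: q'_def)
  next
    case False
    have qd: "(q has_real_derivative q') (at (norm x))"
      unfolding q_def[abs_def] q'_def if_not_P[OF False]
      by (rule DERIV_mult[OF smooth_suppD(5)[OF \<zeta>] has_real_derivative_powr]) (use False in simp)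
    show ?thesis
      by (rule has_derivative_radial[OF qd _ ab, of 0]) (use False in \<open>auto simp: q_def smooth_suppD(2)[OF \<zeta>]\<close>)
  qed
  have "frechet_derivative (\<lambda>x. q (norm x) * (x \<bullet> i)) (at x) i = q (norm x) + q' * (sgn x \<bullet> i) * (x \<bullet> i)"
    if i: "i \<in> Basis" for i
  proof -
    have "((\<lambda>x. q (norm x) * (x \<bullet> i)) has_derivative (\<lambda>h. q (norm x) * (h \<bullet> i) + q' * (sgn x \<bullet> h) * (x \<bullet> i))) (at x)"
      by (rule has_derivative_mult[OF q has_derivative_inner_left[OF has_derivative_ident]])
    from frechet_derivative_at[OF this, symmetric] show ?thesis using i by (simp add: inner_same_Basis)
  qed
  then have "(\<Sum>i\<in>Basis. frechet_derivative (\<lambda>x. q (norm x) * (x \<bullet> i)) (at x) i)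
      = (\<Sum>i\<in>(Basis::'a set). q (norm x) + q' * (sgn x \<bullet> i) * (x \<bullet> i))"
    by (intro sum.cong refl)
  also have "\<dots> = ?n * q (norm x) + q' * (\<Sum>i\<in>Basis. (sgn x \<bullet> i) * (x \<bullet> i))"
    by (simp add: sum.distrib sum_distrib_left mult.assoc)
  also have "(\<Sum>i\<in>Basis. (sgn x \<bullet> i) * (x \<bullet> i)) = norm x"
  proof -
    have "(\<Sum>i\<in>Basis. (sgn x \<bullet> i) * (x \<bullet> i)) = sgn x \<bullet> x" by (rule euclidean_inner[symmetric])
    also have "sgn x \<bullet> x = norm x"
      using inner_sgn_norm[of x x] by (cases "x = 0") (simp_all add: inner_commute dot_square_norm power2_eq_square)
    finally show ?thesis .
  qed
  also have "?n * q (norm x) + q' * norm x = deriv \<zeta> (norm x) * norm x powr (1 - ?n)"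
  proof (cases "x = 0")
    case True
    then show ?thesis using ab by (simp add: q_def q'_def smooth_suppD(2)[OF \<zeta>])
  next
    case False
    then have "norm x powr (1 - ?n) = norm x * norm x powr - ?n"
      "norm x powr - ?n = norm x * norm x powr (- ?n - 1)"
      by (simp_all add: powr_diff powr_minus field_simps)
    then show ?thesis using False by (simp add: q_def q'_def algebra_simps)
  qed
  finally show ?thesis by (simp only: q_def)
qed

lemma radial_field_bounded:
  assumes \<zeta>: "\<zeta> \<in> smooth_supp a b" and a: "0 < a"
  shows "\<exists>L. \<forall>x::'a::euclidean_space. \<bar>\<zeta> (norm x) * norm x powr e\<bar> \<le> L"
    "(\<lambda>x::'a. \<zeta> (norm x) * norm x powr e) \<in> borel_measurable lebesgue"
proof -
  have m: "(\<lambda>t. \<zeta> t * t powr e) \<in> borel_measurable borel" using smooth_suppD(4)[OF \<zeta>] by measurable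
  show "(\<lambda>x::'a. \<zeta> (norm x) * norm x powr e) \<in> borel_measurable lebesgue"
    by (rule measurable_norm_compose[OF m])
  have "continuous_on {a..b} (\<lambda>t. \<zeta> t * t powr e)"
    using a by (intro continuous_intros smooth_suppD(3)[OF \<zeta>]) auto
  then have "bounded ((\<lambda>t. \<zeta> t * t powr e) ` {a..b})" by (intro compact_imp_bounded compact_continuous_image) auto
  then obtain L where L: "\<forall>t\<in>{a..b}. \<bar>\<zeta> t * t powr e\<bar> \<le> L" by (auto simp: bounded_iff)
  have "\<bar>\<zeta> t * t powr e\<bar> \<le> max L 0" for t
    using L smooth_suppD(2)[OF \<zeta>, of t] by (cases "t \<in> {a..b}") (auto simp: le_max_iff_disj)
  then show "\<exists>L. \<forall>x::'a. \<bar>\<zeta> (norm x) * norm x powr e\<bar> \<le> L" by blast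
qed

text \<open>The divergence of \<open>\<zeta>(|x|) |x|\<^sup>-\<^sup>n x\<close> is \<open>\<zeta>'(|x|) |x|\<^sup>1\<^sup>-\<^sup>n\<close>.\<close>

lemma weak_gradient_radial_identity:
  fixes u :: "'a::euclidean_space \<Rightarrow> real"
  assumes wg: "has_weak_gradient (ball 0 1) u U"
    and u: "integrable (lebesgue_on (ball 0 1)) u" and U: "integrable (lebesgue_on (ball 0 1)) U"
    and \<zeta>: "\<zeta> \<in> smooth_supp a b" and ab: "0 < a" "b < 1"
  shows "(LINT x|lebesgue. (deriv \<zeta> (norm x) * norm x powr (1 - real DIM('a))) * (indicator (ball 0 1) x * u x))
    = - (LINT x|lebesgue. (\<zeta> (norm x) * norm x powr (1 - real DIM('a))) * (indicator (ball 0 1) x * (U x \<bullet> sgn x)))"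
proof -
  let ?n = "real DIM('a)" and ?B = "ball 0 1 :: 'a set" and ?M = "lebesgue_on (ball 0 1 :: 'a set)"
  define V where "V i x = \<zeta> (norm x) * norm x powr - ?n * (x \<bullet> i)" for i x :: 'a
  have V: "V i \<in> test_functions ?B" for i
    unfolding V_def[abs_def] by (rule radial_test_function(2)[OF \<zeta> ab])
  have C: "C_k k (V i)" for k i by (rule test_functionsD(4)[OF V])
  have bd: "\<exists>L. \<forall>x. \<bar>f x\<bar> \<le> L" and ms: "f \<in> borel_measurable ?M"
    if f: "continuous_on UNIV f" and S: "\<And>x. x \<notin> S \<Longrightarrow> f x = 0" "compact S" for f :: "'a \<Rightarrow> real" and S
  proof -
    obtain L where "\<And>x. norm (f x) \<le> L" using compact_support_bounded[OF f S(2,1)] by blast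
    then show "\<exists>L. \<forall>x. \<bar>f x\<bar> \<le> L" by auto
    show "f \<in> borel_measurable ?M" by (rule continuous_measurable_lebesgue_on[OF f])
  qed
  have i1: "integrable ?M (\<lambda>x. u x * frechet_derivative (V i) (at x) i)" if i: "i \<in> Basis" for i
  proof -
    have c: "continuous_on UNIV (\<lambda>x. frechet_derivative (V i) (at x) i)" by (rule grad_continuous(2)[OF C[of 1] i])
    have z: "frechet_derivative (V i) (at x) i = 0" if "x \<notin> closure {x. V i x \<noteq> 0}" for x
      using frechet_derivative_outside[OF closed_closure test_functionsD(3)[OF V] that] by simp
    obtain L where "\<forall>x. \<bar>frechet_derivative (V i) (at x) i\<bar> \<le> L" using bd[OF c z test_functionsD(1)[OF V]] by blast
    then show ?thesis by (intro integrable_mult_bounded[OF u ms[OF c z test_functionsD(1)[OF V]]]) auto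
  qed
  have i2: "integrable ?M (\<lambda>x. (U x \<bullet> i) * V i x)" for i
  proof -
    have c: "continuous_on UNIV (V i)" by (rule C_k_continuous[OF C[of 0]])
    obtain L where "\<forall>x. \<bar>V i x\<bar> \<le> L" using bd[OF c test_functionsD(3)[OF V] test_functionsD(1)[OF V]] by blast
    moreover have "integrable ?M (\<lambda>x. U x \<bullet> i)" using U by simp
    ultimately show ?thesis
      by (intro integrable_mult_bounded ms[OF c test_functionsD(3)[OF V] test_functionsD(1)[OF V]]) auto
  qed
  have e: "(LINT x|?M. u x * frechet_derivative (V i) (at x) i) = - (LINT x|?M. (U x \<bullet> i) * V i x)" if "i \<in> Basis" for i
    using wg V[of i] that unfolding has_weak_gradient_def by blast
  have "(LINT x|?M. u x * (\<Sum>i\<in>Basis. frechet_derivative (V i) (at x) i))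
      = (LINT x|?M. (\<Sum>i\<in>Basis. u x * frechet_derivative (V i) (at x) i))"
    by (simp add: sum_distrib_left)
  also have "\<dots> = (\<Sum>i\<in>Basis. LINT x|?M. u x * frechet_derivative (V i) (at x) i)"
    by (rule Bochner_Integration.integral_sum) (rule i1)
  also have "\<dots> = (\<Sum>i\<in>Basis. - (LINT x|?M. (U x \<bullet> i) * V i x))"
    by (intro sum.cong refl e)
  also have "\<dots> = - (LINT x|?M. (\<Sum>i\<in>Basis. (U x \<bullet> i) * V i x))"
    by (subst Bochner_Integration.integral_sum[OF i2]) (simp add: sum_negf)
  also have "(\<lambda>x. \<Sum>i\<in>Basis. (U x \<bullet> i) * V i x) = (\<lambda>x. (U x \<bullet> sgn x) * (\<zeta> (norm x) * norm x powr (1 - ?n)))"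
  proof
    fix x :: 'a
    have "(\<Sum>i\<in>Basis. (U x \<bullet> i) * V i x) = (\<zeta> (norm x) * norm x powr - ?n) * (\<Sum>i\<in>Basis. (U x \<bullet> i) * (x \<bullet> i))"
      by (simp add: V_def sum_distrib_left mult_ac)
    also have "(\<Sum>i\<in>Basis. (U x \<bullet> i) * (x \<bullet> i)) = U x \<bullet> x" by (rule euclidean_inner[symmetric])
    also have "U x \<bullet> x = norm x * (U x \<bullet> sgn x)" by (rule inner_sgn_norm)
    also have "(\<zeta> (norm x) * norm x powr - ?n) * (norm x * (U x \<bullet> sgn x)) = (U x \<bullet> sgn x) * (\<zeta> (norm x) * norm x powr (1 - ?n))"
    proof (cases "x = 0")
      case False
      then have "norm x powr (1 - ?n) = norm x * norm x powr - ?n"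
        by (simp add: powr_diff powr_minus field_simps)
      then show ?thesis by simp
    qed simp
    finally show "(\<Sum>i\<in>Basis. (U x \<bullet> i) * V i x) = (U x \<bullet> sgn x) * (\<zeta> (norm x) * norm x powr (1 - ?n))" .
  qed
  also have "(\<lambda>x. u x * (\<Sum>i\<in>Basis. frechet_derivative (V i) (at x) i)) = (\<lambda>x. u x * (deriv \<zeta> (norm x) * norm x powr (1 - ?n)))"
    unfolding V_def[abs_def] frechet_radial_field[OF \<zeta> ab(1)] by simp
  finally show ?thesis
    by (simp add: integral_lebesgue_on(1) mult_ac)
qed

section \<open>Weak gradients of radial functions\<close>

lemma has_radial_densityD:
  assumes "has_radial_density f k"
  shows "integrable lborel k" "k \<in> borel_measurable borel"
    "\<beta> \<in> borel_measurable borel \<Longrightarrow> integrable lebesgue (\<lambda>x. \<beta> (norm x) * f x) \<Longrightarrow> integrable lborel (\<lambda>s. \<beta> s * k s)"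
    "\<beta> \<in> borel_measurable borel \<Longrightarrow> integrable lebesgue (\<lambda>x. \<beta> (norm x) * f x) \<Longrightarrow>
      (LINT x|lebesgue. \<beta> (norm x) * f x) = (LINT s|lborel. \<beta> s * k s)"
proof -
  show "integrable lborel k" using assms by (simp add: has_radial_density_def)
  from borel_measurable_integrable[OF this] show "k \<in> borel_measurable borel" by simp
qed (use assms in \<open>auto simp: has_radial_density_def\<close>)

lemma indicator_norm_mult_integrable:
  fixes f :: "'a::euclidean_space \<Rightarrow> real"
  assumes f: "integrable lebesgue f" and A: "A \<in> sets borel"
  shows "integrable lebesgue (\<lambda>x. indicator A (norm x) * f x)"
proof -
  have "integrable lebesgue (\<lambda>x. f x * indicator A (norm x))"
    by (rule integrable_mult_bounded[OF f measurable_norm_compose, of _ 1])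
      (use A in \<open>auto simp: indicator_def\<close>)
  then show ?thesis by (simp add: mult.commute)
qed

text \<open>The radial profile \<open>\<rho>\<close> need not be measurable; compact subsets of the exceptional set have
  compact image under the norm, which suffices to test with.\<close>

lemma radial_le_density:
  fixes f :: "'a::euclidean_space \<Rightarrow> real"
  assumes f: "integrable lebesgue f" and rad: "AE x in lebesgue. x \<in> ball 0 1 \<longrightarrow> f x = \<rho> (norm x)"
    and k: "has_radial_density f k"
  shows "AE x in lebesgue. x \<in> ball 0 1 \<longrightarrow> f x \<le> k (norm x) / polar_density DIM('a) (norm x)"
proof (rule ccontr)
  assume neg: "\<not> ?thesis"
  define v where "v s = k s / polar_density DIM('a) s" for s
  have vm: "v \<in> borel_measurable borel" unfolding v_def[abs_def] using has_radial_densityD(2)[OF k] by measurable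
  have fm: "f \<in> borel_measurable lebesgue" using f by auto
  have vnm: "(\<lambda>x::'a. v (norm x)) \<in> borel_measurable lebesgue" by (rule measurable_norm_compose[OF vm])
  obtain N where N: "{x \<in> space lebesgue. \<not> (x \<in> ball 0 1 \<longrightarrow> f x = \<rho> (norm x))} \<subseteq> N" "emeasure lebesgue N = 0" "N \<in> sets lebesgue"
    using AE_E[OF rad] by blast
  \<comment> \<open>The set of counterexamples, cleaned of the null set N where radial symmetry
    fails and of the origin.\<close>
  define D where "D = {x \<in> space lebesgue. v (norm x) < f x} \<inter> (ball 0 1 - {0}) - N"
  have D_sets: "D \<in> sets lebesgue"
  proof -
    have "{x \<in> space lebesgue. v (norm x) < f x} \<in> sets lebesgue" using borel_measurable_less[OF vnm fm] .
    then show ?thesis unfolding D_def by (intro sets.Diff sets.Int N(3)) auto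
  qed
  have D_pos: "emeasure lebesgue D \<noteq> 0"
  proof
    assume "emeasure lebesgue D = 0"
    then have "D \<in> null_sets lebesgue" using D_sets by (simp add: null_sets_def)
    moreover have "N \<in> null_sets lebesgue" using N by (simp add: null_sets_def)
    moreover have "{0::'a} \<in> null_sets lebesgue" by (simp add: null_sets_def)
    ultimately have "AE x in lebesgue. x \<notin> D \<and> x \<notin> N \<and> x \<notin> {0}" by (intro AE_conjI AE_not_in)
    then have "AE x in lebesgue. x \<in> ball 0 1 \<longrightarrow> f x \<le> k (norm x) / polar_density DIM('a) (norm x)"
      by (rule eventually_mono) (auto simp: D_def v_def not_less)
    then show False using neg by blast
  qed
  have D_bd: "bounded D" by (rule bounded_subset[OF bounded_ball[of 0 1]]) (auto simp: D_def)
  have D_fin: "emeasure lebesgue D < \<infinity>"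
  proof -
    have "emeasure lebesgue D \<le> emeasure lebesgue (ball 0 1 :: 'a set)" by (rule emeasure_mono) (auto simp: D_def)
    also have "\<dots> < \<infinity>" using emeasure_bounded_finite[OF bounded_ball[of "0::'a" 1]] by simp
    finally show ?thesis .
  qed
  then have mD: "measure lebesgue D > 0"
    using D_pos by (simp add: measure_def enn2real_positive_iff zero_less_iff_neq_zero top.not_eq_extremum)
  \<comment> \<open>Inner regularity. The norm image of the compact set T is compact and hence
    Borel, which could not be claimed for the image of D.\<close>
  obtain T where T: "closed T" "T \<subseteq> D" "D - T \<in> lmeasurable" "emeasure lebesgue (D - T) < ennreal (measure lebesgue D)"
    by (rule sets_lebesgue_inner_closed[OF D_sets mD])
  have Tc: "compact T" using T(1) bounded_subset[OF D_bd T(2)] by (simp add: compact_eq_bounded_closed)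
  have T_sets: "T \<in> sets lebesgue" using T(1) by simp
  have T_pos: "T \<notin> null_sets lebesgue"
  proof
    assume "T \<in> null_sets lebesgue"
    then have "emeasure lebesgue (D - T) = emeasure lebesgue D" by (rule emeasure_Diff_null_set[OF _ D_sets])
    moreover have "emeasure lebesgue D = ennreal (measure lebesgue D)"
      using D_fin by (intro emeasure_eq_ennreal_measure) auto
    ultimately show False using T(4) by simp
  qed
  define K where "K = norm ` T"
  have K: "K \<in> sets borel" unfolding K_def by (intro borel_closed compact_imp_closed compact_continuous_image Tc continuous_intros)
  have K01: "K \<subseteq> {0<..<1}" using T(2) by (auto simp: K_def D_def)
  let ?I = "\<lambda>s. indicator K s :: real"
  have Im: "?I \<in> borel_measurable borel" using K by simp
  have i1: "integrable lebesgue (\<lambda>x. ?I (norm x) * f x)" by (rule indicator_norm_mult_integrable[OF f K])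
  have pd: "polar_density DIM('a) s * (?I s * v s) = ?I s * k s" for s
  proof (cases "s \<in> K")
    case True
    then have "polar_density DIM('a) s > 0" using K01 by (intro polar_density_pos) auto
    then show ?thesis by (simp add: v_def)
  qed simp
  have ivm: "(\<lambda>s. ?I s * v s) \<in> borel_measurable borel" by (rule borel_measurable_times[OF Im vm])
  have i2: "integrable lebesgue (\<lambda>x::'a. ?I (norm x) * v (norm x))"
    using radial_integral(1)[OF ivm, where 'a='a] has_radial_densityD(3)[OF k Im i1] unfolding pd by blast
  have e2: "(LINT x::'a|lebesgue. ?I (norm x) * v (norm x)) = (LINT x|lebesgue. ?I (norm x) * f x)"
    using radial_integral(2)[OF ivm, where 'a='a] has_radial_densityD(4)[OF k Im i1] unfolding pd by simp
  define F where "F x = ?I (norm x) * f x - ?I (norm x) * v (norm x)" for x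
  have Fi: "integrable lebesgue F" unfolding F_def[abs_def] by (rule Bochner_Integration.integrable_diff[OF i1 i2])
  have F0: "(LINT x|lebesgue. F x) = 0"
    unfolding F_def using Bochner_Integration.integral_diff[OF i1 i2] e2 by simp
  \<comment> \<open>A point whose radius lies in K shares it with a point of T, and off N the values
    of f depend only on the radius. So F is positive almost everywhere on the whole set of such
    radii, although its integral vanishes by the definition of the density.\<close>
  have Fpos: "F x > 0" if x: "norm x \<in> K" "x \<notin> N" for x
  proof -
    obtain y where y: "y \<in> T" "norm x = norm y" using x(1) by (auto simp: K_def)
    have yD: "y \<in> D" using y(1) T(2) by blast
    then have "y \<in> ball 0 1" "y \<notin> N" "v (norm y) < f y" by (auto simp: D_def)
    then have "f y = \<rho> (norm y)" using N(1) by auto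
    moreover have "x \<in> ball 0 1" using \<open>y \<in> ball 0 1\<close> y(2) by simp
    then have "f x = \<rho> (norm x)" using N(1) x(2) by auto
    ultimately show ?thesis using \<open>v (norm y) < f y\<close> x(1) y(2) by (simp add: F_def)
  qed
  have N_ae: "AE x in lebesgue. x \<notin> N" using N by (intro AE_not_in) (simp add: null_sets_def)
  have "AE x in lebesgue. 0 \<le> F x"
    using N_ae
  proof eventually_elim
    case (elim x)
    then show ?case using Fpos[of x] by (cases "norm x \<in> K") (auto simp: F_def)
  qed
  then have "AE x in lebesgue. F x = 0" using integral_nonneg_eq_0_iff_AE[OF Fi] F0 by blast
  with N_ae have "AE x in lebesgue. x \<notin> T"
  proof eventually_elim
    case (elim x)
    then show ?case using Fpos[of x] by (auto simp: K_def)
  qed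
  then have "T \<in> null_sets lebesgue" using T_sets by (simp add: AE_iff_null_sets)
  then show False using T_pos by blast
qed

lemma radial_eq_density:
  fixes f :: "'a::euclidean_space \<Rightarrow> real"
  assumes f: "integrable lebesgue f" and rad: "AE x in lebesgue. x \<in> ball 0 1 \<longrightarrow> f x = \<rho> (norm x)"
    and k: "has_radial_density f k"
  shows "AE x in lebesgue. x \<in> ball 0 1 \<longrightarrow> f x = k (norm x) / polar_density DIM('a) (norm x)"
proof -
  have "integrable lebesgue (\<lambda>x. - f x)" using f by simp
  moreover have "AE x in lebesgue. x \<in> ball 0 1 \<longrightarrow> - f x = (\<lambda>s. - \<rho> s) (norm x)" using rad by eventually_elim simp
  ultimately have "AE x in lebesgue. x \<in> ball 0 1 \<longrightarrow> - f x \<le> - k (norm x) / polar_density DIM('a) (norm x)"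
    by (rule radial_le_density[OF _ _ has_radial_density_uminus[OF k]])
  with radial_le_density[OF f rad k] show ?thesis by eventually_elim auto
qed

text \<open>The densities of u and of its radial derivative U \<bullet> sgn x, divided by the area
  of spheres, satisfy a' = d weakly; this is the weak gradient tested with radial fields. Radial
  symmetry then identifies u with its mean a.\<close>

lemma radial_profile:
  fixes u :: "'a::euclidean_space \<Rightarrow> real"
  assumes wg: "has_weak_gradient (ball 0 1) u U"
    and u: "integrable (lebesgue_on (ball 0 1)) u" and U: "integrable (lebesgue_on (ball 0 1)) U"
    and rad: "AE x in lebesgue_on (ball 0 1). u x = \<rho> (norm x)"
  shows "\<exists>W d. (\<forall>x y. 0 < x \<longrightarrow> x < y \<longrightarrow> y < 1 \<longrightarrow> set_integrable lborel {x..y} d) \<and> d \<in> borel_measurable borel \<and>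
    (\<forall>x y. 0 < x \<longrightarrow> x \<le> y \<longrightarrow> y < 1 \<longrightarrow> W y - W x = (LINT s:{x..y}|lborel. d s)) \<and>
    (AE x in lebesgue. x \<in> ball 0 1 \<longrightarrow> u x = W (norm x))"
proof -
  let ?n = "real DIM('a)" and ?B = "ball 0 1 :: 'a set"
  define c where "c = unit_ball_vol ?n * ?n"
  have c: "c > 0" by (simp add: c_def)
  define f where "f x = indicator ?B x * u x" for x
  define F where "F x = indicator ?B x * (U x \<bullet> sgn x)" for x
  have B: "?B \<in> sets lebesgue" by simp
  have f: "integrable lebesgue f"
    using u integral_lebesgue_on(2)[OF B, of u] by (simp add: f_def[abs_def])
  have F: "integrable lebesgue F"
  proof -
    have iU: "integrable lebesgue (\<lambda>x. indicator ?B x *\<^sub>R U x)" using U integral_lebesgue_on(2)[OF B, of U] by simp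
    have sm: "(sgn :: 'a \<Rightarrow> 'a) \<in> borel_measurable lebesgue"
    proof -
      have "(sgn :: 'a \<Rightarrow> 'a) \<in> borel_measurable borel" unfolding sgn_div_norm[abs_def] by measurable
      then show ?thesis by (intro measurable_completion) simp
    qed
    show ?thesis
      unfolding F_def[abs_def]
    proof (rule Bochner_Integration.integrable_bound[OF integrable_norm[OF iU]])
      have "(\<lambda>x. (indicator ?B x *\<^sub>R U x) \<bullet> sgn x) \<in> borel_measurable lebesgue"
        by (rule borel_measurable_inner[OF borel_measurable_integrable[OF iU] sm])
      then show "(\<lambda>x. indicator ?B x * (U x \<bullet> sgn x)) \<in> borel_measurable lebesgue" by simp
      show "AE x in lebesgue. norm (indicator ?B x * (U x \<bullet> sgn x)) \<le> norm (norm (indicator ?B x *\<^sub>R U x))"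
      proof (rule AE_I2)
        fix x
        have "\<bar>U x \<bullet> sgn x\<bar> \<le> norm (U x) * norm (sgn x)" by (rule Cauchy_Schwarz_ineq2)
        also have "\<dots> \<le> norm (U x) * 1" by (intro mult_left_mono) (auto simp: norm_sgn)
        finally show "norm (indicator ?B x * (U x \<bullet> sgn x)) \<le> norm (norm (indicator ?B x *\<^sub>R U x))"
          by (simp add: abs_mult indicator_def)
      qed
    qed
  qed
  obtain ku where ku: "has_radial_density f ku" by (rule radial_density_exists[OF f])
  obtain k where k: "has_radial_density F k" by (rule radial_density_exists[OF F])
  \<comment> \<open>Spherical means: the factor s^(1-n) / c is the reciprocal area of the sphere of
    radius s.\<close>
  define a where "a s = ku s * s powr (1 - ?n) / c" for s
  define d where "d s = k s * s powr (1 - ?n) / c" for s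
  have si: "set_integrable lborel {x..y} (\<lambda>s. k s * s powr (1 - ?n) / c)"
    if k: "integrable lborel k" and xy: "0 < x" "x < y" for x y and k :: "real \<Rightarrow> real"
  proof -
    have "integrable lborel (\<lambda>s. k s * (indicator {x..y} s * s powr (1 - ?n) / c))"
    proof (rule integrable_mult_bounded[OF k])
      show "(\<lambda>s. indicator {x..y} s * s powr (1 - ?n) / c) \<in> borel_measurable lborel" by measurable
      fix s
      have "s powr (1 - ?n) \<le> x powr (1 - ?n)" if "s \<in> {x..y}"
        using that xy DIM_positive[where 'a='a] by (intro powr_mono2') auto
      then show "\<bar>indicator {x..y} s * s powr (1 - ?n) / c\<bar> \<le> x powr (1 - ?n) / c"
        using c by (auto simp: indicator_def abs_mult intro!: divide_right_mono)
    qed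
    then show ?thesis by (simp add: set_integrable_def mult_ac)
  qed
  have kum: "ku \<in> borel_measurable borel" and km: "k \<in> borel_measurable borel"
    by (rule has_radial_densityD(2)[OF ku], rule has_radial_densityD(2)[OF k])
  have "\<exists>W. (\<forall>x y. 0 < x \<longrightarrow> x \<le> y \<longrightarrow> y < 1 \<longrightarrow> W y - W x = (LINT s:{x..y}|lborel. d s)) \<and>
    (AE s in lborel. s \<in> {0<..<1} \<longrightarrow> a s = W s)"
  proof (rule weak_derivative_unit_interval)
    show "set_integrable lborel {x..y} a" if "0 < x" "x < y" "y < 1" for x y
      unfolding a_def[abs_def] by (rule si[OF has_radial_densityD(1)[OF ku] that(1,2)])
    show "set_integrable lborel {x..y} d" if "0 < x" "x < y" "y < 1" for x y
      unfolding d_def[abs_def] by (rule si[OF has_radial_densityD(1)[OF k] that(1,2)])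
    fix x y :: real and \<zeta> assume xy: "0 < x" "x < y" "y < 1" and \<zeta>: "\<zeta> \<in> smooth_supp x y"
    have m: "(\<lambda>s. \<xi> s * s powr (1 - ?n)) \<in> borel_measurable borel"
      and i: "integrable lebesgue f \<Longrightarrow> integrable lebesgue (\<lambda>x. (\<xi> (norm x) * norm x powr (1 - ?n)) * f x)"
      if \<xi>: "\<xi> \<in> smooth_supp x y" for \<xi> and f :: "'a \<Rightarrow> real"
    proof -
      show "(\<lambda>s. \<xi> s * s powr (1 - ?n)) \<in> borel_measurable borel" using smooth_suppD(4)[OF \<xi>] by measurable
      obtain L where L: "\<forall>x::'a. \<bar>\<xi> (norm x) * norm x powr (1 - ?n)\<bar> \<le> L" using radial_field_bounded(1)[OF \<xi> xy(1)] by blast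
      assume f: "integrable lebesgue f"
      have "integrable lebesgue (\<lambda>x. f x * (\<xi> (norm x) * norm x powr (1 - ?n)))"
        by (rule integrable_mult_bounded[OF f radial_field_bounded(2)[OF \<xi> xy(1)]]) (use L in blast)
      then show "integrable lebesgue (\<lambda>x. (\<xi> (norm x) * norm x powr (1 - ?n)) * f x)" by (simp add: mult.commute)
    qed
    have "(LINT s|lborel. (deriv \<zeta> s * s powr (1 - ?n)) * ku s) = - (LINT s|lborel. (\<zeta> s * s powr (1 - ?n)) * k s)"
      using weak_gradient_radial_identity[OF wg u U \<zeta> xy(1,3)]
        has_radial_densityD(4)[OF ku m[OF smooth_supp_deriv[OF \<zeta>]] i[OF smooth_supp_deriv[OF \<zeta>] f]]
        has_radial_densityD(4)[OF k m[OF \<zeta>] i[OF \<zeta> F]]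
      by (simp add: f_def[symmetric] F_def[symmetric])
    moreover have "(LINT s|lborel. a s * deriv \<zeta> s) = (LINT s|lborel. (deriv \<zeta> s * s powr (1 - ?n)) * ku s) / c"
      unfolding a_def by (simp add: mult_ac flip: Bochner_Integration.integral_divide_zero)
    moreover have "(LINT s|lborel. d s * \<zeta> s) = (LINT s|lborel. (\<zeta> s * s powr (1 - ?n)) * k s) / c"
      unfolding d_def by (simp add: mult_ac flip: Bochner_Integration.integral_divide_zero)
    ultimately show "(LINT s|lborel. a s * deriv \<zeta> s) = - (LINT s|lborel. d s * \<zeta> s)" by simp
  qed
  then obtain W where W: "\<And>x y. 0 < x \<Longrightarrow> x \<le> y \<Longrightarrow> y < 1 \<Longrightarrow> W y - W x = (LINT s:{x..y}|lborel. d s)"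
    and aW: "AE s in lborel. s \<in> {0<..<1} \<longrightarrow> a s = W s" by blast
  have "AE x in lebesgue. x \<in> ?B \<longrightarrow> u x = \<rho> (norm x)"
    using rad by (subst (asm) AE_restrict_space_iff) auto
  then have "AE x in lebesgue. x \<in> ?B \<longrightarrow> f x = \<rho> (norm x)" by eventually_elim (simp add: f_def)
  note fk = radial_eq_density[OF f this ku]
  have "AE s in lborel. 0 < s \<longrightarrow> (s < 1 \<longrightarrow> ku s / polar_density DIM('a) s = W s)"
    using aW
  proof eventually_elim
    case (elim s)
    show ?case
    proof (intro impI)
      assume s: "0 < s" "s < 1"
      have "polar_density DIM('a) s = c * s powr (?n - 1)"
        using s polar_density_eq_powr[of "DIM('a)" s] by (simp add: c_def)
      moreover have "s powr (1 - ?n) = 1 / s powr (?n - 1)"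
        using s powr_minus_divide[of s "?n - 1"] by simp
      ultimately have "ku s / polar_density DIM('a) s = a s" by (simp add: a_def)
      then show "ku s / polar_density DIM('a) s = W s" using elim s by simp
    qed
  qed
  from AE_radial[OF this, where 'a='a]
  have "AE x::'a in lebesgue. norm x < 1 \<longrightarrow> ku (norm x) / polar_density DIM('a) (norm x) = W (norm x)" .
  with fk have uW: "AE x in lebesgue. x \<in> ?B \<longrightarrow> u x = W (norm x)"
    by eventually_elim (auto simp: f_def)
  have dm: "d \<in> borel_measurable borel" unfolding d_def[abs_def] using km by measurable
  have sd: "set_integrable lborel {x..y} d" if "0 < x" "x < y" "y < 1" for x y
    unfolding d_def[abs_def] by (rule si[OF has_radial_densityD(1)[OF k] that(1,2)])
  show ?thesis
  proof (rule exI[of _ W], rule exI[of _ d], intro conjI allI impI)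
    show "set_integrable lborel {x..y} d" if "0 < x" "x < y" "y < 1" for x y by (rule sd[OF that])
    show "W y - W x = (LINT s:{x..y}|lborel. d s)" if "0 < x" "x \<le> y" "y < 1" for x y by (rule W[OF that])
  qed (fact dm uW)+
qed

lemma integrable_lebesgue_on_subset:
  fixes f :: "'a::euclidean_space \<Rightarrow> 'b::{banach, second_countable_topology}"
  assumes "integrable (lebesgue_on S) f" "S \<in> sets lebesgue" "T \<in> sets lebesgue" "T \<subseteq> S"
  shows "integrable (lebesgue_on T) f"
proof -
  have "set_integrable lebesgue S f" using assms(1) integral_lebesgue_on(2)[OF assms(2), of f] by (simp add: set_integrable_def)
  then have "set_integrable lebesgue T f" by (rule set_integrable_subset[OF _ assms(3,4)])
  then show ?thesis using integral_lebesgue_on(2)[OF assms(3), of f] by (simp add: set_integrable_def)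
qed

section \<open>Measurability and bounds for primitives\<close>

lemma tail_measurable:
  assumes [measurable]: "f \<in> borel_measurable borel"
  shows "tail f \<in> borel_measurable borel"
proof -
  have "tail f = (\<lambda>s. LINT t|lborel. (if s \<le> t then f t else 0))"
    unfolding tail_def[abs_def] by (intro ext Bochner_Integration.integral_cong) (auto simp: indicator_def)
  also have "\<dots> \<in> borel_measurable borel" by measurable
  finally show ?thesis .
qed

lemma tail_bounded:
  assumes "integrable lborel f"
  shows "\<bar>tail f s\<bar> \<le> (LINT t|lborel. \<bar>f t\<bar>)"
proof -
  have i: "integrable lborel (\<lambda>t. indicator {s..} t * f t)"
    using integrable_mult_indicator[OF _ assms, of "{s..}"] by simp
  have "\<bar>tail f s\<bar> \<le> (LINT t|lborel. \<bar>indicator {s..} t * f t\<bar>)"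
    unfolding tail_def by (rule integral_abs_bound)
  also have "\<dots> \<le> (LINT t|lborel. \<bar>f t\<bar>)"
    by (rule integral_mono[OF integrable_abs[OF i] integrable_abs[OF assms]]) (auto simp: indicator_def)
  finally show ?thesis .
qed

lemma head_measurable:
  fixes f :: "real \<Rightarrow> real"
  assumes [measurable]: "f \<in> borel_measurable borel"
  shows "(\<lambda>t. LINT s|lborel. indicator {..t} s * f s) \<in> borel_measurable borel"
proof -
  have "(\<lambda>t. LINT s|lborel. indicator {..t} s * f s) = (\<lambda>t. LINT s|lborel. (if s \<le> t then f s else 0))"
    by (intro ext Bochner_Integration.integral_cong) (auto simp: indicator_def)
  also have "\<dots> \<in> borel_measurable borel" by measurable
  finally show ?thesis .
qed

lemma head_bounded:
  fixes f :: "real \<Rightarrow> real"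
  assumes "integrable lborel f"
  shows "\<bar>LINT s|lborel. indicator {..t} s * f s\<bar> \<le> (LINT t|lborel. \<bar>f t\<bar>)"
proof -
  have i: "integrable lborel (\<lambda>s. indicator {..t} s * f s)"
    using integrable_mult_indicator[OF _ assms, of "{..t}"] by simp
  have "\<bar>LINT s|lborel. indicator {..t} s * f s\<bar> \<le> (LINT s|lborel. \<bar>indicator {..t} s * f s\<bar>)"
    by (rule integral_abs_bound)
  also have "\<dots> \<le> (LINT t|lborel. \<bar>f t\<bar>)"
    by (rule integral_mono[OF integrable_abs[OF i] integrable_abs[OF assms]]) (auto simp: indicator_def)
  finally show ?thesis .
qed

lemma sgn_measurable_lebesgue: "(\<lambda>x::'a::euclidean_space. sgn x \<bullet> i) \<in> borel_measurable lebesgue"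
proof -
  have "(\<lambda>x::'a. sgn x \<bullet> i) \<in> borel_measurable borel" unfolding sgn_div_norm by measurable
  then show ?thesis by (intro measurable_completion) simp
qed

lemma abs_sgn_inner_le: "i \<in> Basis \<Longrightarrow> \<bar>sgn x \<bullet> i\<bar> \<le> 1"
  using Basis_le_norm[of i "sgn x"] by (auto simp: norm_sgn split: if_splits)

lemma radial_integrable_shell:
  fixes d :: "real \<Rightarrow> real"
  assumes d: "set_integrable lborel {a..b} d" and ab: "0 < a" "b < 1"
  shows "integrable lebesgue (\<lambda>x::'a::euclidean_space. indicator {a..b} (norm x) * d (norm x))"
proof -
  define d1 where "d1 s = indicator {a..b} s * d s" for s
  have d1: "integrable lborel d1" using d by (simp add: d1_def[abs_def] set_integrable_def)
  have "integrable lborel (\<lambda>s. d1 s * (indicator {a..b} s * polar_density DIM('a) s))"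
  proof (rule integrable_mult_bounded[OF d1])
    show "(\<lambda>s. indicator {a..b} s * polar_density DIM('a) s) \<in> borel_measurable lborel" by measurable
    fix s
    show "\<bar>indicator {a..b} s * polar_density DIM('a) s\<bar> \<le> unit_ball_vol (real DIM('a)) * real DIM('a)"
    proof (cases "s \<in> {a..b}")
      case True
      then have "0 < s" "s ^ (DIM('a) - 1) \<le> 1" using ab by (auto intro: power_le_one)
      then show ?thesis by (auto simp: polar_density_def indicator_def abs_mult intro!: mult_left_mono mult_left_le)
    qed simp
  qed
  also have "(\<lambda>s. d1 s * (indicator {a..b} s * polar_density DIM('a) s)) = (\<lambda>s. polar_density DIM('a) s * d1 s)"
    by (auto simp: d1_def indicator_def)
  finally have "integrable lborel (\<lambda>s. polar_density DIM('a) s * d1 s)" .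
  moreover have "d1 \<in> borel_measurable borel" using borel_measurable_integrable[OF d1] by simp
  ultimately have "integrable lebesgue (\<lambda>x::'a. d1 (norm x))" using radial_integral(1)[of d1, where 'a='a] by blast
  then show ?thesis by (simp add: d1_def)
qed

text \<open>The profile controls only the component of U along x; here U is shown to have no other
  component. Both fields are tested on the punctured ball, where a test function lives in a shell
  that avoids the singularities of d and sgn. Each pairing is reduced to the same one-dimensional
  integral of d.\<close>

lemma radial_weak_gradient:
  fixes u :: "'a::euclidean_space \<Rightarrow> real"
  assumes wg: "has_weak_gradient (ball 0 1) u U"
    and U: "integrable (lebesgue_on (ball 0 1)) U"
    and d: "\<And>x y. 0 < x \<Longrightarrow> x < y \<Longrightarrow> y < 1 \<Longrightarrow> set_integrable lborel {x..y} d"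
    and dm: "d \<in> borel_measurable borel"
    and W: "\<And>x y. 0 < x \<Longrightarrow> x \<le> y \<Longrightarrow> y < 1 \<Longrightarrow> W y - W x = (LINT s:{x..y}|lborel. d s)"
    and uW: "AE x in lebesgue. x \<in> ball 0 1 \<longrightarrow> u x = W (norm x)"
  shows "AE x in lebesgue. x \<in> ball 0 1 \<longrightarrow> U x = d (norm x) *\<^sub>R sgn x"
proof -
  let ?B = "ball 0 1 :: 'a set" and ?P = "ball 0 1 - {0} :: 'a set"
  have P: "open ?P" "?P \<in> sets lebesgue" by (auto intro: open_delete)
  have B: "?B \<in> sets lebesgue" by simp
  have shell: "\<exists>a b. 0 < a \<and> a < b \<and> b < 1 \<and> (\<forall>x\<in>K. norm x \<in> {a..b})" if K: "compact K" "K \<subseteq> ?P" for K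
  proof -
    have "compact (norm ` K)" by (intro compact_continuous_image K continuous_intros)
    moreover have "norm ` K \<subseteq> {0<..<1}" using K(2) by auto
    ultimately show ?thesis using compact_subset_unit_interval[of "norm ` K"] by (auto simp: image_subset_iff)
  qed
  have comp: "AE x in lebesgue_on ?P. U x \<bullet> i - d (norm x) * (sgn x \<bullet> i) = 0" if i: "i \<in> Basis" for i
  proof (rule fundamental_lemma[OF P(1)])
    have Hd: "integrable lebesgue (\<lambda>x::'a. indicator {a..b} (norm x) * d (norm x) * (sgn x \<bullet> i))"
      if "0 < a" "a < b" "b < 1" for a b
      by (rule integrable_mult_bounded[OF radial_integrable_shell[OF d[OF that] that(1,3)] sgn_measurable_lebesgue])
        (rule abs_sgn_inner_le[OF i])
    have lU: "locally_integrable ?P (\<lambda>x. U x \<bullet> i)"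
      unfolding locally_integrable_def
    proof (intro allI impI)
      fix K :: "'a set" assume K: "compact K \<and> K \<subseteq> ?P"
      have "integrable (lebesgue_on K) U"
        by (rule integrable_lebesgue_on_subset[OF U B]) (use K in \<open>auto simp: compact_imp_closed\<close>)
      then show "integrable (lebesgue_on K) (\<lambda>x. U x \<bullet> i)" by simp
    qed
    have ld: "locally_integrable ?P (\<lambda>x. d (norm x) * (sgn x \<bullet> i))"
      unfolding locally_integrable_def
    proof (intro allI impI)
      fix K :: "'a set" assume K: "compact K \<and> K \<subseteq> ?P"
      then obtain a b where ab: "0 < a" "a < b" "b < 1" and Kab: "\<forall>x\<in>K. norm x \<in> {a..b}" using shell by blast
      have Ks: "K \<in> sets lebesgue" using K by (simp add: compact_imp_closed)
      have "integrable lebesgue (\<lambda>x. indicator K x *\<^sub>R (indicator {a..b} (norm x) * d (norm x) * (sgn x \<bullet> i)))"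
        by (rule integrable_mult_indicator[OF Ks Hd[OF ab]])
      also have "(\<lambda>x. indicator K x *\<^sub>R (indicator {a..b} (norm x) * d (norm x) * (sgn x \<bullet> i)))
          = (\<lambda>x. indicator K x *\<^sub>R (d (norm x) * (sgn x \<bullet> i)))"
      proof
        fix x show "indicator K x *\<^sub>R (indicator {a..b} (norm x) * d (norm x) * (sgn x \<bullet> i))
            = indicator K x *\<^sub>R (d (norm x) * (sgn x \<bullet> i))"
          using Kab by (cases "x \<in> K") auto
      qed
      finally show "integrable (lebesgue_on K) (\<lambda>x. d (norm x) * (sgn x \<bullet> i))"
        using integral_lebesgue_on(2)[OF Ks] by blast
    qed
    show "locally_integrable ?P (\<lambda>x. U x \<bullet> i - d (norm x) * (sgn x \<bullet> i))" by (rule locally_integrable_diff[OF lU ld])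
    fix \<phi> :: "'a \<Rightarrow> real" assume \<phi>: "\<phi> \<in> test_functions ?P"
    define S where "S = closure {x. \<phi> x \<noteq> 0}"
    note S = test_functionsD(1-3)[OF \<phi>, folded S_def] and C = test_functionsD(4)[OF \<phi>]
    obtain a b where ab: "0 < a" "a < b" "b < 1" and Sab: "\<forall>x\<in>S. norm x \<in> {a..b}" using shell[OF S(1,2)] by blast
    have \<phi>B: "\<phi> \<in> test_functions ?B"
    proof (rule test_functionsI[OF C S(1)])
      show "S \<subseteq> ?B" using S(2) by blast
    qed (rule S(3))
    have \<phi>c: "continuous_on UNIV \<phi>" by (rule C_k_continuous[OF C[of 0]])
    have \<phi>m: "\<phi> \<in> borel_measurable lebesgue"
      using borel_measurable_continuous_onI[OF \<phi>c] by (intro measurable_completion) simp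
    obtain L where L: "\<And>x. norm (\<phi> x) \<le> L" using compact_support_bounded[OF \<phi>c S(1,3)] by blast
    define \<psi> where "\<psi> x = frechet_derivative \<phi> (at x) i" for x
    have \<psi>c: "continuous_on UNIV \<psi>" unfolding \<psi>_def[abs_def] by (rule grad_continuous(2)[OF C[of 1] i])
    have \<psi>0: "\<psi> x = 0" if "x \<notin> S" for x
      unfolding \<psi>_def using frechet_derivative_outside[OF compact_imp_closed[OF S(1)] S(3) that] by simp
    have leb: "integrable lebesgue f \<longleftrightarrow> integrable lborel f" "(LINT x|lebesgue. f x) = (LINT x|lborel. f x)"
      if "f \<in> borel_measurable borel" for f :: "'a \<Rightarrow> real"
      using that by (auto simp: integrable_completion integral_completion)
    have \<psi>b: "\<psi> \<in> borel_measurable borel" by (rule borel_measurable_continuous_onI[OF \<psi>c])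
    have \<psi>i: "integrable lebesgue \<psi>" using integrable_compact_support[OF \<psi>c S(1) \<psi>0] leb(1)[OF \<psi>b] by blast
    have \<psi>I: "(LINT x|lebesgue. \<psi> x) = 0"
      using integral_directional_derivative(2)[OF C_k_has_derivative[OF C[of "Suc 0"]] \<psi>c[unfolded \<psi>_def[abs_def]] S(1,3)]
        leb(2)[OF \<psi>b] by (simp add: \<psi>_def)
    have \<phi>i: "integrable lebesgue \<phi>"
      using integrable_compact_support[OF \<phi>c S(1,3)] leb(1)[OF borel_measurable_continuous_onI[OF \<phi>c]] by blast
    define \<theta> where "\<theta> x = \<phi> x * (sgn x \<bullet> i)" for x
    have \<theta>i: "integrable lebesgue \<theta>"
      unfolding \<theta>_def[abs_def] by (rule integrable_mult_bounded[OF \<phi>i sgn_measurable_lebesgue abs_sgn_inner_le[OF i]])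
    \<comment> \<open>p and e are the radial densities of the partial derivative of \<phi> and of
      \<phi> times the i-th component of sgn x. The link between them is that e is a primitive of
      p.\<close>
    obtain p where p: "has_radial_density \<psi> p" by (rule radial_density_exists[OF \<psi>i])
    obtain e where e: "has_radial_density \<theta> e" by (rule radial_density_exists[OF \<theta>i])
    note pi = has_radial_densityD(1,2)[OF p] and ei = has_radial_densityD(1,2)[OF e]
    define d1 where "d1 s = indicator {a..b} s * d s" for s
    define p1 where "p1 s = indicator {a..b} s * p s" for s
    have d1: "integrable lborel d1" using d[OF ab] by (simp add: d1_def[abs_def] set_integrable_def)
    have d1b: "d1 \<in> borel_measurable borel" using borel_measurable_integrable[OF d1] by simp
    have p1: "integrable lborel p1"
      using integrable_mult_indicator[OF _ pi(1), of "{a..b}"] by (simp add: p1_def[abs_def])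
    have p1b: "p1 \<in> borel_measurable borel" using borel_measurable_integrable[OF p1] by simp
    have shell_ind: "indicator {a..b} (norm x) * f x = f x" if "x \<notin> S \<Longrightarrow> f x = 0" for f :: "'a \<Rightarrow> real" and x
      using that Sab by (cases "x \<in> S") auto
    have Im: "(indicator {a..b} :: real \<Rightarrow> real) \<in> borel_measurable borel" by simp
    have Ab: "{a..b} \<in> sets (borel :: real measure)" by simp
    \<comment> \<open>The integral of a partial derivative vanishes; this later removes the constant
      W b.\<close>
    have p1I: "(LINT s|lborel. p1 s) = 0"
      using has_radial_densityD(4)[OF p Im indicator_norm_mult_integrable[OF \<psi>i Ab]] \<psi>I shell_ind[of _ \<psi>, OF \<psi>0]
      by (simp add: p1_def)
    define \<Phi> where "\<Phi> t = (LINT s|lborel. indicator {..t} s * p1 s)" for t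
    have \<Phi>m: "\<Phi> \<in> borel_measurable borel" unfolding \<Phi>_def[abs_def] by (rule head_measurable[OF p1b])
    have \<Phi>b: "\<bar>\<Phi> t\<bar> \<le> (LINT t|lborel. \<bar>p1 t\<bar>)" for t unfolding \<Phi>_def by (rule head_bounded[OF p1])

    have step1: "(LINT x|lebesgue_on ?P. (U x \<bullet> i) * \<phi> x) = (LINT t|lborel. d1 t * \<Phi> t)"
    proof -
      \<comment> \<open>A bounded Borel function on the whole line that equals W on [a,b]; the
        density property of p can be applied to it.\<close>
      define \<beta> where "\<beta> s = indicator {a..b} s * (W b - tail d1 s)" for s
      have \<beta>m: "\<beta> \<in> borel_measurable borel"
        unfolding \<beta>_def[abs_def] using tail_measurable[OF d1b] by measurable
      have \<beta>b: "\<bar>\<beta> s\<bar> \<le> \<bar>W b\<bar> + (LINT t|lborel. \<bar>d1 t\<bar>)" for s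
      proof -
        have "\<bar>\<beta> s\<bar> \<le> \<bar>W b - tail d1 s\<bar>" by (auto simp: \<beta>_def indicator_def)
        also have "\<dots> \<le> \<bar>W b\<bar> + \<bar>tail d1 s\<bar>" by (rule abs_triangle_ineq4)
        finally show ?thesis using tail_bounded[OF d1, of s] by linarith
      qed
      have \<beta>W: "\<beta> s = W s" if "s \<in> {a..b}" for s
      proof -
        have "(\<lambda>t. indicator {s..} t * d1 t) = (\<lambda>t. indicator {s..b} t *\<^sub>R d t)"
          using that by (auto simp: d1_def indicator_def)
        then have "tail d1 s = W b - W s"
          using W[of s b] that ab by (simp add: tail_def set_lebesgue_integral_def)
        then show ?thesis using that by (simp add: \<beta>_def)
      qed
      have \<beta>\<psi>: "integrable lebesgue (\<lambda>x. \<beta> (norm x) * \<psi> x)"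
        using integrable_mult_bounded[OF \<psi>i measurable_norm_compose[OF \<beta>m] \<beta>b] by (simp add: mult.commute)
      have \<phi>00: "indicator ?P x *\<^sub>R ((U x \<bullet> i) * \<phi> x) = indicator ?B x *\<^sub>R ((U x \<bullet> i) * \<phi> x)" for x
      proof (cases "x \<in> S")
        case True
        then have "x \<in> ?P" "x \<in> ?B" using S(2) by blast+
        then show ?thesis by simp
      qed (simp add: S(3))
      have "(LINT x|lebesgue_on ?P. (U x \<bullet> i) * \<phi> x) = (LINT x|lebesgue_on ?B. (U x \<bullet> i) * \<phi> x)"
        unfolding integral_lebesgue_on(1)[OF P(2)] integral_lebesgue_on(1)[OF B] \<phi>00 ..
      also have "\<dots> = - (LINT x|lebesgue_on ?B. u x * \<psi> x)"
        using wg \<phi>B i unfolding has_weak_gradient_def \<psi>_def by simp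
      also have "(LINT x|lebesgue_on ?B. u x * \<psi> x) = (LINT x|lebesgue. indicator ?B x *\<^sub>R (u x * \<psi> x))"
        by (rule integral_lebesgue_on(1)[OF B])
      also have "\<dots> = (LINT x|lebesgue. \<beta> (norm x) * \<psi> x)"
      proof (rule integral_cong_AE)
        have um: "(\<lambda>x. u x * \<psi> x) \<in> borel_measurable (lebesgue_on ?B)"
          using wg continuous_measurable_lebesgue_on[OF \<psi>c] by (intro borel_measurable_times) (auto simp: has_weak_gradient_def)
        then show "(\<lambda>x. indicator ?B x *\<^sub>R (u x * \<psi> x)) \<in> borel_measurable lebesgue"
          using borel_measurable_restrict_space_iff[of ?B lebesgue "\<lambda>x. u x * \<psi> x"] by simp
        show "(\<lambda>x. \<beta> (norm x) * \<psi> x) \<in> borel_measurable lebesgue" by (rule borel_measurable_integrable[OF \<beta>\<psi>])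
        show "AE x in lebesgue. indicator ?B x *\<^sub>R (u x * \<psi> x) = \<beta> (norm x) * \<psi> x"
          using uW
        proof eventually_elim
          case (elim x)
          show ?case
          proof (cases "x \<in> S")
            case True
            then have "x \<in> ?B" using S(2) by blast
            then show ?thesis using elim \<beta>W[of "norm x"] Sab True by simp
          qed (simp add: \<psi>0)
        qed
      qed
      also have "\<dots> = (LINT s|lborel. \<beta> s * p s)" by (rule has_radial_densityD(4)[OF p \<beta>m \<beta>\<psi>])
      also have "\<dots> = (LINT s|lborel. p1 s * W b - p1 s * tail d1 s)"
        by (rule Bochner_Integration.integral_cong[OF refl]) (simp add: \<beta>_def p1_def algebra_simps)
      also have "\<dots> = (LINT s|lborel. p1 s * W b) - (LINT s|lborel. p1 s * tail d1 s)"
        by (intro Bochner_Integration.integral_diff integrable_mult_left p1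
            integrable_mult_bounded[OF p1 _ tail_bounded[OF d1]]) (use tail_measurable[OF d1b] in simp)
      also have "\<dots> = - (LINT t|lborel. d1 t * \<Phi> t)"
        using p1I Fubini_tail(1)[OF p1 d1] by (simp add: \<Phi>_def)
      finally show ?thesis by simp
    qed

    \<comment> \<open>Integration by parts against \<open>tail \<xi>\<close> of the norm: its i-th
      derivative is -\<xi>(|x|) times the i-th component of sgn x, so tail \<xi> paired with p
      equals \<xi> paired with e.\<close>
    have e\<Phi>: "AE s in lborel. s \<in> {0<..<1} \<longrightarrow> e s - \<Phi> s = 0"
    proof (rule fundamental_lemma_unit_interval)
      fix x y :: real assume xy: "0 < x" "x < y" "y < 1"
      have 1: "set_integrable lborel {x..y} e"
        unfolding set_integrable_def by (rule integrable_mult_indicator[OF _ ei(1)]) simp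
      have "integrable lborel (indicator {x..y} :: real \<Rightarrow> real)"
        using xy by (intro integrable_real_indicator) simp_all
      from integrable_mult_bounded[OF this _ \<Phi>b] have 2: "set_integrable lborel {x..y} \<Phi>"
        using \<Phi>m by (simp add: set_integrable_def)
      show "set_integrable lborel {x..y} (\<lambda>s. e s - \<Phi> s)" by (rule set_integral_diff(1)[OF 1 2])
      fix \<xi> assume \<xi>: "\<xi> \<in> smooth_supp x y"
      obtain L' where L': "\<And>t. norm (\<xi> t) \<le> L'"
        using compact_support_bounded[OF smooth_suppD(3)[OF \<xi>] compact_Icc smooth_suppD(2)[OF \<xi>]] by blast
      have \<xi>m: "\<xi> \<in> borel_measurable borel" by (rule smooth_suppD(4)[OF \<xi>])
      have \<xi>i: "integrable lborel \<xi>" by (rule smooth_supp_integrable[OF \<xi>])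
      have tm: "tail \<xi> \<in> borel_measurable borel" by (rule tail_measurable[OF \<xi>m])
      have i\<theta>: "integrable lebesgue (\<lambda>x. \<xi> (norm x) * \<theta> x)"
        using integrable_mult_bounded[OF \<theta>i measurable_norm_compose[OF \<xi>m], of L'] L' by (simp add: mult.commute)
      have "integrable lebesgue (\<lambda>x. \<psi> x * tail \<xi> (norm x))"
        by (rule integrable_mult_bounded[OF \<psi>i measurable_norm_compose[OF tm] tail_bounded[OF \<xi>i]])
      then have i\<psi>': "integrable lebesgue (\<lambda>x. tail \<xi> (norm x) * \<psi> x)" by (simp add: mult.commute)
      have i\<psi>: "integrable lebesgue (\<lambda>x. indicator {a..b} (norm x) * tail \<xi> (norm x) * \<psi> x)"
        using indicator_norm_mult_integrable[OF i\<psi>' Ab] by (simp add: mult.assoc)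
      have itm: "(\<lambda>s. indicator {a..b} s * tail \<xi> s) \<in> borel_measurable borel" using tm by measurable
      have "(LINT t|lborel. \<xi> t * \<Phi> t) = (LINT s|lborel. p1 s * tail \<xi> s)"
        unfolding \<Phi>_def by (rule Fubini_tail(1)[OF p1 \<xi>i, symmetric])
      also have "\<dots> = (LINT s|lborel. (indicator {a..b} s * tail \<xi> s) * p s)"
        by (simp add: p1_def mult_ac)
      also have "\<dots> = (LINT x|lebesgue. indicator {a..b} (norm x) * tail \<xi> (norm x) * \<psi> x)"
        by (rule has_radial_densityD(4)[OF p itm i\<psi>, symmetric])
      also have "\<dots> = (LINT x|lebesgue. \<psi> x * tail \<xi> (norm x))"
      proof (rule Bochner_Integration.integral_cong[OF refl])
        fix x show "indicator {a..b} (norm x) * tail \<xi> (norm x) * \<psi> x = \<psi> x * tail \<xi> (norm x)"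
          using Sab \<psi>0[of x] by (cases "x \<in> S") auto
      qed
      also have "\<dots> = (LINT x|lborel. \<psi> x * tail \<xi> (norm x))"
        by (rule leb(2), rule borel_measurable_times[OF \<psi>b], rule measurable_compose[OF _ tm]) simp
      also have "\<dots> = - (LINT x|lborel. \<phi> x * frechet_derivative (\<lambda>x. tail \<xi> (norm x)) (at x) i)"
        using integral_by_parts_test[OF C[of 1] radial_test_function(3)[OF \<xi> xy(1,3), of 1] S(1,3) i]
        by (simp add: \<psi>_def)
      also have "\<dots> = (LINT x|lborel. \<xi> (norm x) * \<theta> x)"
        unfolding frechet_tail_radial[OF \<xi> xy(1)] by (simp add: \<theta>_def mult_ac)
      also have "\<dots> = (LINT x|lebesgue. \<xi> (norm x) * \<theta> x)"
      proof (rule leb(2)[symmetric])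
        have "(\<lambda>x::'a. sgn x \<bullet> i) \<in> borel_measurable borel" unfolding sgn_div_norm by measurable
        then show "(\<lambda>x. \<xi> (norm x) * \<theta> x) \<in> borel_measurable borel"
          unfolding \<theta>_def using \<xi>m borel_measurable_continuous_onI[OF \<phi>c] by measurable
      qed
      also have "\<dots> = (LINT s|lborel. \<xi> s * e s)" by (rule has_radial_densityD(4)[OF e \<xi>m i\<theta>])
      finally have eq: "(LINT t|lborel. \<xi> t * \<Phi> t) = (LINT s|lborel. \<xi> s * e s)" .
      have j1: "integrable lborel (\<lambda>s. \<xi> s * e s)" by (rule has_radial_densityD(3)[OF e \<xi>m i\<theta>])
      have j2: "integrable lborel (\<lambda>s. \<xi> s * \<Phi> s)" by (rule integrable_mult_bounded[OF \<xi>i _ \<Phi>b]) (use \<Phi>m in simp)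
      show "(LINT s|lborel. (e s - \<Phi> s) * \<xi> s) = 0"
        using Bochner_Integration.integral_diff[OF j1 j2] eq by (simp add: algebra_simps)
    qed

    have i3: "integrable lebesgue (\<lambda>x. d1 (norm x) * \<theta> x)"
      using integrable_mult_bounded[OF Hd[OF ab] \<phi>m, of L] L by (simp add: d1_def \<theta>_def mult_ac)
    have step2: "(LINT x|lebesgue_on ?P. (d (norm x) * (sgn x \<bullet> i)) * \<phi> x) = (LINT t|lborel. d1 t * \<Phi> t)"
    proof -
      have "(LINT x|lebesgue_on ?P. (d (norm x) * (sgn x \<bullet> i)) * \<phi> x) = (LINT x|lebesgue. d1 (norm x) * \<theta> x)"
        unfolding integral_lebesgue_on(1)[OF P(2)]
      proof (rule Bochner_Integration.integral_cong[OF refl])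
        fix x show "indicator ?P x *\<^sub>R ((d (norm x) * (sgn x \<bullet> i)) * \<phi> x) = d1 (norm x) * \<theta> x"
        proof (cases "x \<in> S")
          case True
          then have "x \<in> ?P" using S(2) by blast
          then show ?thesis using Sab True by (simp add: d1_def \<theta>_def)
        qed (simp add: S(3) \<theta>_def)
      qed
      also have "\<dots> = (LINT s|lborel. d1 s * e s)" by (rule has_radial_densityD(4)[OF e d1b i3])
      also have "\<dots> = (LINT s|lborel. d1 s * \<Phi> s)"
      proof (rule integral_cong_AE)
        show "(\<lambda>s. d1 s * e s) \<in> borel_measurable lborel" "(\<lambda>s. d1 s * \<Phi> s) \<in> borel_measurable lborel"
          using d1b ei(2) \<Phi>m by simp_all
        show "AE s in lborel. d1 s * e s = d1 s * \<Phi> s"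
          using e\<Phi>
        proof eventually_elim
          case (elim s)
          then show ?case using ab by (cases "s \<in> {a..b}") (auto simp: d1_def)
        qed
      qed
      finally show ?thesis .
    qed
    show "(LINT x|lebesgue_on ?P. (U x \<bullet> i - d (norm x) * (sgn x \<bullet> i)) * \<phi> x) = 0"
      using Bochner_Integration.integral_diff[OF locally_integrable_mult_test[OF P(1) lU \<phi>] locally_integrable_mult_test[OF P(1) ld \<phi>]]
        step1 step2 by (simp add: left_diff_distrib)
  qed
  have "AE x in lebesgue_on ?P. \<forall>i\<in>Basis. U x \<bullet> i - d (norm x) * (sgn x \<bullet> i) = 0"
    using comp by (intro eventually_ball_finite) auto
  then have "AE x in lebesgue_on ?P. U x = d (norm x) *\<^sub>R sgn x"
  proof (rule eventually_mono)
    fix x assume eq: "\<forall>i\<in>Basis. U x \<bullet> i - d (norm x) * (sgn x \<bullet> i) = 0"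
    show "U x = d (norm x) *\<^sub>R sgn x"
    proof (rule euclidean_eqI)
      fix i :: 'a assume "i \<in> Basis"
      then have "U x \<bullet> i - d (norm x) * (sgn x \<bullet> i) = 0" using eq by blast
      then show "U x \<bullet> i = (d (norm x) *\<^sub>R sgn x) \<bullet> i" by simp
    qed
  qed
  then have 1: "AE x in lebesgue. x \<in> ?P \<longrightarrow> U x = d (norm x) *\<^sub>R sgn x"
    using P(2) by (subst (asm) AE_restrict_space_iff) auto
  \<comment> \<open>The puncture is a null set.\<close>
  have "AE x in lebesgue. x \<notin> {0::'a}" by (rule AE_not_in) (simp add: null_sets_def)
  with 1 show ?thesis by eventually_elim auto
qed

section \<open>The equation in radial form\<close>

text \<open>N-functions and their densities are monotone only on [0,\<infinity>). Extending them
  constantly to the left gives monotone, hence Borel, functions on the line.\<close>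

lemma mono_extension_measurable:
  fixes g :: "real \<Rightarrow> real"
  assumes "\<And>a b. 0 \<le> a \<Longrightarrow> a \<le> b \<Longrightarrow> g a \<le> g b"
  shows "(\<lambda>t. g (max 0 t)) \<in> borel_measurable borel"
  by (rule borel_measurable_mono) (auto intro!: monoI assms)

text \<open>Superlinearity gives |f| \<le> 1 + G |f| / G 1, and the constant is integrable on a
  bounded set.\<close>

lemma integrable_of_modular:
  fixes f :: "'a::euclidean_space \<Rightarrow> 'b::euclidean_space"
  assumes G: "N_function g G" and \<Omega>: "open \<Omega>" "bounded \<Omega>" and f: "f \<in> borel_measurable (lebesgue_on \<Omega>)"
    and fin: "(\<integral>\<^sup>+x. ennreal (G (norm (f x))) \<partial>lebesgue_on \<Omega>) < \<infinity>"
  shows "integrable (lebesgue_on \<Omega>) f" "integrable (lebesgue_on \<Omega>) (\<lambda>x. G (norm (f x)))"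
proof -
  have Gm: "(\<lambda>t. G (max 0 t)) \<in> borel_measurable borel"
    by (rule mono_extension_measurable) (rule N_function_le[OF G])
  have m: "(\<lambda>x. G (norm (f x))) \<in> borel_measurable (lebesgue_on \<Omega>)"
    using measurable_compose[OF measurable_compose[OF f borel_measurable_norm] Gm] by simp
  show i: "integrable (lebesgue_on \<Omega>) (\<lambda>x. G (norm (f x)))"
    by (rule integrableI_bounded[OF m]) (use fin N_function_value_nonneg[OF G] in simp)
  have G1: "G 1 > 0" using N_function_value_pos[OF G] by simp
  have "emeasure (lebesgue_on \<Omega>) (space (lebesgue_on \<Omega>)) < \<infinity>"
    using \<Omega> emeasure_bounded_finite[OF \<Omega>(2)] by (simp add: emeasure_restrict_space)
  then have c: "integrable (lebesgue_on \<Omega>) (\<lambda>x. 1 :: real)"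
    by (simp add: integrable_iff_bounded)
  show "integrable (lebesgue_on \<Omega>) f"
  proof (rule Bochner_Integration.integrable_bound[OF Bochner_Integration.integrable_add[OF c integrable_mult_right[OF i, of "1 / G 1"]] f], rule AE_I2)
    fix x
    have "norm (f x) \<le> 1 + 1 / G 1 * G (norm (f x))"
    proof (cases "norm (f x) \<le> 1")
      case True
      then show ?thesis using N_function_value_nonneg[OF G, of "norm (f x)"] G1 by (simp add: add_increasing2)
    next
      case False
      then have "norm (f x) * G 1 \<le> G (norm (f x))" using N_function_superlinear[OF G, of 1 "norm (f x)"] by simp
      then show ?thesis using G1 by (simp add: field_simps)
    qed
    then show "norm (f x) \<le> norm (1 + 1 / G 1 * G (norm (f x)))" by simp
  qed
qed

lemma profile_continuous:
  fixes d W :: "real \<Rightarrow> real"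
  assumes d: "\<And>x y. 0 < x \<Longrightarrow> x < y \<Longrightarrow> y < 1 \<Longrightarrow> set_integrable lborel {x..y} d"
    and W: "\<And>x y. 0 < x \<Longrightarrow> x \<le> y \<Longrightarrow> y < 1 \<Longrightarrow> W y - W x = (LINT s:{x..y}|lborel. d s)"
  shows "continuous_on {0<..<1} W"
proof (rule continuous_at_imp_continuous_on, rule ballI)
  fix t :: real assume t: "t \<in> {0<..<1}"
  define x y where "x = t / 2" and "y = (1 + t) / 2"
  have xy: "0 < x" "x < y" "y < 1" and txy: "t \<in> interior {x..y}" using t by (auto simp: x_def y_def)
  have si: "set_integrable lborel {x..s} d" if "s \<le> y" for s
    using that xy by (intro set_integrable_subset[OF d[OF xy]]) auto
  have "continuous_on {x..y} (\<lambda>t. W x + integral {x..t} d)"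
    using set_borel_integral_eq_integral(1)[OF si[of y]]
    by (intro continuous_intros indefinite_integral_continuous_1) auto
  then have "continuous_on {x..y} W"
  proof (rule continuous_on_eq)
    fix s assume s: "s \<in> {x..y}"
    then show "W x + integral {x..s} d = W s"
      using W[of x s] xy set_borel_integral_eq_integral(2)[OF si[of s]] by simp
  qed
  then show "isCont W t" using txy by (rule continuous_on_interior)
qed

text \<open>The test function is \<open>tail \<xi>\<close> of |x|, with gradient -\<xi>(|x|) sgn x.
  Both sides of the equation become integrals over (0,1), and \<open>Fubini_tail\<close> moves the
  primitive from \<xi> to the right-hand side, which leaves an identity tested with \<xi>
  itself.\<close>

lemma radial_flux:
  fixes u :: "'a::euclidean_space \<Rightarrow> real"
  assumes G: "N_function g G" and H: "N_function h H"
    and sol: "weak_solution (ball 0 1) \<alpha> g G h u"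
    and d: "\<And>x y. 0 < x \<Longrightarrow> x < y \<Longrightarrow> y < 1 \<Longrightarrow> set_integrable lborel {x..y} d"
    and dm: "d \<in> borel_measurable borel"
    and W: "\<And>x y. 0 < x \<Longrightarrow> x \<le> y \<Longrightarrow> y < 1 \<Longrightarrow> W y - W x = (LINT s:{x..y}|lborel. d s)"
    and uW: "AE x in lebesgue. x \<in> ball 0 1 \<longrightarrow> u x = W (norm x)"
    and Ud: "AE x in lebesgue. x \<in> ball 0 1 \<longrightarrow> weak_gradient (ball 0 1) u x = d (norm x) *\<^sub>R sgn x"
  defines "Q \<equiv> \<lambda>s. s powr (\<alpha> + real DIM('a) - 1) * h (max (W s) 0)"
  shows "\<And>r. 0 < r \<Longrightarrow> r < 1 \<Longrightarrow> set_integrable lborel {0<..<r} Q"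
    "AE t in lborel. t \<in> {0<..<1} \<longrightarrow>
       t powr (real DIM('a) - 1) * (sgn (d t) * g \<bar>d t\<bar>) = - (LINT s:{0<..<t}|lborel. Q s)"
proof -
  let ?n = "real DIM('a)" and ?B = "ball 0 1 :: 'a set"
  \<comment> \<open>Nothing is known about W outside (0,1); the cut-off makes the integrands Borel
    on the whole line.\<close>
  let ?I = "\<lambda>s. indicator {0<..<1} s :: real"
  define c where "c = unit_ball_vol ?n * ?n"
  have c: "c > 0" by (simp add: c_def)
  have B: "?B \<in> sets lebesgue" by simp
  define A where "A s = sgn (d s) * g \<bar>d s\<bar>" for s
  have gm: "(\<lambda>t. g (max 0 t)) \<in> borel_measurable borel"
    by (rule mono_extension_measurable) (rule N_function_mono[OF G])
  have hm: "(\<lambda>t. h (max 0 t)) \<in> borel_measurable borel"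
    by (rule mono_extension_measurable) (rule N_function_mono[OF H])
  have Am: "A \<in> borel_measurable borel"
  proof -
    have "(\<lambda>s. g (max 0 \<bar>d s\<bar>)) \<in> borel_measurable borel"
      by (rule measurable_compose[OF _ gm]) (use dm in measurable)
    moreover have "(\<lambda>s. sgn (d s)) \<in> borel_measurable borel" unfolding sgn_real_def using dm by measurable
    ultimately have "(\<lambda>s. sgn (d s) * g (max 0 \<bar>d s\<bar>)) \<in> borel_measurable borel"
      by (intro borel_measurable_times)
    then show ?thesis by (simp add: A_def[abs_def])
  qed
  have Wm: "(\<lambda>s. ?I s * W s) \<in> borel_measurable borel"
    using borel_measurable_continuous_on_indicator[OF _ profile_continuous[OF d W]] by simp
  have Q_eq: "?I s * Q s = ?I s * (s powr (\<alpha> + ?n - 1) * h (max 0 (?I s * W s)))" for s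
    by (simp add: Q_def max.commute indicator_def)
  have Qm: "(\<lambda>s. ?I s * Q s) \<in> borel_measurable borel"
  proof -
    have [measurable]: "(\<lambda>s. h (max 0 (?I s * W s))) \<in> borel_measurable borel"
      by (rule measurable_compose[OF Wm hm])
    show ?thesis unfolding Q_eq by measurable
  qed
  have pd: "polar_density DIM('a) s * (?I s * f) = c * (?I s * (s powr (?n - 1) * f))" for s f
    using polar_density_eq_powr[of "DIM('a)" s] by (cases "s \<in> {0<..<1}") (auto simp: c_def)
  have Bn: "AE x::'a in lebesgue. indicator ?B x = ?I (norm x)"
  proof -
    have "AE x in lebesgue. x \<notin> {0::'a}" by (rule AE_not_in) (simp add: null_sets_def)
    then show ?thesis by eventually_elim (auto simp: indicator_def)
  qed
  have main: "integrable lborel (\<lambda>s. ?I s * (s powr (?n - 1) * (\<xi> s * A s)))"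
      "integrable lborel (\<lambda>s. ?I s * Q s * tail \<xi> s)"
      "(LINT s|lborel. ?I s * (s powr (?n - 1) * (\<xi> s * A s))) = - (LINT s|lborel. ?I s * Q s * tail \<xi> s)"
    if xy: "0 < x" "x < y" "y < 1" and \<xi>: "\<xi> \<in> smooth_supp x y" for x y \<xi>
  proof -
    define v where "v x = tail \<xi> (norm x)" for x :: 'a
    have v: "v \<in> test_functions ?B" unfolding v_def[abs_def] by (rule radial_test_function(4)[OF \<xi> xy(1,3)])
    have v0: "v \<in> orlicz_sobolev_0 ?B G" by (rule test_function_orlicz_sobolev_0[OF G _ _ v]) auto
    have wgv: "AE x in lebesgue_on ?B. weak_gradient ?B v x = grad v x" by (rule weak_gradient_test(2)[OF _ v]) simp
    have gv: "grad v x = - \<xi> (norm x) *\<^sub>R sgn x" for x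
    proof (rule euclidean_eqI)
      fix b :: 'a assume b: "b \<in> Basis"
      show "grad v x \<bullet> b = (- \<xi> (norm x) *\<^sub>R sgn x) \<bullet> b"
        unfolding grad_inner[OF b] v_def[abs_def] frechet_tail_radial[OF \<xi> xy(1)] by simp
    qed
    define flux where "flux x = (g (norm (weak_gradient ?B u x)) / norm (weak_gradient ?B u x)) *\<^sub>R weak_gradient ?B u x" for x
    have eqs: "integrable (lebesgue_on ?B) (\<lambda>x. flux x \<bullet> weak_gradient ?B v x)"
      "integrable (lebesgue_on ?B) (\<lambda>x. norm x powr \<alpha> * h (max (u x) 0) * v x)"
      "(LINT x|lebesgue_on ?B. flux x \<bullet> weak_gradient ?B v x) = (LINT x|lebesgue_on ?B. norm x powr \<alpha> * h (max (u x) 0) * v x)"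
      using sol v0 unfolding weak_solution_def Let_def flux_def by blast+
    have wgv': "AE x in lebesgue. x \<in> ?B \<longrightarrow> weak_gradient ?B v x = grad v x"
      using wgv by (subst (asm) AE_restrict_space_iff) auto
    have n0: "AE x in lebesgue. x \<noteq> (0::'a)"
      using AE_not_in[of "{0::'a}" lebesgue] by (simp add: null_sets_def)
    have ae1: "AE x in lebesgue. indicator ?B x *\<^sub>R (flux x \<bullet> weak_gradient ?B v x) = - (?I (norm x) * (\<xi> (norm x) * A (norm x)))"
      using Ud wgv' Bn n0
    proof eventually_elim
      case (elim x)
      show ?case
      proof (cases "x \<in> ?B")
        case True
        have sg: "norm (sgn x) = 1" using elim(4) by (simp add: norm_sgn)
        have "flux x \<bullet> weak_gradient ?B v x = ((g \<bar>d (norm x)\<bar> / \<bar>d (norm x)\<bar>) *\<^sub>R (d (norm x) *\<^sub>R sgn x)) \<bullet> (- \<xi> (norm x) *\<^sub>R sgn x)"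
          using elim True by (simp add: flux_def gv sg)
        also have "\<dots> = - (\<xi> (norm x) * (g \<bar>d (norm x)\<bar> / \<bar>d (norm x)\<bar> * d (norm x))) * (sgn x \<bullet> sgn x)"
          by simp
        \<comment> \<open>At d = 0 both sides are 0 because division by 0 yields 0 and sgn 0 =
          0.\<close>
        also have "g \<bar>d (norm x)\<bar> / \<bar>d (norm x)\<bar> * d (norm x) = A (norm x)"
          by (auto simp: A_def sgn_real_def abs_if)
        also have "sgn x \<bullet> sgn x = 1" using sg by (simp add: dot_square_norm)
        finally show ?thesis using elim(3) True by simp
      next
        case False
        then show ?thesis using elim(3) by simp
      qed
    qed
    have ae2: "AE x in lebesgue. indicator ?B x *\<^sub>R (norm x powr \<alpha> * h (max (u x) 0) * v x)
        = ?I (norm x) * (norm x powr \<alpha> * h (max 0 (?I (norm x) * W (norm x))) * tail \<xi> (norm x))"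
      using uW Bn
    proof eventually_elim
      case (elim x)
      show ?case
      proof (cases "x \<in> ?B")
        case True
        then have "?I (norm x) = 1" using elim(2) by simp
        then show ?thesis using elim True by (simp add: v_def max.commute)
      next
        case False
        then show ?thesis using elim(2) by simp
      qed
    qed
    have \<xi>m: "\<xi> \<in> borel_measurable borel" by (rule smooth_suppD(4)[OF \<xi>])
    have tm: "tail \<xi> \<in> borel_measurable borel" by (rule tail_measurable[OF \<xi>m])
    have m1: "(\<lambda>s. ?I s * (\<xi> s * A s)) \<in> borel_measurable borel" using \<xi>m Am by measurable
    have [measurable]: "(\<lambda>s. h (max 0 (?I s * W s))) \<in> borel_measurable borel"
      by (rule measurable_compose[OF Wm hm])
    have m2: "(\<lambda>s. ?I s * (s powr \<alpha> * h (max 0 (?I s * W s)) * tail \<xi> s)) \<in> borel_measurable borel"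
      using tm by measurable
    note n1 = measurable_norm_compose[OF m1, where 'a='a] and n2 = measurable_norm_compose[OF m2, where 'a='a]
    have I1: "integrable lebesgue (\<lambda>x. indicator ?B x *\<^sub>R (flux x \<bullet> weak_gradient ?B v x))"
      using eqs(1) unfolding integral_lebesgue_on(2)[OF B] .
    have I2: "integrable lebesgue (\<lambda>x. indicator ?B x *\<^sub>R (norm x powr \<alpha> * h (max (u x) 0) * v x))"
      using eqs(2) unfolding integral_lebesgue_on(2)[OF B] .
    have "integrable lebesgue (\<lambda>x::'a. - (?I (norm x) * (\<xi> (norm x) * A (norm x))))"
      using integrable_cong_AE[OF borel_measurable_integrable[OF I1] _ ae1] n1 I1 by simp
    then have J1: "integrable lebesgue (\<lambda>x::'a. ?I (norm x) * (\<xi> (norm x) * A (norm x)))" by simp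
    have J2: "integrable lebesgue (\<lambda>x::'a. ?I (norm x) * (norm x powr \<alpha> * h (max 0 (?I (norm x) * W (norm x))) * tail \<xi> (norm x)))"
      using integrable_cong_AE[OF borel_measurable_integrable[OF I2] n2 ae2] I2 by simp
    have K1: "integrable lborel (\<lambda>s. c * (?I s * (s powr (?n - 1) * (\<xi> s * A s))))"
      by (rule radial_integral(1)[OF m1, where 'a='a, THEN iffD1, OF J1, unfolded pd])
    then show "integrable lborel (\<lambda>s. ?I s * (s powr (?n - 1) * (\<xi> s * A s)))"
      using c by simp
    have q: "?I s * (s powr (?n - 1) * (s powr \<alpha> * h (max 0 (?I s * W s)) * tail \<xi> s)) = ?I s * Q s * tail \<xi> s" for s
      unfolding Q_eq by (simp add: powr_add[symmetric] algebra_simps)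
    have K2: "integrable lborel (\<lambda>s. c * (?I s * Q s * tail \<xi> s))"
      by (rule radial_integral(1)[OF m2, where 'a='a, THEN iffD1, OF J2, unfolded pd q])
    then show "integrable lborel (\<lambda>s. ?I s * Q s * tail \<xi> s)" using c by simp
    have "(LINT x|lebesgue. indicator ?B x *\<^sub>R (flux x \<bullet> weak_gradient ?B v x)) = (LINT x::'a|lebesgue. - (?I (norm x) * (\<xi> (norm x) * A (norm x))))"
      by (rule integral_cong_AE[OF borel_measurable_integrable[OF I1] _ ae1]) (use n1 in simp)
    also have "\<dots> = - (LINT s|lborel. c * (?I s * (s powr (?n - 1) * (\<xi> s * A s))))"
      using radial_integral(2)[OF m1, where 'a='a] unfolding pd by simp
    finally have L1: "(LINT x|lebesgue_on ?B. flux x \<bullet> weak_gradient ?B v x) = - (LINT s|lborel. c * (?I s * (s powr (?n - 1) * (\<xi> s * A s))))"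
      unfolding integral_lebesgue_on(1)[OF B] .
    have "(LINT x|lebesgue. indicator ?B x *\<^sub>R (norm x powr \<alpha> * h (max (u x) 0) * v x))
        = (LINT x::'a|lebesgue. ?I (norm x) * (norm x powr \<alpha> * h (max 0 (?I (norm x) * W (norm x))) * tail \<xi> (norm x)))"
      by (rule integral_cong_AE[OF borel_measurable_integrable[OF I2] n2 ae2])
    also have "\<dots> = (LINT s|lborel. c * (?I s * Q s * tail \<xi> s))"
      using radial_integral(2)[OF m2, where 'a='a] unfolding pd q .
    finally have L2: "(LINT x|lebesgue_on ?B. norm x powr \<alpha> * h (max (u x) 0) * v x) = (LINT s|lborel. c * (?I s * Q s * tail \<xi> s))"
      unfolding integral_lebesgue_on(1)[OF B] .
    have "- (c * (LINT s|lborel. ?I s * (s powr (?n - 1) * (\<xi> s * A s)))) = c * (LINT s|lborel. ?I s * Q s * tail \<xi> s)"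
      using L1 L2 eqs(3) by simp
    then have "c * (LINT s|lborel. ?I s * (s powr (?n - 1) * (\<xi> s * A s))) = c * (- (LINT s|lborel. ?I s * Q s * tail \<xi> s))" by simp
    then show "(LINT s|lborel. ?I s * (s powr (?n - 1) * (\<xi> s * A s))) = - (LINT s|lborel. ?I s * Q s * tail \<xi> s)"
      using c by (simp only: mult_cancel_left) auto
  qed

  \<comment> \<open>A bump of mass 1 supported in [r,(1+r)/2] has primitive 1 on (0,r), so
    integrability up to r is read off from the integrability contained in the weak
    formulation.\<close>
  show Qi: "set_integrable lborel {0<..<r} Q" if r: "0 < r" "r < 1" for r
  proof -
    have "r < (1 + r) / 2" "(1 + r) / 2 < 1" using r by auto
    then obtain \<xi> where \<xi>: "\<xi> \<in> smooth_supp r ((1 + r) / 2)" "(LINT t|lborel. \<xi> t) = 1" using smooth_supp_bump[of r "(1 + r) / 2"] by blast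
    have i: "integrable lborel (\<lambda>s. ?I s * Q s * tail \<xi> s)" by (rule main(2)[OF _ _ _ \<xi>(1)]) (use r in auto)
    have "integrable lborel (\<lambda>s. indicator {0<..<r} s *\<^sub>R (?I s * Q s * tail \<xi> s))"
      by (rule integrable_mult_indicator[OF _ i]) simp
    also have "(\<lambda>s. indicator {0<..<r} s *\<^sub>R (?I s * Q s * tail \<xi> s)) = (\<lambda>s. indicator {0<..<r} s *\<^sub>R Q s)"
    proof
      fix s show "indicator {0<..<r} s *\<^sub>R (?I s * Q s * tail \<xi> s) = indicator {0<..<r} s *\<^sub>R Q s"
      proof (cases "s \<in> {0<..<r}")
        case True
        then have "tail \<xi> s = 1" using tail_le[OF \<xi>(1), of s] \<xi>(2) by simp
        then show ?thesis using True r by simp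
      qed simp
    qed
    finally show ?thesis by (simp add: set_integrable_def)
  qed

  define F where "F t = (LINT s:{0<..<t}|lborel. Q s)" for t
  have "AE t in lborel. t \<in> {0<..<1} \<longrightarrow> t powr (?n - 1) * A t + F t = 0"
  proof (rule fundamental_lemma_unit_interval)
    \<comment> \<open>Q is known to be integrable only up to radii below 1. For a given [x,y] it is
      cut off at a radius beyond y, which changes neither F on [x,y] nor products with the
      primitives in question.\<close>
    have Fy: "\<exists>Q1. integrable lborel Q1 \<and> (\<forall>t\<in>{x..y}. F t = (LINT s|lborel. indicator {..t} s * Q1 s)) \<and>
        (\<forall>\<xi>\<in>smooth_supp x y. \<forall>s. ?I s * Q s * tail \<xi> s = Q1 s * tail \<xi> s)"
      if xy: "0 < x" "x < y" "y < 1" for x y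
    proof (intro exI conjI ballI allI)
      define z where "z = (1 + y) / 2"
      have z: "0 < z" "z < 1" "y < z" using xy by (auto simp: z_def)
      let ?Q1 = "\<lambda>s. indicator {0<..<z} s * Q s"
      have Q1i: "integrable lborel ?Q1" using Qi[OF z(1,2)] by (simp add: set_integrable_def)
      then show "integrable lborel ?Q1" .
      show "F t = (LINT s|lborel. indicator {..t} s * ?Q1 s)" if t: "t \<in> {x..y}" for t
      proof -
        have "AE s in lborel. indicator {0<..<t} s *\<^sub>R Q s = indicator {..t} s * ?Q1 s"
          using AE_lborel_singleton[of t] by eventually_elim (use t z xy in \<open>auto simp: indicator_def\<close>)
        moreover have "(\<lambda>s. indicator {0<..<t} s *\<^sub>R Q s) \<in> borel_measurable lborel"
          using Qi[of t] t xy by (auto simp: set_integrable_def)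
        moreover have "(\<lambda>s. indicator {..t} s * ?Q1 s) \<in> borel_measurable lborel"
          by (rule borel_measurable_times[OF _ borel_measurable_integrable[OF Q1i]]) simp
        ultimately show ?thesis unfolding F_def set_lebesgue_integral_def by (intro integral_cong_AE)
      qed
      fix \<xi> s assume \<xi>: "\<xi> \<in> smooth_supp x y"
      show "?I s * Q s * tail \<xi> s = ?Q1 s * tail \<xi> s"
        using tail_ge[OF \<xi>, of s] z by (cases "s \<le> y") (auto simp: indicator_def)
    qed
    \<comment> \<open>The flux is integrable against every \<xi>; dividing by a \<xi> with a
      positive minimum on [x,y] gives local integrability of the flux itself.\<close>
    have si1: "set_integrable lborel {x..y} (\<lambda>t. t powr (?n - 1) * A t)" if xy: "0 < x" "x < y" "y < 1" for x y
    proof -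
      obtain \<xi> where \<xi>: "\<xi> \<in> smooth_supp (x / 2) ((1 + y) / 2)" and pos: "\<forall>t\<in>{x / 2<..<(1 + y) / 2}. 0 < \<xi> t"
        using smooth_supp_positive[of "x / 2" "(1 + y) / 2"] by blast
      have i: "integrable lborel (\<lambda>s. ?I s * (s powr (?n - 1) * (\<xi> s * A s)))"
        by (rule main(1)[OF _ _ _ \<xi>]) (use xy in auto)
      have "compact (\<xi> ` {x..y})" by (intro compact_continuous_image smooth_suppD(3)[OF \<xi>]) auto
      moreover have "\<xi> ` {x..y} \<noteq> {}" using xy by auto
      ultimately obtain l where l: "l \<in> \<xi> ` {x..y}" "\<forall>t\<in>\<xi> ` {x..y}. l \<le> t" using compact_attains_inf by blast
      have pos': "0 < \<xi> t" if "t \<in> {x..y}" for t using pos that xy by auto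
      have l0: "l > 0" using l(1) pos' by auto
      have "integrable lborel (\<lambda>s. ?I s * (s powr (?n - 1) * (\<xi> s * A s)) * (indicator {x..y} s / \<xi> s))"
      proof (rule integrable_mult_bounded[OF i])
        show "(\<lambda>s. indicator {x..y} s / \<xi> s) \<in> borel_measurable lborel" using smooth_suppD(4)[OF \<xi>] by measurable
        fix s show "\<bar>indicator {x..y} s / \<xi> s\<bar> \<le> 1 / l"
        proof (cases "s \<in> {x..y}")
          case True
          then have "l \<le> \<xi> s" using l(2) by blast
          then show ?thesis using True l0 by (simp add: frac_le)
        qed (use l0 in simp)
      qed
      also have "(\<lambda>s. ?I s * (s powr (?n - 1) * (\<xi> s * A s)) * (indicator {x..y} s / \<xi> s))
          = (\<lambda>s. indicator {x..y} s *\<^sub>R (s powr (?n - 1) * A s))"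
      proof
        fix s show "?I s * (s powr (?n - 1) * (\<xi> s * A s)) * (indicator {x..y} s / \<xi> s)
          = indicator {x..y} s *\<^sub>R (s powr (?n - 1) * A s)"
        proof (cases "s \<in> {x..y}")
          case True
          then show ?thesis using pos'[OF True] xy by simp
        qed simp
      qed
      finally show ?thesis by (simp add: set_integrable_def)
    qed
    have si2: "set_integrable lborel {x..y} F" if xy: "0 < x" "x < y" "y < 1" for x y
    proof -
      obtain Q1 where Q1: "integrable lborel Q1" "\<forall>t\<in>{x..y}. F t = (LINT s|lborel. indicator {..t} s * Q1 s)"
        using Fy[OF xy] by blast
      have "integrable lborel (indicator {x..y} :: real \<Rightarrow> real)"
        using xy by (intro integrable_real_indicator) simp_all
      from integrable_mult_bounded[OF this _ head_bounded[OF Q1(1)]]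
      have "integrable lborel (\<lambda>t. indicator {x..y} t * (LINT s|lborel. indicator {..t} s * Q1 s))"
        using head_measurable[of Q1] borel_measurable_integrable[OF Q1(1)] by simp
      also have "(\<lambda>t. indicator {x..y} t * (LINT s|lborel. indicator {..t} s * Q1 s)) = (\<lambda>t. indicator {x..y} t *\<^sub>R F t)"
        using Q1(2) by (auto simp: indicator_def)
      finally show ?thesis by (simp add: set_integrable_def)
    qed
    fix x y :: real assume xy: "0 < x" "x < y" "y < 1"
    show "set_integrable lborel {x..y} (\<lambda>t. t powr (?n - 1) * A t + F t)"
      by (rule set_integral_add(1)[OF si1[OF xy] si2[OF xy]])
    fix \<xi> assume \<xi>: "\<xi> \<in> smooth_supp x y"
    obtain Q1 where Q1: "integrable lborel Q1" "\<forall>t\<in>{x..y}. F t = (LINT s|lborel. indicator {..t} s * Q1 s)"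
      "\<forall>s. ?I s * Q s * tail \<xi> s = Q1 s * tail \<xi> s"
      using Fy[OF xy] \<xi> by blast
    have "(LINT s|lborel. ?I s * Q s * tail \<xi> s) = (LINT s|lborel. Q1 s * tail \<xi> s)"
      by (rule Bochner_Integration.integral_cong[OF refl]) (rule Q1(3)[rule_format])
    also have "\<dots> = (LINT t|lborel. \<xi> t * (LINT s|lborel. indicator {..t} s * Q1 s))"
      by (rule Fubini_tail(1)[OF Q1(1) smooth_supp_integrable[OF \<xi>]])
    also have "\<dots> = (LINT t|lborel. F t * \<xi> t)"
    proof (rule Bochner_Integration.integral_cong[OF refl])
      fix t show "\<xi> t * (LINT s|lborel. indicator {..t} s * Q1 s) = F t * \<xi> t"
        using Q1(2) smooth_suppD(2)[OF \<xi>, of t] by (cases "t \<in> {x..y}") auto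
    qed
    finally have 1: "(LINT s|lborel. ?I s * Q s * tail \<xi> s) = (LINT t|lborel. F t * \<xi> t)" .
    have 2: "(LINT s|lborel. ?I s * (s powr (?n - 1) * (\<xi> s * A s))) = (LINT t|lborel. (t powr (?n - 1) * A t) * \<xi> t)"
    proof (rule Bochner_Integration.integral_cong[OF refl])
      fix t show "?I t * (t powr (?n - 1) * (\<xi> t * A t)) = (t powr (?n - 1) * A t) * \<xi> t"
        using smooth_suppD(2)[OF \<xi>, of t] xy by (cases "t \<in> {x..y}") (auto simp: indicator_def)
    qed
    have "(LINT t|lborel. (t powr (?n - 1) * A t + F t) * \<xi> t) = (LINT t|lborel. (t powr (?n - 1) * A t) * \<xi> t) + (LINT t|lborel. F t * \<xi> t)"
      unfolding distrib_right
      by (rule Bochner_Integration.integral_add[OF set_integrable_mult_smooth_supp[OF si1[OF xy] \<xi>] set_integrable_mult_smooth_supp[OF si2[OF xy] \<xi>]])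
    then show "(LINT t|lborel. (t powr (?n - 1) * A t + F t) * \<xi> t) = 0"
      using 1 2 main(3)[OF xy \<xi>] by simp
  qed
  then show "AE t in lborel. t \<in> {0<..<1} \<longrightarrow>
       t powr (?n - 1) * (sgn (d t) * g \<bar>d t\<bar>) = - (LINT s:{0<..<t}|lborel. Q s)"
    by (rule eventually_mono) (auto simp: A_def F_def)
qed

text \<open>The right-hand side of the flux identity has a sign, which forces d \<le> 0 almost
  everywhere; the resulting monotonicity of W upgrades positivity from almost all points to every
  radius.\<close>

lemma radial_solution_profile:
  fixes u :: "'a::euclidean_space \<Rightarrow> real"
  assumes G: "N_function g G" and H: "N_function h H"
    and rad: "u \<in> X_rad (ball 0 1) G" and sol: "weak_solution (ball 0 1) \<alpha> g G h u"
  shows "\<exists>\<gamma> w. (\<forall>r. \<gamma> r \<ge> 0) \<and>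
    (\<forall>r t. 0 < r \<longrightarrow> r \<le> t \<longrightarrow> t < 1 \<longrightarrow> set_integrable lborel {r..t} \<gamma> \<and> w r - w t = (LINT s:{r..t}|lborel. \<gamma> s)) \<and>
    (\<forall>r. 0 < r \<longrightarrow> r < 1 \<longrightarrow> w r > 0 \<and>
      set_integrable lborel {0<..<r} (\<lambda>s. s powr (\<alpha> + real DIM('a) - 1) * h (w s))) \<and>
    set_integrable lborel {0<..<1} (\<lambda>s. s powr (real DIM('a) - 1) * G (\<gamma> s)) \<and>
    (AE t in lborel. t \<in> {0<..<1} \<longrightarrow> t powr (real DIM('a) - 1) * g (\<gamma> t)
      = (LINT s:{0<..<t}|lborel. s powr (\<alpha> + real DIM('a) - 1) * h (w s))) \<and>
    (AE x in lebesgue. x \<in> ball 0 1 \<longrightarrow> u x = w (norm x))"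
proof -
  let ?n = "real DIM('a)" and ?B = "ball 0 1 :: 'a set"
  let ?I = "\<lambda>s. indicator {0<..<1} s :: real"
  define c where "c = unit_ball_vol ?n * ?n"
  have c: "c > 0" by (simp add: c_def)
  have B: "?B \<in> sets lebesgue" "open ?B" "bounded ?B" by auto
  define U where "U = weak_gradient ?B u"
  obtain \<rho> where \<rho>: "AE x in lebesgue_on ?B. u x = \<rho> (norm x)" using rad by (auto simp: X_rad_def)
  have u_os: "u \<in> orlicz_sobolev ?B G" using rad by (auto simp: X_rad_def orlicz_sobolev_0_def)
  then obtain V where V: "has_weak_gradient ?B u V" by (auto simp: orlicz_sobolev_def)
  have wg: "has_weak_gradient ?B u U"
    unfolding U_def weak_gradient_def by (rule someI[where P="has_weak_gradient ?B u", OF V])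
  have um: "u \<in> borel_measurable (lebesgue_on ?B)" and Um: "U \<in> borel_measurable (lebesgue_on ?B)"
    using wg by (simp_all add: has_weak_gradient_def)
  have ui: "integrable (lebesgue_on ?B) u"
    by (rule integrable_of_modular(1)[OF G B(2,3) um]) (use u_os in \<open>simp add: orlicz_sobolev_def orlicz_space_def\<close>)
  have Ufin: "(\<integral>\<^sup>+x. ennreal (G (norm (U x))) \<partial>lebesgue_on ?B) < \<infinity>"
    using u_os by (simp add: orlicz_sobolev_def U_def)
  have Ui: "integrable (lebesgue_on ?B) U" and GUi: "integrable (lebesgue_on ?B) (\<lambda>x. G (norm (U x)))"
    by (rule integrable_of_modular[OF G B(2,3) Um Ufin])+
  obtain W d where d: "\<And>x y. 0 < x \<Longrightarrow> x < y \<Longrightarrow> y < 1 \<Longrightarrow> set_integrable lborel {x..y} d"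
    and dm: "d \<in> borel_measurable borel"
    and W: "\<And>x y. 0 < x \<Longrightarrow> x \<le> y \<Longrightarrow> y < 1 \<Longrightarrow> W y - W x = (LINT s:{x..y}|lborel. d s)"
    and uW: "AE x in lebesgue. x \<in> ?B \<longrightarrow> u x = W (norm x)"
    using radial_profile[OF wg ui Ui \<rho>] by blast
  have Ud: "AE x in lebesgue. x \<in> ?B \<longrightarrow> U x = d (norm x) *\<^sub>R sgn x"
    by (rule radial_weak_gradient[OF wg Ui d dm W uW])
  have flux1: "set_integrable lborel {0<..<r} (\<lambda>s. s powr (\<alpha> + ?n - 1) * h (max (W s) 0))" if "0 < r" "r < 1" for r
    by (rule radial_flux(1)[where d=d, OF G H sol _ dm _ uW Ud[unfolded U_def] that]) (fact d W)+
  have flux2: "AE t in lborel. t \<in> {0<..<1} \<longrightarrow>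
      t powr (?n - 1) * (sgn (d t) * g \<bar>d t\<bar>) = - (LINT s:{0<..<t}|lborel. s powr (\<alpha> + ?n - 1) * h (max (W s) 0))"
    by (rule radial_flux(2)[where d=d, OF G H sol _ dm _ uW Ud[unfolded U_def]]) (fact d W)+
  have d': "set_integrable lborel {x..y} d" if "0 < x" "x \<le> y" "y < 1" for x y
  proof (rule set_integrable_subset)
    show "set_integrable lborel {x..(1 + y) / 2} d" using that by (intro d) auto
  qed (use that in auto)

  have d_le: "AE t in lborel. t \<in> {0<..<1} \<longrightarrow> d t \<le> 0"
    using flux2
  proof eventually_elim
    case (elim t)
    show ?case
    proof (intro impI leI notI)
      assume t: "t \<in> {0<..<1}" and "0 < d t"
      have "0 \<le> (LINT s:{0<..<t}|lborel. s powr (\<alpha> + ?n - 1) * h (max (W s) 0))"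
        unfolding set_lebesgue_integral_def
        using N_function_nonneg[OF H] by (intro Bochner_Integration.integral_nonneg) (auto simp: indicator_def)
      then have "t powr (?n - 1) * g (d t) \<le> 0" using elim t \<open>0 < d t\<close> by simp
      moreover have "t powr (?n - 1) * g (d t) > 0" using t N_function_pos[OF G \<open>0 < d t\<close>] by simp
      ultimately show False by linarith
    qed
  qed
  \<comment> \<open>The absolute value is nonnegative everywhere, whereas -d is so only almost
    everywhere; their integrals agree.\<close>
  define \<gamma> where "\<gamma> t = \<bar>d t\<bar>" for t
  have \<gamma>i: "set_integrable lborel {x..y} \<gamma>" if "0 < x" "x \<le> y" "y < 1" for x y
    unfolding \<gamma>_def[abs_def] by (rule set_integrable_abs[OF d'[OF that]])
  have W\<gamma>: "W x - W y = (LINT s:{x..y}|lborel. \<gamma> s)" if xy: "0 < x" "x \<le> y" "y < 1" for x y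
  proof -
    have "(LINT s:{x..y}|lborel. \<gamma> s) = (LINT s:{x..y}|lborel. - d s)"
      unfolding set_lebesgue_integral_def
    proof (rule integral_cong_AE)
      show "(\<lambda>s. indicator {x..y} s *\<^sub>R \<gamma> s) \<in> borel_measurable lborel"
        using borel_measurable_integrable \<gamma>i[OF xy] unfolding set_integrable_def by blast
      show "(\<lambda>s. indicator {x..y} s *\<^sub>R - d s) \<in> borel_measurable lborel" using dm by measurable
      show "AE s in lborel. indicator {x..y} s *\<^sub>R \<gamma> s = indicator {x..y} s *\<^sub>R - d s"
        using d_le by eventually_elim (use xy in \<open>auto simp: \<gamma>_def indicator_def\<close>)
    qed
    also have "\<dots> = - (LINT s:{x..y}|lborel. d s)" by (simp add: set_lebesgue_integral_def)
    finally show ?thesis using W[OF xy] by simp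
  qed
  have W_mono: "W y \<le> W x" if xy: "0 < x" "x \<le> y" "y < 1" for x y
  proof -
    have "0 \<le> (LINT s:{x..y}|lborel. \<gamma> s)"
      unfolding set_lebesgue_integral_def
      by (intro Bochner_Integration.integral_nonneg) (auto simp: indicator_def \<gamma>_def)
    then show ?thesis using W\<gamma>[OF xy] by simp
  qed
  have u_pos: "AE x in lebesgue. x \<in> ?B \<longrightarrow> u x > 0"
    using sol B(1) by (auto simp: weak_solution_def AE_restrict_space_iff)
  \<comment> \<open>If W r \<le> 0, then W \<le> 0 on all of (r,1), and u would fail to be positive
    on a shell of positive measure.\<close>
  have W_pos: "W r > 0" if r: "0 < r" "r < 1" for r
  proof (rule ccontr)
    assume "\<not> W r > 0"
    then have le: "W s \<le> 0" if "s \<in> {r<..<1}" for s using W_mono[of r s] r that by auto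
    have "AE x::'a in lebesgue. norm x \<notin> {r<..<1}"
      using uW u_pos
    proof eventually_elim
      case (elim x)
      show ?case
      proof
        assume x: "norm x \<in> {r<..<1}"
        then have "x \<in> ?B" by simp
        then show False using elim le[OF x] by simp
      qed
    qed
    then have "AE s in lborel. 0 < s \<longrightarrow> s \<notin> {r<..<1}" by (rule AE_radialD) simp
    then have "AE s in lborel. s \<notin> {r<..<1}" by eventually_elim (use r in auto)
    then have "{r<..<1} \<in> null_sets lborel"
      by (rule AE_iff_null_sets[THEN iffD2, rotated]) simp
    from null_setsD1[OF this] show False using r by simp
  qed

  have energy: "set_integrable lborel {0<..<1} (\<lambda>s. s powr (?n - 1) * G (\<gamma> s))"
  proof -
    have Gm: "(\<lambda>t. G (max 0 t)) \<in> borel_measurable borel"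
      by (rule mono_extension_measurable) (rule N_function_le[OF G])
    have "(\<lambda>s. \<gamma> s) \<in> borel_measurable borel" unfolding \<gamma>_def using dm by measurable
    from measurable_compose[OF this Gm] have "(\<lambda>s. G (\<gamma> s)) \<in> borel_measurable borel" by (simp add: \<gamma>_def)
    then have m: "(\<lambda>s. ?I s * G (\<gamma> s)) \<in> borel_measurable borel" by measurable
    have n0: "AE x in lebesgue. x \<notin> {0::'a}" by (rule AE_not_in) (simp add: null_sets_def)
    have I: "integrable lebesgue (\<lambda>x. indicator ?B x *\<^sub>R G (norm (U x)))"
      using GUi unfolding integral_lebesgue_on(2)[OF B(1)] .
    have ae: "AE x in lebesgue. indicator ?B x *\<^sub>R G (norm (U x)) = ?I (norm x) * G (\<gamma> (norm x))"
      using Ud n0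
    proof eventually_elim
      case (elim x)
      then show ?case by (cases "x \<in> ?B") (auto simp: \<gamma>_def norm_sgn)
    qed
    have J: "integrable lebesgue (\<lambda>x::'a. ?I (norm x) * G (\<gamma> (norm x)))"
      using integrable_cong_AE[OF borel_measurable_integrable[OF I] measurable_norm_compose[OF m] ae] I by simp
    have pd: "polar_density DIM('a) s * (?I s * G (\<gamma> s)) = c * (?I s * (s powr (?n - 1) * G (\<gamma> s)))" for s
      using polar_density_eq_powr[of "DIM('a)" s] by (cases "s \<in> {0<..<1}") (auto simp: c_def)
    have "integrable lborel (\<lambda>s. c * (?I s * (s powr (?n - 1) * G (\<gamma> s))))"
      by (rule radial_integral(1)[OF m, where 'a='a, THEN iffD1, OF J, unfolded pd])
    then show ?thesis using c by (simp add: set_integrable_def)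
  qed

  have hW: "h (max (W s) 0) = h (W s)" if "s \<in> {0<..<r}" "r \<le> 1" for s r
    using W_pos[of s] that by (simp add: max_def)
  have Fi: "set_integrable lborel {0<..<r} (\<lambda>s. s powr (\<alpha> + ?n - 1) * h (W s))" if r: "0 < r" "r < 1" for r
  proof -
    have "set_integrable lborel {0<..<r} (\<lambda>s. s powr (\<alpha> + ?n - 1) * h (W s)) \<longleftrightarrow>
        set_integrable lborel {0<..<r} (\<lambda>s. s powr (\<alpha> + ?n - 1) * h (max (W s) 0))"
      by (rule set_integrable_cong) (use hW[of _ r] r in auto)
    then show ?thesis using flux1[OF r] by blast
  qed
  have fl: "AE t in lborel. t \<in> {0<..<1} \<longrightarrow> t powr (?n - 1) * g (\<gamma> t)
      = (LINT s:{0<..<t}|lborel. s powr (\<alpha> + ?n - 1) * h (W s))"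
    using flux2 d_le
  proof eventually_elim
    case (elim t)
    show ?case
    proof
      assume t: "t \<in> {0<..<1}"
      have "(LINT s:{0<..<t}|lborel. s powr (\<alpha> + ?n - 1) * h (W s)) = (LINT s:{0<..<t}|lborel. s powr (\<alpha> + ?n - 1) * h (max (W s) 0))"
        by (rule set_lebesgue_integral_cong) (use hW t in auto)
      moreover have "sgn (d t) * g \<bar>d t\<bar> = - g (\<gamma> t)"
        using elim(2) t N_function_zero[OF G] G by (cases "d t = 0") (auto simp: \<gamma>_def N_function_def)
      ultimately show "t powr (?n - 1) * g (\<gamma> t) = (LINT s:{0<..<t}|lborel. s powr (\<alpha> + ?n - 1) * h (W s))"
        using elim(1) t by simp
    qed
  qed
  show ?thesis
    using \<gamma>i W\<gamma> W_pos energy Fi fl uW by (intro exI[of _ \<gamma>] exI[of _ W] conjI allI impI) (simp_all add: \<gamma>_def)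
qed

section \<open>Boundedness of radial solutions\<close>

lemma radial_solution_bounded:
  fixes u :: "'a::euclidean_space \<Rightarrow> real"
  assumes alpha: "\<alpha> > 0" and G: "N_function g G" and H: "N_function h H"
    and exponents: "1 < pm" "1 < pp" "pp < real DIM('a)" "1 < qp"
    and G_growth: "\<And>t. t \<ge> 0 \<Longrightarrow> pm * G t \<le> t * g t \<and> t * g t \<le> pp * G t"
    and H_growth: "\<And>t. t \<ge> 0 \<Longrightarrow> qm * H t \<le> t * h t \<and> t * h t \<le> qp * H t"
    and pq: "pp < qm"
    and R: "N_function R' R"
    and R_growth: "growth_condition DIM('a) \<alpha> G R"
    and qr: "qp < (INF t\<in>{0<..}. t * R' t / R t)"
    and rad: "u \<in> X_rad (ball 0 1) G"
    and sol: "weak_solution (ball 0 1) \<alpha> g G h u"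
  shows "\<exists>C>0. AE x in lebesgue_on (ball 0 1). \<bar>u x\<bar> \<le> C"
proof -
  let ?n = "DIM('a)"
  obtain \<gamma> w where \<gamma>: "\<And>r. \<gamma> r \<ge> 0"
    and \<gamma>w: "\<And>r t. 0 < r \<Longrightarrow> r \<le> t \<Longrightarrow> t < 1 \<Longrightarrow> set_integrable lborel {r..t} \<gamma>"
      "\<And>r t. 0 < r \<Longrightarrow> r \<le> t \<Longrightarrow> t < 1 \<Longrightarrow> w r - w t = (LINT s:{r..t}|lborel. \<gamma> s)"
    and w: "\<And>r. 0 < r \<Longrightarrow> r < 1 \<Longrightarrow> w r > 0"
      "\<And>r. 0 < r \<Longrightarrow> r < 1 \<Longrightarrow> set_integrable lborel {0<..<r} (\<lambda>s. s powr (\<alpha> + real ?n - 1) * h (w s))"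
    and energy: "set_integrable lborel {0<..<1} (\<lambda>s. s powr (real ?n - 1) * G (\<gamma> s))"
    and flux: "AE t in lborel. t \<in> {0<..<1} \<longrightarrow> t powr (real ?n - 1) * g (\<gamma> t)
      = (LINT s:{0<..<t}|lborel. s powr (\<alpha> + real ?n - 1) * h (w s))"
    and uw: "AE x in lebesgue. x \<in> ball 0 1 \<longrightarrow> u x = w (norm x)"
  proof -
    from radial_solution_profile[OF G H rad sol] show ?thesis
    proof (elim exE conjE)
      fix \<gamma> w
      assume *: "\<forall>r. \<gamma> r \<ge> 0"
        "\<forall>r t. 0 < r \<longrightarrow> r \<le> t \<longrightarrow> t < 1 \<longrightarrow> set_integrable lborel {r..t} \<gamma> \<and> w r - w t = (LINT s:{r..t}|lborel. \<gamma> s)"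
        "\<forall>r. 0 < r \<longrightarrow> r < 1 \<longrightarrow> w r > 0 \<and>
          set_integrable lborel {0<..<r} (\<lambda>s. s powr (\<alpha> + real ?n - 1) * h (w s))"
        and ** : "set_integrable lborel {0<..<1} (\<lambda>s. s powr (real ?n - 1) * G (\<gamma> s))"
        "AE t in lborel. t \<in> {0<..<1} \<longrightarrow> t powr (real ?n - 1) * g (\<gamma> t)
          = (LINT s:{0<..<t}|lborel. s powr (\<alpha> + real ?n - 1) * h (w s))"
        "AE x in lebesgue. x \<in> ball 0 1 \<longrightarrow> u x = w (norm x)"
      show ?thesis
        by (rule that[of \<gamma> w, OF _ _ _ _ _ **]) (use * in simp_all)
    qed
  qed
  define \<rho> where "\<rho> = (INF t\<in>{0<..}. t * R' t / R t)"
  \<comment> \<open>The infimum is taken in the reals, so it is a lower bound only because the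
    quotients are bounded below by 0.\<close>
  have R\<rho>: "\<rho> * R t \<le> t * R' t" if "t > 0" for t
  proof -
    have "bdd_below ((\<lambda>t. t * R' t / R t) ` {0<..})"
      using N_function_pos[OF R] N_function_value_pos[OF R] by (intro bdd_belowI2[of _ 0]) (simp add: less_imp_le)
    then have "\<rho> \<le> t * R' t / R t" unfolding \<rho>_def using that by (intro cINF_lower) auto
    then show ?thesis using N_function_value_pos[OF R that] by (simp add: field_simps)
  qed
  define m where "m s = (SOME t. t > 0 \<and> G t = s powr - real ?n)" for s
  have m: "m s > 0 \<and> G (m s) = s powr - real ?n" if "s > 0" for s
  proof -
    have "\<exists>t>0. G t = s powr - real ?n" by (rule N_function_surj[OF G]) (use that in simp)
    then show ?thesis unfolding m_def by (rule someI_ex)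
  qed
  \<comment> \<open>The gain delivered by \<open>H_profile_bound\<close> with a = \<alpha> + n; it
    is positive because qp < \<rho>.\<close>
  define \<delta> where "\<delta> = (\<alpha> + real ?n) * (1 - qp / \<rho>)"
  have \<delta>: "\<delta> > 0" using qr exponents alpha by (simp add: \<delta>_def \<rho>_def[symmetric])
  have Gu: "t * g t \<le> pp * G t" if "t > 0" for t using G_growth[of t] that by simp
  have Hu: "t * h t \<le> qp * H t" if "t > 0" for t using H_growth[of t] that by simp
  have n1: "?n \<ge> 1" using DIM_positive[where 'a='a] by simp
  have C0: "\<exists>C>0. \<forall>r. 0 < r \<longrightarrow> r \<le> 1/2 \<longrightarrow> R (r * m r / (1 + 2 ^ ?n)) \<le> C * r powr - (\<alpha> + real ?n)"
  proof (rule growth_condition_pointwise[OF G _ _ _ _ R R_growth n1 alpha])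
    show "0 < pp" "pp \<le> real ?n" using exponents by simp_all
  qed (fact Gu m)+
  then obtain C where C: "C > 0" "\<And>r. 0 < r \<Longrightarrow> r \<le> 1/2 \<Longrightarrow> R (r * m r / (1 + 2 ^ ?n)) \<le> C * r powr - (\<alpha> + real ?n)"
    by (elim exE conjE) simp
  have HM: "\<exists>C1>0. \<forall>r. 0 < r \<longrightarrow> r \<le> 1/2 \<longrightarrow> H (K * (r * m r)) \<le> C1 * r powr (\<delta> - (\<alpha> + real ?n))" if K: "K > 0" for K
    unfolding \<delta>_def
  proof (rule H_profile_bound[OF H _ _ R _ _ _ _ C(1) _ _ K])
    show "0 < 1 / (1 + 2 ^ ?n :: real)" by (simp add: add_pos_pos)
    show "R (1 / (1 + 2 ^ ?n) * (r * m r)) \<le> C * r powr - (\<alpha> + real ?n)" if "0 < r" "r \<le> 1/2" for r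
      using C(2)[OF that] by simp
    show "0 < r * m r" if "0 < r" for r using m[OF that] that by simp
    show "0 < qp" "qp < \<rho>" "0 < \<alpha> + real ?n" using exponents qr alpha by (simp_all add: \<rho>_def)
  qed (fact Hu R\<rho>)+
  have "radial_ode ?n \<alpha> pm pp qm qp \<delta> g G h H m \<gamma> w"
  proof (rule radial_ode.intro)
    show "\<And>t. t > 0 \<Longrightarrow> pm * G t \<le> t * g t" "\<And>t. t > 0 \<Longrightarrow> qm * H t \<le> t * h t"
      using G_growth H_growth by simp_all
    show "0 < qp" "pp \<le> qm" using exponents pq by simp_all
    show "\<And>r. 0 < r \<Longrightarrow> r < 1 \<Longrightarrow> 0 \<le> \<gamma> r" by (rule \<gamma>)
  qed (fact n1 G H exponents Gu Hu m \<delta> HM \<gamma>w w energy flux)+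
  from radial_ode.w_bounded[OF this] obtain C where C: "C > 0" "\<And>r. 0 < r \<Longrightarrow> r < 1 \<Longrightarrow> w r \<le> C"
    by (elim exE conjE) simp
  have n0: "AE x in lebesgue. x \<notin> {0::'a}" by (rule AE_not_in) (simp add: null_sets_def)
  have "AE x in lebesgue. x \<in> ball 0 1 \<longrightarrow> \<bar>u x\<bar> \<le> C"
    using uw n0
  proof eventually_elim
    case (elim x)
    show ?case
    proof
      assume "x \<in> ball 0 1"
      then have "0 < norm x" "norm x < 1" "u x = w (norm x)" using elim by auto
      then show "\<bar>u x\<bar> \<le> C" using C(2)[of "norm x"] w(1)[of "norm x"] by simp
    qed
  qed
  then have "AE x in lebesgue_on (ball 0 1). \<bar>u x\<bar> \<le> C"
    by (subst AE_restrict_space_iff) auto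
  then show ?thesis using C(1) by blast
qed

theorem theorem1p2:
  fixes u :: "real ^ 'n \<Rightarrow> real"
    and g G h H R' R :: "real \<Rightarrow> real"
    and \<alpha> p\<^sub>m p\<^sub>p q\<^sub>m q\<^sub>p :: real
  assumes n: "CARD('n) \<ge> 2"
    and alpha: "\<alpha> > 0"
    and G: "N_function g G"
    and H: "N_function h H"
    and exponents: "{p\<^sub>m, p\<^sub>p, q\<^sub>m, q\<^sub>p} \<subseteq> {1<..<real CARD('n)}"
    and G_growth: "\<And>t. t \<ge> 0 \<Longrightarrow> p\<^sub>m * G t \<le> t * g t \<and> t * g t \<le> p\<^sub>p * G t"
    and H_growth: "\<And>t. t \<ge> 0 \<Longrightarrow> q\<^sub>m * H t \<le> t * h t \<and> t * h t \<le> q\<^sub>p * H t"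
    and pq: "p\<^sub>p < q\<^sub>m"
    and R: "N_function R' R"
    and R_growth: "growth_condition CARD('n) \<alpha> G R"
    and qr: "q\<^sub>p < (INF t\<in>{0<..}. t * R' t / R t)"
    and rad: "u \<in> X_rad (ball 0 1) G"
    and sol: "weak_solution (ball 0 1) \<alpha> g G h u"
  shows "\<exists>C>0. esssup (lebesgue_on (ball 0 1)) (\<lambda>x. ereal \<bar>u x\<bar>) \<le> ereal C"
proof -
  have dim: "DIM(real ^ 'n) = CARD('n)" by simp
  obtain C where C: "C > 0" "AE x in lebesgue_on (ball 0 1). \<bar>u x\<bar> \<le> C"
    using radial_solution_bounded[OF alpha G H _ _ _ _ G_growth H_growth pq R _ qr rad sol] exponents R_growth
    by (auto simp: dim)
  \<comment> \<open>\<open>esssup\<close> is the top element for a non-measurable function, so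
    measurability has to be supplied.\<close>
  have "u \<in> borel_measurable (lebesgue_on (ball 0 1))"
    using rad by (simp add: X_rad_def orlicz_sobolev_0_def orlicz_sobolev_def orlicz_space_def)
  then have "(\<lambda>x. ereal \<bar>u x\<bar>) \<in> borel_measurable (lebesgue_on (ball 0 1))" by measurable
  then have "esssup (lebesgue_on (ball 0 1)) (\<lambda>x. ereal \<bar>u x\<bar>) \<le> ereal C"
    by (rule esssup_I) (use C(2) in simp)
  then show ?thesis using C(1) by blast
qed

end
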